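(* Let $k\in\mathbb{N}$ and let $\mathbb{D}_Q\subset\mathbb{M}^d$ be an NC operator ball. Then $\mathcal{X}_k(\mathbb{D}_Q)$ is the unique pre-dual $\mathcal{X}_k$ of $M_k(H^\infty(\mathbb{D}_Q))$ such that the matrix point-evaluation maps $\Phi_X$ are $\sigma(M_k(H^\infty(\mathbb{D}_Q)),\mathcal{X}_k)$-continuous for all $X\in\mathbb{D}_Q$.
   Context: Fix $d\in\mathbb{N}$. Write $M_n$ for the complex $n\times n$ matrices, $M_n^d$ for $d$-tuples of such matrices, and $\mathbb{M}^d=\bigsqcup_{n\ge1}M_n^d$; for $\Omega\subseteq\mathbb{M}^d$ let $\Omega(n)=\Omega\cap M_n^d$. Let $\mathcal{H}$ be a Hilbert space, let $\mathcal{E}\subseteq B(\mathcal{H})$ be a $d$-dimensional linear subspace (operator space) with basis $Q_1,\dots,Q_d$, and put $Q(X)=\sum_{j=1}^d Q_j\otimes X_j\in B(\mathcal{H}\otimes\mathbb{C}^n)$ for $X\in M_n^d$. The NC operator ball is $\mathbb{D}_Q=\{X\in\mathbb{M}^d:\|Q(X)\|<1\}$. A function $F:\mathbb{D}_Q\to\mathbb{M}^1$ is NC if $F(X)\in M_n$ for $X\in\mathbb{D}_Q(n)$, $F(X\oplus Y)=F(X)\oplus F(Y)$ for $X,Y\in\mathbb{D}_Q$, and $F(S^{-1}XS)=S^{-1}F(X)S$ whenever $X,S^{-1}XS\in\mathbb{D}_Q(n)$, $S\in GL_n$. $H^\infty(\mathbb{D}_Q)$ is the Banach algebra of NC functions $F$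 on $\mathbb{D}_Q$ with $\|F\|_Q=\sup_{X\in\mathbb{D}_Q}\|F(X)\|<\infty$. $M_k(H^\infty(\mathbb{D}_Q))=M_k\otimes H^\infty(\mathbb{D}_Q)$ has norm $\|F\|_Q=\sup_{X\in\mathbb{D}_Q}\|(F_{ij}(X))\|$. For $X\in\mathbb{D}_Q(n)$, $\Phi_X:M_k(H^\infty(\mathbb{D}_Q))\to M_k(M_n)$ is $\Phi_X(F)=F(X)=(F_{ij}(X))$. Let $\mathcal{X}(\mathbb{D}_Q)$ be the norm-closed span in $(H^\infty(\mathbb{D}_Q))^*$ of all functionals $F\mapsto\eta(F(X))$ with $n\in\mathbb{N}$, $X\in\mathbb{D}_Q(n)$, $\eta\in M_n^*$, and let $\mathcal{X}_k(\mathbb{D}_Q)=M_k^*\otimes\mathcal{X}(\mathbb{D}_Q)$, a closed subspace of $(M_k(H^\infty(\mathbb{D}_Q)))^*$; concretely, it consists of all functionals $(F_{ij})\mapsto\sum_{i,j}\varphi_{ij}(F_{ij})$ with $\varphi_{ij}\in\mathcal{X}(\mathbb{D}_Q)$. A pre-dual of a Banach space $\mathcal{Y}$ is a norm-closed subspace $\mathcal{X}\subset\mathcal{Y}^*$ such that, when elements of $\mathcal{Y}$ are viewed as bounded functionals on $\mathcal{X}$ via the canonical embedding $\mathcal{Y}\subset\mathcal{Y}^{**}$, one has $\mathcal{Y}=\mathcal{X}^*$ (isometrically). $\sigma(\mathcal{Y},\mathcal{X})$ is the coarsest topology on $\mathcal{Y}$ making every $\varphi\in\mathcal{X}$ continuous.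 *)

theory Defs
  imports
    "HOL-Library.FuncSet"
    "HOL-Analysis.L2_Norm"
    "HOL-Analysis.Abstract_Metric_Spaces"
    "Jordan_Normal_Form.Matrix"
begin

section \<open>Complex Hilbert spaces and operator spaces\<close>

class complex_hilbert_space = banach +
  fixes scaleC :: "complex \<Rightarrow> 'a \<Rightarrow> 'a" (infixr "*\<^sub>C" 75)
    and cinner :: "'a \<Rightarrow> 'a \<Rightarrow> complex"
  assumes scaleC_add_right: "c *\<^sub>C (x + y) = c *\<^sub>C x + c *\<^sub>C y"
    and scaleC_add_left: "(b + c) *\<^sub>C x = b *\<^sub>C x + c *\<^sub>C x"
    and scaleC_scaleC: "b *\<^sub>C c *\<^sub>C x = (b * c) *\<^sub>C x"
    and scaleR_scaleC: "r *\<^sub>R x = complex_of_real r *\<^sub>C x"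
    and cinner_commute: "cinner x y = cnj (cinner y x)"
    and cinner_add_left: "cinner (x + y) z = cinner x z + cinner y z"
    and cinner_scaleC_left: "cinner (c *\<^sub>C x) y = c * cinner x y"
    and cinner_self: "cinner x x = complex_of_real ((norm x)\<^sup>2)"

definition bounded_clinear :: "('h::complex_hilbert_space \<Rightarrow> 'h) \<Rightarrow> bool" where
  "bounded_clinear T \<longleftrightarrow> bounded_linear T \<and> (\<forall>c x. T (c *\<^sub>C x) = c *\<^sub>C T x)"

definition operator_space_basis ::
    "('h::complex_hilbert_space \<Rightarrow> 'h) set \<Rightarrow> ('d::finite \<Rightarrow> 'h \<Rightarrow> 'h) \<Rightarrow> bool" where
  "operator_space_basis E Q \<longleftrightarrow>
     (\<forall>j. bounded_clinear (Q j)) \<and>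
     E = {\<lambda>h. \<Sum>j\<in>UNIV. c j *\<^sub>C Q j h | c. True} \<and>
     (\<forall>c. (\<lambda>h. \<Sum>j\<in>UNIV. c j *\<^sub>C Q j h) = (\<lambda>h. 0) \<longrightarrow> (\<forall>j. c j = 0))"


section \<open>Normed spaces on a carrier, their duals and pre-duals\<close>

text \<open>
  The Banach space of bounded NC functions depends on the tuple \<open>Q\<close>, so it cannot be a type;
  complex normed spaces are therefore given by a carrier set and explicit operations.
\<close>

record 'a nspace =
  ns_carrier :: "'a set"
  ns_add :: "'a \<Rightarrow> 'a \<Rightarrow> 'a"
  ns_scale :: "complex \<Rightarrow> 'a \<Rightarrow> 'a"
  ns_norm :: "'a \<Rightarrow> real"

text \<open>The value off the carrier is irrelevant to the topology; 0 makes this a total metric.\<close>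

definition ns_dist :: "'a nspace \<Rightarrow> 'a \<Rightarrow> 'a \<Rightarrow> real" where
  "ns_dist V x y =
     (if x \<in> ns_carrier V \<and> y \<in> ns_carrier V
      then ns_norm V (ns_add V x (ns_scale V (- 1) y)) else 0)"

definition norm_topology :: "'a nspace \<Rightarrow> 'a topology" where
  "norm_topology V = Metric_space.mtopology (ns_carrier V) (ns_dist V)"

definition ns_subspace :: "'a nspace \<Rightarrow> 'a set \<Rightarrow> bool" where
  "ns_subspace V W \<longleftrightarrow> W \<subseteq> ns_carrier V \<and> W \<noteq> {} \<and>
     (\<forall>x\<in>W. \<forall>y\<in>W. ns_add V x y \<in> W) \<and> (\<forall>c. \<forall>x\<in>W. ns_scale V c x \<in> W)"

definition ns_span :: "'a nspace \<Rightarrow> 'a set \<Rightarrow> 'a set" where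
  "ns_span V S = \<Inter>{W. ns_subspace V W \<and> S \<subseteq> W}"

text \<open>
  Functionals are extensional: they take the value \<open>undefined\<close> off the carrier, so that
  functionals agreeing on the space are equal.
\<close>

definition ns_dual :: "'a nspace \<Rightarrow> ('a \<Rightarrow> complex) nspace" where
  "ns_dual V = \<lparr>
     ns_carrier = {\<phi> \<in> extensional (ns_carrier V).
       (\<forall>x\<in>ns_carrier V. \<forall>y\<in>ns_carrier V. \<phi> (ns_add V x y) = \<phi> x + \<phi> y) \<and>
       (\<forall>c. \<forall>x\<in>ns_carrier V. \<phi> (ns_scale V c x) = c * \<phi> x) \<and>
       (\<exists>B. \<forall>x\<in>ns_carrier V. cmod (\<phi> x) \<le> B * ns_norm V x)},
     ns_add = (\<lambda>\<phi> \<psi>. \<lambda>x\<in>ns_carrier V. \<phi> x + \<psi> x),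
     ns_scale = (\<lambda>c \<phi>. \<lambda>x\<in>ns_carrier V. c * \<phi> x),
     ns_norm = (\<lambda>\<phi>. Sup {cmod (\<phi> x) | x. x \<in> ns_carrier V \<and> ns_norm V x \<le> 1}) \<rparr>"

definition ns_restrict :: "'a nspace \<Rightarrow> 'a set \<Rightarrow> 'a nspace" where
  "ns_restrict V W = V\<lparr>ns_carrier := W\<rparr>"

definition is_predual :: "'a nspace \<Rightarrow> ('a \<Rightarrow> complex) set \<Rightarrow> bool" where
  "is_predual Y \<X> \<longleftrightarrow>
     ns_subspace (ns_dual Y) \<X> \<and>
     closedin (norm_topology (ns_dual Y)) \<X> \<and>
     (let X' = ns_dual (ns_restrict (ns_dual Y) \<X>); \<iota> = (\<lambda>y. \<lambda>\<phi>\<in>\<X>. \<phi> y) in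
       bij_betw \<iota> (ns_carrier Y) (ns_carrier X') \<and>
       (\<forall>y\<in>ns_carrier Y. ns_norm X' (\<iota> y) = ns_norm Y y))"

definition weak_topology :: "'a nspace \<Rightarrow> ('a \<Rightarrow> complex) set \<Rightarrow> 'a topology" where
  "weak_topology Y \<X> =
     topology_generated_by {\<phi> -` U \<inter> ns_carrier Y | \<phi> U. \<phi> \<in> \<X> \<and> open U}"

text \<open>The space of \<open>k \<times> k\<close> matrices over \<open>V\<close>, with a prescribed norm.\<close>

definition mat_amp :: "nat \<Rightarrow> 'a nspace \<Rightarrow> ('a mat \<Rightarrow> real) \<Rightarrow> 'a mat nspace" where
  "mat_amp k V nrm = \<lparr>
     ns_carrier = {A \<in> carrier_mat k k. \<forall>i<k. \<forall>j<k. A $$ (i, j) \<in> ns_carrier V},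
     ns_add = (\<lambda>A B. Matrix.mat k k (\<lambda>(i, j). ns_add V (A $$ (i, j)) (B $$ (i, j)))),
     ns_scale = (\<lambda>c A. Matrix.mat k k (\<lambda>(i, j). ns_scale V c (A $$ (i, j)))),
     ns_norm = nrm \<rparr>"


section \<open>Matrix spaces\<close>

definition mat_norm :: "complex mat \<Rightarrow> real" where
  "mat_norm A = Sup {L2_set (\<lambda>i. cmod (vec_index (A *\<^sub>v v) i)) {..<dim_row A} | v.
     v \<in> carrier_vec (dim_col A) \<and> L2_set (\<lambda>i. cmod (vec_index v i)) {..<dim_col A} \<le> 1}"

definition mat_space :: "nat \<Rightarrow> complex mat nspace" where
  "mat_space n = \<lparr> ns_carrier = carrier_mat n n, ns_add = (+), ns_scale = (\<cdot>\<^sub>m),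
     ns_norm = mat_norm \<rparr>"

text \<open>\<open>M\<^sub>k(M\<^sub>n)\<close> is normed by identifying a block matrix with a matrix of size \<open>k * n\<close>.\<close>

definition flatten_blocks :: "nat \<Rightarrow> nat \<Rightarrow> complex mat mat \<Rightarrow> complex mat" where
  "flatten_blocks k n A =
     Matrix.mat (k * n) (k * n) (\<lambda>(i, j). (A $$ (i div n, j div n)) $$ (i mod n, j mod n))"

definition block_mat_space :: "nat \<Rightarrow> nat \<Rightarrow> complex mat mat nspace" where
  "block_mat_space k n = mat_amp k (mat_space n) (\<lambda>A. mat_norm (flatten_blocks k n A))"


section \<open>NC operator balls and bounded NC functions\<close>

text \<open>
  The Hilbert space \<open>H \<otimes> \<complex>\<^sup>n\<close> is the \<open>n\<close>-fold Hilbert sum of \<open>H\<close>: a family \<open>v\<close> stands for the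
  sum of the \<open>v b \<otimes> e\<^sub>b\<close> over \<open>b < n\<close>.  On such families \<open>Q(X) = \<Sum>\<^sub>j Q\<^sub>j \<otimes> X\<^sub>j\<close> acts as
  \<open>pencil_apply Q n X\<close>, since \<open>X\<^sub>j e\<^sub>b = \<Sum>\<^sub>a X\<^sub>j(a,b) e\<^sub>a\<close>.
\<close>

definition pencil_apply :: "('d::finite \<Rightarrow> 'h::complex_hilbert_space \<Rightarrow> 'h) \<Rightarrow> nat \<Rightarrow>
    ('d \<Rightarrow> complex mat) \<Rightarrow> (nat \<Rightarrow> 'h) \<Rightarrow> nat \<Rightarrow> 'h" where
  "pencil_apply Q n X v a = (\<Sum>j\<in>UNIV. \<Sum>b<n. (X j $$ (a, b)) *\<^sub>C Q j (v b))"

definition pencil_norm :: "('d::finite \<Rightarrow> 'h::complex_hilbert_space \<Rightarrow> 'h) \<Rightarrow> nat \<Rightarrow>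
    ('d \<Rightarrow> complex mat) \<Rightarrow> real" where
  "pencil_norm Q n X = Sup {L2_set (\<lambda>a. norm (pencil_apply Q n X v a)) {..<n} | v.
     L2_set (\<lambda>b. norm (v b)) {..<n} \<le> 1}"

definition nc_ball_at :: "('d::finite \<Rightarrow> 'h::complex_hilbert_space \<Rightarrow> 'h) \<Rightarrow> nat \<Rightarrow>
    ('d \<Rightarrow> complex mat) set" where
  "nc_ball_at Q n = {X. 1 \<le> n \<and> (\<forall>j. X j \<in> carrier_mat n n) \<and> pencil_norm Q n X < 1}"

definition nc_ball :: "('d::finite \<Rightarrow> 'h::complex_hilbert_space \<Rightarrow> 'h) \<Rightarrow>
    ('d \<Rightarrow> complex mat) set" where
  "nc_ball Q = (\<Union>n. nc_ball_at Q n)"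

definition mat_dsum :: "complex mat \<Rightarrow> complex mat \<Rightarrow> complex mat" where
  "mat_dsum A B =
     four_block_mat A (0\<^sub>m (dim_row A) (dim_col B)) (0\<^sub>m (dim_row B) (dim_col A)) B"

text \<open>In the similarity clause, \<open>T\<close> is the inverse of \<open>S\<close>.\<close>

definition nc_function :: "('d::finite \<Rightarrow> 'h::complex_hilbert_space \<Rightarrow> 'h) \<Rightarrow>
    (('d \<Rightarrow> complex mat) \<Rightarrow> complex mat) \<Rightarrow> bool" where
  "nc_function Q F \<longleftrightarrow>
     F \<in> extensional (nc_ball Q) \<and>
     (\<forall>n. \<forall>X\<in>nc_ball_at Q n. F X \<in> carrier_mat n n) \<and>
     (\<forall>X\<in>nc_ball Q. \<forall>Y\<in>nc_ball Q. F (\<lambda>j. mat_dsum (X j) (Y j)) = mat_dsum (F X) (F Y)) \<and>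
     (\<forall>n S T. \<forall>X\<in>nc_ball_at Q n.
        S \<in> carrier_mat n n \<longrightarrow> T \<in> carrier_mat n n \<longrightarrow> S * T = 1\<^sub>m n \<longrightarrow> T * S = 1\<^sub>m n \<longrightarrow>
        (\<lambda>j. T * X j * S) \<in> nc_ball_at Q n \<longrightarrow> F (\<lambda>j. T * X j * S) = T * F X * S)"

definition Hinf :: "('d::finite \<Rightarrow> 'h::complex_hilbert_space \<Rightarrow> 'h) \<Rightarrow>
    (('d \<Rightarrow> complex mat) \<Rightarrow> complex mat) nspace" where
  "Hinf Q = \<lparr>
     ns_carrier = {F. nc_function Q F \<and> bdd_above ((\<lambda>X. mat_norm (F X)) ` nc_ball Q)},
     ns_add = (\<lambda>F G. \<lambda>X\<in>nc_ball Q. F X + G X),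
     ns_scale = (\<lambda>c F. \<lambda>X\<in>nc_ball Q. c \<cdot>\<^sub>m F X),
     ns_norm = (\<lambda>F. SUP X\<in>nc_ball Q. mat_norm (F X)) \<rparr>"

definition matrix_eval :: "('d \<Rightarrow> complex mat) \<Rightarrow>
    (('d \<Rightarrow> complex mat) \<Rightarrow> complex mat) mat \<Rightarrow> complex mat mat" where
  "matrix_eval X F = map_mat (\<lambda>f. f X) F"

definition mat_Hinf :: "nat \<Rightarrow> ('d::finite \<Rightarrow> 'h::complex_hilbert_space \<Rightarrow> 'h) \<Rightarrow>
    (('d \<Rightarrow> complex mat) \<Rightarrow> complex mat) mat nspace" where
  "mat_Hinf k Q = mat_amp k (Hinf Q)
     (\<lambda>F. Sup {ns_norm (block_mat_space k n) (matrix_eval X F) | n X. X \<in> nc_ball_at Q n})"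


section \<open>The canonical pre-dual\<close>

definition point_functionals :: "('d::finite \<Rightarrow> 'h::complex_hilbert_space \<Rightarrow> 'h) \<Rightarrow>
    ((('d \<Rightarrow> complex mat) \<Rightarrow> complex mat) \<Rightarrow> complex) set" where
  "point_functionals Q = {\<lambda>F\<in>ns_carrier (Hinf Q). \<eta> (F X) | n X \<eta>.
     X \<in> nc_ball_at Q n \<and> \<eta> \<in> ns_carrier (ns_dual (mat_space n))}"

definition predual_X :: "('d::finite \<Rightarrow> 'h::complex_hilbert_space \<Rightarrow> 'h) \<Rightarrow>
    ((('d \<Rightarrow> complex mat) \<Rightarrow> complex mat) \<Rightarrow> complex) set" where
  "predual_X Q = norm_topology (ns_dual (Hinf Q)) closure_of
     ns_span (ns_dual (Hinf Q)) (point_functionals Q)"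

definition predual_Xk :: "nat \<Rightarrow> ('d::finite \<Rightarrow> 'h::complex_hilbert_space \<Rightarrow> 'h) \<Rightarrow>
    ((('d \<Rightarrow> complex mat) \<Rightarrow> complex mat) mat \<Rightarrow> complex) set" where
  "predual_Xk k Q = {\<lambda>F\<in>ns_carrier (mat_Hinf k Q). \<Sum>i<k. \<Sum>j<k. \<phi> i j (F $$ (i, j)) | \<phi>.
     \<forall>i<k. \<forall>j<k. \<phi> i j \<in> predual_X Q}"

end

theory Submission
  imports Defs "HOL-Analysis.Operator_Norm"
begin

text \<open>
  For a graded matrix function, to be NC is to satisfy a system of equations which are linear in
  the matrix entries of its values: the entries at \<open>X \<oplus> Y\<close> are entries at \<open>X\<close>, entries
  at \<open>Y\<close> or zero, and the entries at \<open>T * X * S\<close> are fixed linear combinations of the entries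
  at \<open>X\<close>.  The same equations therefore hold between the functionals
  \<open>e X p = (F \<mapsto> F(X)\<^sub>p)\<close> (\<open>entry_functional\<close>), and every functional \<open>\<Lambda>\<close> on their closed span \<open>\<X>(Q)\<close> yields an NC
  function with the values \<open>F(X)\<^sub>p = \<Lambda> (e X p)\<close>.  It is bounded by the norm of \<open>\<Lambda>\<close>, because
  \<open>\<Sum> w\<^sub>a u\<^sub>b e X (a, b)\<close> is a functional of norm at most 1 when \<open>w\<close> and \<open>u\<close> are unit vectors.  These
  functionals are also norming, so the bounded NC functions form the dual of \<open>\<X>(Q)\<close>
  (\<open>function_of_functional_in_Hinf\<close>, \<open>predual_X_representation\<close>).  For \<open>k \<times> k\<close> matrices the same
  argument applies entry by entry, with norming functionals taken from the flattened block matrix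
  (\<open>predual_Xk_is_predual\<close>).  The point evaluations are weakly continuous since a matrix is
  controlled by its finitely many entries, each of which is a functional in \<open>\<X>\<^sub>k(Q)\<close>
  (\<open>matrix_eval_weakly_continuous\<close>).

  Uniqueness has two halves.  A linear functional that is continuous for the weak topology given
  by \<open>\<X>\<close> lies in \<open>\<X>\<close> (\<open>weakly_continuous_functional\<close>); hence a predual \<open>\<X>\<close> for which all point
  evaluations are continuous contains the point functionals, and then \<open>\<X>\<^sub>k(Q)\<close>
  (\<open>predual_Xk_minimal\<close>).  Conversely, a predual never contains another one properly
  (\<open>predual_not_included\<close>): by the Hahn-Banach theorem there would be a non-zero functional on the
  larger one that vanishes on the smaller one; it is evaluation at some element of the space, and
  an element annihilated by a predual is zero.

  All spaces here are carriers with explicit operations, so the functional analysis is developed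
  for such carriers, including the Hahn-Banach theorem.
\<close>

section \<open>Normed spaces on carriers and their duals\<close>

text \<open>
  The part of the normed space axioms on which the theory of the dual rests: boundedness of a
  functional is a statement about the unit ball, and homogeneity carries it to the whole space.
\<close>

locale homogeneous_nspace =
  fixes V :: "'a nspace"
  assumes carrier_nonempty: "ns_carrier V \<noteq> {}"
    and add_closed: "\<lbrakk>x \<in> ns_carrier V; y \<in> ns_carrier V\<rbrakk> \<Longrightarrow> ns_add V x y \<in> ns_carrier V"
    and scale_closed: "x \<in> ns_carrier V \<Longrightarrow> ns_scale V c x \<in> ns_carrier V"
    and norm_nonneg: "x \<in> ns_carrier V \<Longrightarrow> 0 \<le> ns_norm V x"
    and norm_scale: "x \<in> ns_carrier V \<Longrightarrow> ns_norm V (ns_scale V c x) = cmod c * ns_norm V x"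

locale complex_nspace = homogeneous_nspace V for V :: "'a nspace" +
  assumes add_assoc: "\<lbrakk>x \<in> ns_carrier V; y \<in> ns_carrier V; z \<in> ns_carrier V\<rbrakk>
      \<Longrightarrow> ns_add V (ns_add V x y) z = ns_add V x (ns_add V y z)"
    and add_commute: "\<lbrakk>x \<in> ns_carrier V; y \<in> ns_carrier V\<rbrakk> \<Longrightarrow> ns_add V x y = ns_add V y x"
    and add_zero: "\<lbrakk>x \<in> ns_carrier V; y \<in> ns_carrier V\<rbrakk> \<Longrightarrow> ns_add V x (ns_scale V 0 y) = x"
    and scale_add: "\<lbrakk>x \<in> ns_carrier V; y \<in> ns_carrier V\<rbrakk>
      \<Longrightarrow> ns_scale V c (ns_add V x y) = ns_add V (ns_scale V c x) (ns_scale V c y)"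
    and add_scale: "x \<in> ns_carrier V
      \<Longrightarrow> ns_scale V (b + c) x = ns_add V (ns_scale V b x) (ns_scale V c x)"
    and scale_scale: "x \<in> ns_carrier V \<Longrightarrow> ns_scale V b (ns_scale V c x) = ns_scale V (b * c) x"
    and scale_one: "x \<in> ns_carrier V \<Longrightarrow> ns_scale V 1 x = x"
    and norm_triangle: "\<lbrakk>x \<in> ns_carrier V; y \<in> ns_carrier V\<rbrakk>
      \<Longrightarrow> ns_norm V (ns_add V x y) \<le> ns_norm V x + ns_norm V y"
    and norm_zero_imp: "\<lbrakk>x \<in> ns_carrier V; ns_norm V x = 0\<rbrakk> \<Longrightarrow> x = ns_scale V 0 x"

text \<open>
  One inequality suffices for homogeneity: applied to \<open>c\<close> and to \<open>inverse c\<close> it gives both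
  directions.
\<close>

lemma homogeneous_nspaceI:
  assumes "ns_carrier V \<noteq> {}"
    and "\<And>x y. \<lbrakk>x \<in> ns_carrier V; y \<in> ns_carrier V\<rbrakk> \<Longrightarrow> ns_add V x y \<in> ns_carrier V"
    and scale: "\<And>c x. x \<in> ns_carrier V \<Longrightarrow> ns_scale V c x \<in> ns_carrier V"
    and nonneg: "\<And>x. x \<in> ns_carrier V \<Longrightarrow> 0 \<le> ns_norm V x"
    and le: "\<And>c x. x \<in> ns_carrier V \<Longrightarrow> ns_norm V (ns_scale V c x) \<le> cmod c * ns_norm V x"
    and inv: "\<And>c x. \<lbrakk>x \<in> ns_carrier V; c \<noteq> 0\<rbrakk> \<Longrightarrow> ns_scale V (inverse c) (ns_scale V c x) = x"
  shows "homogeneous_nspace V"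
proof
  show "ns_norm V (ns_scale V c x) = cmod c * ns_norm V x" if x: "x \<in> ns_carrier V" for c x
  proof (cases "c = 0")
    case True
    then show ?thesis using le[OF x, of 0] nonneg[OF scale[OF x, of 0]] by simp
  next
    case False
    have "ns_norm V x \<le> cmod (inverse c) * ns_norm V (ns_scale V c x)"
      using le[OF scale[OF x, of c], of "inverse c"] inv[OF x False] by simp
    then have "cmod c * ns_norm V x \<le> cmod c * (cmod (inverse c) * ns_norm V (ns_scale V c x))"
      by (rule mult_left_mono) simp
    also have "\<dots> = ns_norm V (ns_scale V c x)" using False by (simp add: norm_inverse)
    finally show ?thesis using le[OF x, of c] by simp
  qed
qed (use assms in auto)

lemma dual_carrier_iff:
  "\<phi> \<in> ns_carrier (ns_dual V) \<longleftrightarrow> \<phi> \<in> extensional (ns_carrier V) \<and>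
     (\<forall>x\<in>ns_carrier V. \<forall>y\<in>ns_carrier V. \<phi> (ns_add V x y) = \<phi> x + \<phi> y) \<and>
     (\<forall>c. \<forall>x\<in>ns_carrier V. \<phi> (ns_scale V c x) = c * \<phi> x) \<and>
     (\<exists>B. \<forall>x\<in>ns_carrier V. cmod (\<phi> x) \<le> B * ns_norm V x)"
  by (simp add: ns_dual_def)

lemma dual_add: "ns_add (ns_dual V) \<phi> \<psi> = (\<lambda>x\<in>ns_carrier V. \<phi> x + \<psi> x)"
  by (simp add: ns_dual_def)

lemma dual_scale: "ns_scale (ns_dual V) c \<phi> = (\<lambda>x\<in>ns_carrier V. c * \<phi> x)"
  by (simp add: ns_dual_def)

lemma dual_norm:
  "ns_norm (ns_dual V) \<phi> = Sup {cmod (\<phi> x) | x. x \<in> ns_carrier V \<and> ns_norm V x \<le> 1}"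
  by (simp add: ns_dual_def)

lemma restrict_simps [simp]:
  "ns_carrier (ns_restrict V W) = W" "ns_add (ns_restrict V W) = ns_add V"
  "ns_scale (ns_restrict V W) = ns_scale V" "ns_norm (ns_restrict V W) = ns_norm V"
  by (simp_all add: ns_restrict_def)

context homogeneous_nspace
begin

abbreviation "carr \<equiv> ns_carrier V"
abbreviation "dual_carr \<equiv> ns_carrier (ns_dual V)"

definition "zerov = ns_scale V 0 (SOME x. x \<in> carr)"

lemma zerov: "zerov \<in> carr" "ns_norm V zerov = 0"
proof -
  have "(SOME x. x \<in> carr) \<in> carr"
    using carrier_nonempty by (simp add: some_in_eq)
  then show "zerov \<in> carr" "ns_norm V zerov = 0"
    by (simp_all add: zerov_def scale_closed norm_scale)
qed

lemma dualI:
  assumes "\<And>x y. \<lbrakk>x \<in> carr; y \<in> carr\<rbrakk> \<Longrightarrow> f (ns_add V x y) = f x + f y"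
    and "\<And>c x. x \<in> carr \<Longrightarrow> f (ns_scale V c x) = c * f x"
    and "\<And>x. x \<in> carr \<Longrightarrow> cmod (f x) \<le> B * ns_norm V x"
  shows "(\<lambda>x\<in>carr. f x) \<in> dual_carr"
  unfolding dual_carrier_iff using assms by (auto simp: add_closed scale_closed intro!: exI[of _ B])

lemma dual_zerov: "\<phi> \<in> dual_carr \<Longrightarrow> \<phi> zerov = 0"
  using zerov(1) by (auto simp: dual_carrier_iff) (metis mult_zero_right norm_le_zero_iff zerov(2))

lemma dual_add_apply:
  "\<lbrakk>\<phi> \<in> dual_carr; x \<in> carr; y \<in> carr\<rbrakk>
    \<Longrightarrow> \<phi> (ns_add V x y) = \<phi> x + \<phi> y"
  by (simp add: dual_carrier_iff)

lemma dual_scale_apply: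
  "\<lbrakk>\<phi> \<in> dual_carr; x \<in> carr\<rbrakk> \<Longrightarrow> \<phi> (ns_scale V c x) = c * \<phi> x"
  by (simp add: dual_carrier_iff)

lemma dual_norm_upper:
  assumes "\<phi> \<in> dual_carr" "x \<in> carr" "ns_norm V x \<le> 1"
  shows "cmod (\<phi> x) \<le> ns_norm (ns_dual V) \<phi>"
proof -
  obtain B where "\<forall>x\<in>carr. cmod (\<phi> x) \<le> B * ns_norm V x"
    using assms(1) unfolding dual_carrier_iff by blast
  then have B: "\<And>x. x \<in> carr \<Longrightarrow> cmod (\<phi> x) \<le> B * ns_norm V x" by blast
  have "cmod (\<phi> y) \<le> \<bar>B\<bar>" if "y \<in> carr" "ns_norm V y \<le> 1" for y
  proof -
    have "B * ns_norm V y \<le> \<bar>B\<bar> * 1"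
      by (rule mult_mono) (use that norm_nonneg[of y] in auto)
    with B[OF that(1)] show ?thesis by simp
  qed
  then show ?thesis
    unfolding dual_norm using assms(2,3) by (intro cSup_upper bdd_aboveI[where M="\<bar>B\<bar>"]) auto
qed

lemma dual_norm_nonneg: "\<phi> \<in> dual_carr \<Longrightarrow> 0 \<le> ns_norm (ns_dual V) \<phi>"
  using dual_norm_upper[of \<phi> zerov] zerov by (auto intro: order_trans[OF norm_ge_zero])

lemma dual_bound:
  assumes "\<phi> \<in> dual_carr" "x \<in> carr"
  shows "cmod (\<phi> x) \<le> ns_norm (ns_dual V) \<phi> * ns_norm V x"
proof (cases "ns_norm V x = 0")
  case True
  have "\<exists>B. cmod (\<phi> x) \<le> B * ns_norm V x" using assms unfolding dual_carrier_iff by blast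
  with True show ?thesis by simp
next
  case False
  with norm_nonneg[OF assms(2)] have pos: "ns_norm V x > 0" by simp
  define c where "c = complex_of_real (1 / ns_norm V x)"
  have "ns_norm V (ns_scale V c x) \<le> 1"
    using pos by (simp add: norm_scale assms c_def norm_divide)
  then have "cmod (\<phi> (ns_scale V c x)) \<le> ns_norm (ns_dual V) \<phi>"
    by (intro dual_norm_upper assms scale_closed)
  then show ?thesis
    using pos assms by (simp add: dual_scale_apply norm_mult c_def norm_divide field_simps)
qed

lemma dual_norm_le:
  assumes "\<And>x. \<lbrakk>x \<in> carr; ns_norm V x \<le> 1\<rbrakk> \<Longrightarrow> cmod (\<phi> x) \<le> C"
  shows "ns_norm (ns_dual V) \<phi> \<le> C"
  unfolding dual_norm using zerov by (intro cSup_least) (auto intro: assms)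

lemma dual_eqI:
  assumes "\<phi> \<in> dual_carr" "\<psi> \<in> dual_carr"
    and "\<And>x. x \<in> carr \<Longrightarrow> \<phi> x = \<psi> x"
  shows "\<phi> = \<psi>"
  using assms by (auto simp: dual_carrier_iff intro: extensionalityI)

lemma dual_add_closed:
  assumes "\<phi> \<in> dual_carr" "\<psi> \<in> dual_carr"
  shows "ns_add (ns_dual V) \<phi> \<psi> \<in> dual_carr"
  unfolding dual_add
proof (rule dualI[where B="ns_norm (ns_dual V) \<phi> + ns_norm (ns_dual V) \<psi>"])
  fix x assume "x \<in> carr"
  then show "cmod (\<phi> x + \<psi> x) \<le> (ns_norm (ns_dual V) \<phi> + ns_norm (ns_dual V) \<psi>) * ns_norm V x"
    using dual_bound[of \<phi> x] dual_bound[of \<psi> x] assms norm_triangle_ineq[of "\<phi> x" "\<psi> x"]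
    by (simp add: algebra_simps)
qed (use assms in \<open>auto simp: dual_add_apply dual_scale_apply algebra_simps\<close>)

lemma dual_scale_closed:
  assumes "\<phi> \<in> dual_carr"
  shows "ns_scale (ns_dual V) c \<phi> \<in> dual_carr"
  unfolding dual_scale
proof (rule dualI[where B="cmod c * ns_norm (ns_dual V) \<phi>"])
  fix x assume "x \<in> carr"
  then show "cmod (c * \<phi> x) \<le> cmod c * ns_norm (ns_dual V) \<phi> * ns_norm V x"
    using dual_bound[of \<phi> x] assms by (simp add: norm_mult mult.assoc mult_left_mono)
qed (use assms in \<open>auto simp: dual_add_apply dual_scale_apply algebra_simps\<close>)

lemma zero_in_dual: "(\<lambda>x\<in>carr. 0) \<in> dual_carr"
  by (rule dualI[where B=0]) auto

text \<open>
  The vector space laws hold since functionals are added and scaled pointwise on the carrier.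
\<close>

lemma complex_nspace_dual: "complex_nspace (ns_dual V)"
proof -
  let ?D = "ns_dual V"
  have "homogeneous_nspace ?D"
  proof (rule homogeneous_nspaceI)
    show "ns_carrier ?D \<noteq> {}" using zero_in_dual by blast
    show "ns_norm ?D (ns_scale ?D c x) \<le> cmod c * ns_norm ?D x" if "x \<in> ns_carrier ?D" for c x
      by (rule dual_norm_le)
        (use that dual_norm_upper in \<open>auto simp: dual_scale norm_mult mult_left_mono\<close>)
    show "ns_scale ?D (inverse c) (ns_scale ?D c x) = x" if "x \<in> ns_carrier ?D" "c \<noteq> 0" for c x
      using that by (intro dual_eqI dual_scale_closed) (auto simp: dual_scale)
  qed (auto intro: dual_add_closed dual_scale_closed dual_norm_nonneg)
  then interpret D: homogeneous_nspace ?D .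
  show ?thesis
  proof
  show "ns_norm ?D (ns_add ?D x y) \<le> ns_norm ?D x + ns_norm ?D y"
    if "x \<in> ns_carrier ?D" "y \<in> ns_carrier ?D" for x y
  proof (rule dual_norm_le)
    fix z assume "z \<in> carr" "ns_norm V z \<le> 1"
    then show "cmod (ns_add ?D x y z) \<le> ns_norm ?D x + ns_norm ?D y"
      using dual_norm_upper[of x z] dual_norm_upper[of y z] that norm_triangle_ineq[of "x z" "y z"]
      by (simp add: dual_add)
  qed
  show "x = ns_scale ?D 0 x" if "x \<in> ns_carrier ?D" "ns_norm ?D x = 0" for x
    using that dual_bound[of x] by (intro dual_eqI dual_scale_closed) (auto simp: dual_scale)
  show "ns_scale ?D 1 x = x" if "x \<in> ns_carrier ?D" for x
    using that by (intro dual_eqI dual_scale_closed) (auto simp: dual_scale)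
  show "ns_add ?D x (ns_scale ?D 0 y) = x" if "x \<in> ns_carrier ?D" "y \<in> ns_carrier ?D" for x y
    using that by (intro dual_eqI dual_scale_closed dual_add_closed) (auto simp: dual_scale dual_add)
qed (auto simp: dual_add dual_scale algebra_simps cong: restrict_cong)
qed

end

lemma complex_nspace_restrict:
  assumes "complex_nspace V" "ns_subspace V W"
  shows "complex_nspace (ns_restrict V W)"
proof -
  interpret complex_nspace V by fact
  have "W \<subseteq> ns_carrier V" "W \<noteq> {}" "\<And>x y. x \<in> W \<Longrightarrow> y \<in> W \<Longrightarrow> ns_add V x y \<in> W"
    "\<And>c x. x \<in> W \<Longrightarrow> ns_scale V c x \<in> W"
    using assms(2) by (auto simp: ns_subspace_def)
  then show ?thesis
    by unfold_locales
      (auto simp: subset_iff norm_nonneg norm_scale add_assoc add_zero scale_add add_scale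
        scale_scale scale_one norm_triangle norm_zero_imp intro: add_commute norm_zero_imp)
qed

section \<open>The norm topology\<close>

context complex_nspace
begin

abbreviation subv where "subv x y \<equiv> ns_add V x (ns_scale V (- 1) y)"

lemma minus_closed: "x \<in> carr \<Longrightarrow> y \<in> carr \<Longrightarrow> subv x y \<in> carr"
  by (simp add: add_closed scale_closed)

lemma minus_self: "x \<in> carr \<Longrightarrow> subv x x = ns_scale V 0 x"
  using add_scale[of x 1 "-1"] by (simp add: scale_one)

lemma zero_add: "x \<in> carr \<Longrightarrow> y \<in> carr \<Longrightarrow> ns_add V (ns_scale V 0 y) x = x"
  by (simp add: add_zero add_commute scale_closed)

lemma zero_unique: "x \<in> carr \<Longrightarrow> y \<in> carr \<Longrightarrow> ns_scale V 0 x = ns_scale V 0 y"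
  by (metis add_zero zero_add scale_closed)

lemma zerov_eq: "x \<in> carr \<Longrightarrow> zerov = ns_scale V 0 x"
  unfolding zerov_def by (rule zero_unique) (simp_all add: carrier_nonempty some_in_eq)

lemma add_cancel:
  assumes "x \<in> carr" "y \<in> carr"
  shows "ns_add V (subv x y) y = x"
proof -
  have "ns_add V (subv x y) y = ns_add V x (ns_add V (ns_scale V (-1) y) y)"
    by (simp add: add_assoc assms scale_closed)
  also have "ns_add V (ns_scale V (-1) y) y = ns_scale V 0 y"
    using add_scale[of y "-1" 1] by (simp add: scale_one assms)
  finally show ?thesis by (simp add: add_zero assms)
qed

lemma minus_minus_add:
  assumes "x \<in> carr" "y \<in> carr" "z \<in> carr"
  shows "ns_add V (subv x y) (subv y z) = subv x z"
  using add_cancel[of x y] add_assoc[of "subv x y" y "ns_scale V (-1) z"] assms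
  by (simp add: add_closed scale_closed)

text \<open>
  Makes \<open>ns_dist\<close> symmetric; with the triangle inequality, the norm topology is that of a metric
  space.
\<close>

lemma norm_minus_commute:
  assumes "x \<in> carr" "y \<in> carr"
  shows "ns_norm V (subv x y) = ns_norm V (subv y x)"
proof -
  have "ns_scale V (-1) (subv x y) = subv y x"
    by (simp add: scale_add assms scale_closed scale_scale scale_one add_commute)
  then show ?thesis
    using norm_scale[of "subv x y" "-1"] minus_closed[OF assms] by simp
qed

lemma Metric_space_ns_dist: "Metric_space (carr) (ns_dist V)"
proof
  show "0 \<le> ns_dist V x y" for x y
    by (simp add: ns_dist_def norm_nonneg add_closed scale_closed)
  show "ns_dist V x y = ns_dist V y x" for x y
    by (auto simp: ns_dist_def norm_minus_commute)
  show "(ns_dist V x y = 0) = (x = y)" if "x \<in> carr" "y \<in> carr" for x y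
  proof
    assume "ns_dist V x y = 0"
    then have "subv x y = ns_scale V 0 (subv x y)"
      using that by (intro norm_zero_imp minus_closed) (auto simp: ns_dist_def)
    then have "subv x y = ns_scale V 0 y" using zero_unique minus_closed that by metis
    then have "x = ns_add V (ns_scale V 0 y) y" using add_cancel[OF that] by simp
    then show "x = y" using zero_add that by simp
  next
    assume "x = y"
    then show "ns_dist V x y = 0" using that by (simp add: ns_dist_def minus_self norm_scale)
  qed
  show "ns_dist V x z \<le> ns_dist V x y + ns_dist V y z"
    if "x \<in> carr" "y \<in> carr" "z \<in> carr" for x y z
    using norm_triangle[of "subv x y" "subv y z"] that
    by (simp add: ns_dist_def minus_minus_add minus_closed)
qed

sublocale Metric_space "carr" "ns_dist V"
  by (rule Metric_space_ns_dist)

lemma closedin_norm_topology: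
  "closedin (norm_topology V) W \<longleftrightarrow> W \<subseteq> carr \<and>
     (\<forall>x\<in>carr. (\<forall>e>0. \<exists>y\<in>W. ns_norm V (subv x y) < e) \<longrightarrow> x \<in> W)"
proof -
  have "disjnt W (mball x r) \<longleftrightarrow> \<not> (\<exists>y\<in>W. ns_norm V (subv x y) < r)"
    if "W \<subseteq> carr" "x \<in> carr" for x r
    using that by (auto simp: disjnt_iff in_mball ns_dist_def subset_iff)
  then show ?thesis
    unfolding norm_topology_def closedin_metric by (smt (verit) DiffD1 DiffD2 DiffI)
qed

lemma closure_of_norm_topology:
  assumes "S \<subseteq> carr"
  shows "(norm_topology V) closure_of S =
    {x \<in> carr. \<forall>e>0. \<exists>y\<in>S. ns_norm V (subv x y) < e}"
  unfolding norm_topology_def metric_closure_of using assms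
  by (auto simp: in_mball ns_dist_def subset_iff Bex_def; blast)

lemma subspace_zerov:
  assumes "ns_subspace V W"
  shows "zerov \<in> W"
proof -
  from assms obtain x where x: "x \<in> W" by (auto simp: ns_subspace_def)
  with assms have "zerov = ns_scale V 0 x" by (intro zerov_eq) (auto simp: ns_subspace_def)
  with assms x show ?thesis by (simp add: ns_subspace_def)
qed

lemma subspace_carrier: "ns_subspace V (carr)"
  by (auto simp: ns_subspace_def add_closed scale_closed carrier_nonempty)

lemma subspace_Inter:
  assumes "\<A> \<noteq> {}" and "\<And>W. W \<in> \<A> \<Longrightarrow> ns_subspace V W"
  shows "ns_subspace V (\<Inter>\<A>)"
proof -
  have "zerov \<in> \<Inter>\<A>" using assms(2) subspace_zerov by blast
  moreover have "\<Inter>\<A> \<subseteq> carr" using assms unfolding ns_subspace_def by blast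
  ultimately show ?thesis using assms(2) unfolding ns_subspace_def by blast
qed

lemma span_subspace:
  assumes "S \<subseteq> carr"
  shows "ns_subspace V (ns_span V S)" "S \<subseteq> ns_span V S"
proof -
  show "ns_subspace V (ns_span V S)"
    unfolding ns_span_def using subspace_carrier assms by (intro subspace_Inter) auto
  show "S \<subseteq> ns_span V S" by (auto simp: ns_span_def)
qed

lemma closure_subspace:
  assumes W: "ns_subspace V W"
  shows "ns_subspace V ((norm_topology V) closure_of W)"
proof -
  have WV: "W \<subseteq> carr" using W by (simp add: ns_subspace_def)
  let ?C = "(norm_topology V) closure_of W"
  have C: "?C = {x \<in> carr. \<forall>e>0. \<exists>y\<in>W. ns_norm V (subv x y) < e}"
    by (rule closure_of_norm_topology[OF WV])
  have "ns_add V x y \<in> ?C" if x: "x \<in> ?C" and y: "y \<in> ?C" for x y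
  proof -
    have xy: "x \<in> carr" "y \<in> carr" using x y by (auto simp: C)
    have "\<exists>z\<in>W. ns_norm V (subv (ns_add V x y) z) < e" if "e > 0" for e :: real
    proof -
      obtain x' where x': "x' \<in> W" "ns_norm V (subv x x') < e/2"
        using x half_gt_zero[OF \<open>e > 0\<close>] unfolding C by blast
      obtain y' where y': "y' \<in> W" "ns_norm V (subv y y') < e/2"
        using y half_gt_zero[OF \<open>e > 0\<close>] unfolding C by blast
      have in_V: "x' \<in> carr" "y' \<in> carr" using x' y' WV by auto
      have "subv (ns_add V x y) (ns_add V x' y') = ns_add V (subv x x') (subv y y')"
        using xy in_V by (metis (no_types, opaque_lifting) add_assoc add_closed add_commute scale_add scale_closed)
      then have "ns_norm V (subv (ns_add V x y) (ns_add V x' y')) < e"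
        using norm_triangle[of "subv x x'" "subv y y'"] x' y' xy in_V by (simp add: minus_closed)
      then show ?thesis using W x' y' by (auto simp: ns_subspace_def)
    qed
    then show ?thesis using xy by (simp add: C add_closed)
  qed
  moreover have "ns_scale V c x \<in> ?C" if x: "x \<in> ?C" for c x
  proof -
    have xV: "x \<in> carr" using x by (auto simp: C)
    have "\<exists>z\<in>W. ns_norm V (subv (ns_scale V c x) z) < e" if "e > 0" for e :: real
    proof -
      have "e / (cmod c + 1) > 0" using that by (intro divide_pos_pos) (auto intro: add_nonneg_pos)
      then obtain x' where x': "x' \<in> W" "ns_norm V (subv x x') < e / (cmod c + 1)"
        using x by (auto simp: C)
      have x'V: "x' \<in> carr" using x' WV by auto
      have "subv (ns_scale V c x) (ns_scale V c x') = ns_scale V c (subv x x')"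
        by (simp add: scale_add xV x'V scale_closed scale_scale)
      then have "ns_norm V (subv (ns_scale V c x) (ns_scale V c x')) = cmod c * ns_norm V (subv x x')"
        by (simp add: norm_scale minus_closed xV x'V)
      also have "\<dots> \<le> (cmod c + 1) * ns_norm V (subv x x')"
        by (intro mult_right_mono norm_nonneg minus_closed xV x'V) auto
      also have "\<dots> < e"
        using x'(2) by (simp add: pos_less_divide_eq add_nonneg_pos mult.commute)
      finally show ?thesis using W x' by (auto simp: ns_subspace_def)
    qed
    then show ?thesis using xV by (simp add: C scale_closed)
  qed
  moreover have "W \<subseteq> ?C"
    using WV by (auto simp: C minus_self norm_scale subset_iff intro!: bexI)
  moreover have "?C \<subseteq> carr" by (auto simp: C)
  ultimately show ?thesis
    using W unfolding ns_subspace_def by blast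
qed

text \<open>
  The induction principle for closed linear spans: a property that is stable under linear
  combinations and norm limits needs to be checked on generators only.
\<close>

lemma closure_span_subset:
  assumes "S \<subseteq> W" "ns_subspace V W" "closedin (norm_topology V) W"
  shows "(norm_topology V) closure_of ns_span V S \<subseteq> W"
proof -
  have "ns_span V S \<subseteq> W" using assms by (auto simp: ns_span_def)
  then show ?thesis using assms(3) by (rule closure_of_minimal)
qed

end

section \<open>The Hahn-Banach theorem\<close>

text \<open>
  Used to transfer subadditivity to infima whose index varies independently in the two summands.
\<close>

lemma le_cINF_add:
  fixes f :: "'a \<Rightarrow> real" and g :: "'b \<Rightarrow> real"
  assumes "A \<noteq> {}" "B \<noteq> {}" and le: "\<And>s t. \<lbrakk>s \<in> A; t \<in> B\<rbrakk> \<Longrightarrow> a \<le> f s + g t"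
  shows "a \<le> (INF s\<in>A. f s) + (INF t\<in>B. g t)"
proof -
  have "a - f s \<le> (INF t\<in>B. g t)" if "s \<in> A" for s
    using assms(2) le[OF that] by (intro cINF_greatest) (auto simp: algebra_simps)
  then have "a - (INF t\<in>B. g t) \<le> (INF s\<in>A. f s)"
    using assms(1) by (intro cINF_greatest) (auto simp: algebra_simps)
  then show ?thesis by simp
qed

lemma le_mult_cINF:
  fixes f :: "'a \<Rightarrow> real"
  assumes "A \<noteq> {}" "0 \<le> c" and le: "\<And>s. s \<in> A \<Longrightarrow> a \<le> c * f s"
  shows "a \<le> c * (INF s\<in>A. f s)"
proof (cases "c = 0")
  case True
  then show ?thesis using le \<open>A \<noteq> {}\<close> by auto
next
  case False
  with \<open>0 \<le> c\<close> have "c > 0" by simp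
  then have "a / c \<le> (INF s\<in>A. f s)"
    using assms by (intro cINF_greatest) (auto simp: pos_divide_le_eq mult.commute)
  with \<open>c > 0\<close> show ?thesis by (simp add: pos_divide_le_eq mult.commute)
qed

context complex_nspace
begin

abbreviation addv (infixl "\<oplus>" 65) where "x \<oplus> y \<equiv> ns_add V x y"
abbreviation scal (infixr "\<odot>" 75) where "(c::complex) \<odot> x \<equiv> ns_scale V c x"
abbreviation rscal (infixr "\<odot>\<^sub>r" 75) where "(r::real) \<odot>\<^sub>r x \<equiv> ns_scale V (complex_of_real r) x"

lemma add_add_swap:
  assumes "a \<in> carr" "b \<in> carr" "c \<in> carr" "d \<in> carr"
  shows "(a \<oplus> b) \<oplus> (c \<oplus> d) = (a \<oplus> c) \<oplus> (b \<oplus> d)"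
proof -
  have "(a \<oplus> b) \<oplus> (c \<oplus> d) = a \<oplus> ((b \<oplus> c) \<oplus> d)"
    using assms by (simp add: add_assoc add_closed)
  also have "b \<oplus> c = c \<oplus> b" using assms by (simp add: add_commute)
  finally show ?thesis using assms by (simp add: add_assoc add_closed)
qed

text \<open>
  Homogeneity is required as an inequality only, the form that passes to infima; equality follows,
  see \<open>sublinear_scale\<close>.
\<close>

definition sublinear :: "('a \<Rightarrow> real) \<Rightarrow> bool" where
  "sublinear q \<longleftrightarrow> (\<forall>x\<in>carr. \<forall>y\<in>carr. q (x \<oplus> y) \<le> q x + q y) \<and>
     (\<forall>r\<ge>0. \<forall>x\<in>carr. q (r \<odot>\<^sub>r x) \<le> r * q x)"

lemma sublinear_add: "\<lbrakk>sublinear q; x \<in> carr; y \<in> carr\<rbrakk> \<Longrightarrow> q (x \<oplus> y) \<le> q x + q y"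
  by (simp add: sublinear_def)

lemma sublinear_scale_le: "\<lbrakk>sublinear q; x \<in> carr; 0 \<le> r\<rbrakk> \<Longrightarrow> q (r \<odot>\<^sub>r x) \<le> r * q x"
  by (simp add: sublinear_def)

lemma sublinear_zero:
  assumes "sublinear q" "x \<in> carr"
  shows "q (0 \<odot> x) = 0"
proof -
  have "q (0 \<odot> x) \<le> q (0 \<odot> x) + q (0 \<odot> x)"
    using sublinear_add[of q "0 \<odot> x" "0 \<odot> x"] assms by (simp add: scale_closed zero_add add_zero)
  with sublinear_scale_le[OF assms, of 0] show ?thesis by simp
qed

lemma sublinear_scale:
  assumes "sublinear q" "x \<in> carr" "0 \<le> r"
  shows "q (r \<odot>\<^sub>r x) = r * q x"
proof (cases "r = 0")
  case True
  then show ?thesis using sublinear_zero assms by simp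
next
  case False
  with assms have "r > 0" by simp
  have "q ((1/r) \<odot>\<^sub>r r \<odot>\<^sub>r x) \<le> (1/r) * q (r \<odot>\<^sub>r x)"
    using assms \<open>r > 0\<close> by (intro sublinear_scale_le) (auto simp: scale_closed)
  moreover have "(1/r) \<odot>\<^sub>r r \<odot>\<^sub>r x = x"
    using assms \<open>r > 0\<close> by (simp add: scale_scale scale_one)
  ultimately have "r * q x \<le> q (r \<odot>\<^sub>r x)"
    using \<open>r > 0\<close> by (simp add: field_simps)
  with sublinear_scale_le[OF assms] show ?thesis by simp
qed

lemma sublinear_minus:
  assumes "sublinear q" "x \<in> carr"
  shows "- q x \<le> q ((- 1) \<odot> x)"
proof -
  have "q (0 \<odot> x) \<le> q x + q ((- 1) \<odot> x)"
    using sublinear_add[OF assms scale_closed[OF assms(2)], of "- 1"]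
    unfolding minus_self[OF assms(2)] .
  then show ?thesis using sublinear_zero[OF assms] by simp
qed

text \<open>
  The largest sublinear functional below \<open>q\<close> that agrees with \<open>q\<close> at \<open>y\<close> and is additive along the ray
  of \<open>y\<close>.  A minimal sublinear functional \<open>q\<close> equals \<open>lower_at q y\<close> for every \<open>y\<close>, and this is what makes it linear.
\<close>

definition lower_at :: "('a \<Rightarrow> real) \<Rightarrow> 'a \<Rightarrow> 'a \<Rightarrow> real" where
  "lower_at q y x = (INF t\<in>{0..}. q (x \<oplus> t \<odot>\<^sub>r y) - t * q y)"

text \<open>
  The infimum is bounded below by \<open>- q (- x)\<close>, because \<open>t y = (x + t y) + (- x)\<close>.
\<close>

lemma lower_at_le:
  assumes q: "sublinear q" and "x \<in> carr" "y \<in> carr" "0 \<le> t"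
  shows "lower_at q y x \<le> q (x \<oplus> t \<odot>\<^sub>r y) - t * q y"
  unfolding lower_at_def
proof (rule cINF_lower)
  show "bdd_below ((\<lambda>t. q (x \<oplus> t \<odot>\<^sub>r y) - t * q y) ` {0..})"
  proof (rule bdd_belowI2)
    fix t :: real assume "t \<in> {0..}"
    then have t: "0 \<le> t" by simp
    have "t \<odot>\<^sub>r y = (x \<oplus> t \<odot>\<^sub>r y) \<oplus> (- 1) \<odot> x"
      using assms add_assoc[of "t \<odot>\<^sub>r y" x "(- 1) \<odot> x"]
      by (simp add: add_commute[of x] minus_self add_zero scale_closed)
    then have "t * q y \<le> q (x \<oplus> t \<odot>\<^sub>r y) + q ((- 1) \<odot> x)"
      using sublinear_add[of q "x \<oplus> t \<odot>\<^sub>r y" "(- 1) \<odot> x"] sublinear_scale[of q y t] assms t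
      by (simp add: add_closed scale_closed)
    then show "- q ((- 1) \<odot> x) \<le> q (x \<oplus> t \<odot>\<^sub>r y) - t * q y" by simp
  qed
qed (use assms in auto)

lemma lower_at_le_self:
  assumes "sublinear q" "x \<in> carr" "y \<in> carr"
  shows "lower_at q y x \<le> q x"
  using lower_at_le[OF assms, of 0] assms by (simp add: add_zero)

lemma sublinear_lower_at:
  assumes q: "sublinear q" and y: "y \<in> carr"
  shows "sublinear (lower_at q y)"
  unfolding sublinear_def
proof (intro conjI ballI allI impI)
  fix x1 x2 assume x: "x1 \<in> carr" "x2 \<in> carr"
  have le: "lower_at q y (x1 \<oplus> x2) \<le> (q (x1 \<oplus> s \<odot>\<^sub>r y) - s * q y) + (q (x2 \<oplus> t \<odot>\<^sub>r y) - t * q y)"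
    if "s \<in> {0..}" "t \<in> {0..}" for s t :: real
  proof -
    have eq: "(x1 \<oplus> x2) \<oplus> (s + t) \<odot>\<^sub>r y = (x1 \<oplus> s \<odot>\<^sub>r y) \<oplus> (x2 \<oplus> t \<odot>\<^sub>r y)"
      using x y by (simp add: add_scale add_add_swap scale_closed)
    have "lower_at q y (x1 \<oplus> x2) \<le> q ((x1 \<oplus> x2) \<oplus> (s + t) \<odot>\<^sub>r y) - (s + t) * q y"
      using that x y by (intro lower_at_le q add_closed) auto
    also have "\<dots> \<le> (q (x1 \<oplus> s \<odot>\<^sub>r y) + q (x2 \<oplus> t \<odot>\<^sub>r y)) - (s + t) * q y"
      unfolding eq using x y by (intro diff_right_mono sublinear_add q add_closed scale_closed)
    finally show ?thesis by (simp add: algebra_simps)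
  qed
  show "lower_at q y (x1 \<oplus> x2) \<le> lower_at q y x1 + lower_at q y x2"
    unfolding lower_at_def[of q y x1] lower_at_def[of q y x2] by (rule le_cINF_add) (use le in auto)
next
  fix c :: real and x assume c: "0 \<le> c" and x: "x \<in> carr"
  have le: "lower_at q y (c \<odot>\<^sub>r x) \<le> c * (q (x \<oplus> t \<odot>\<^sub>r y) - t * q y)" if "t \<in> {0..}" for t
  proof -
    have "lower_at q y (c \<odot>\<^sub>r x) \<le> q (c \<odot>\<^sub>r x \<oplus> (c * t) \<odot>\<^sub>r y) - (c * t) * q y"
      using that c x y by (intro lower_at_le q scale_closed) auto
    also have "c \<odot>\<^sub>r x \<oplus> (c * t) \<odot>\<^sub>r y = c \<odot>\<^sub>r (x \<oplus> t \<odot>\<^sub>r y)"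
      using x y by (simp add: scale_add scale_closed scale_scale)
    also have "q (c \<odot>\<^sub>r (x \<oplus> t \<odot>\<^sub>r y)) = c * q (x \<oplus> t \<odot>\<^sub>r y)"
      using x y c by (intro sublinear_scale q add_closed scale_closed)
    finally show ?thesis by (simp add: algebra_simps)
  qed
  show "lower_at q y (c \<odot>\<^sub>r x) \<le> c * lower_at q y x"
    unfolding lower_at_def[of q y x] by (rule le_mult_cINF) (use le c in auto)
qed

text \<open>
  For a chain the infimum is sublinear: of two members of the chain, the smaller one witnesses
  subadditivity for both.
\<close>

lemma sublinear_cINF:
  assumes C: "C \<noteq> {}" and lin: "\<And>q. q \<in> C \<Longrightarrow> sublinear q"
    and le: "\<And>q x. \<lbrakk>q \<in> C; x \<in> carr\<rbrakk> \<Longrightarrow> q x \<le> p x"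
    and chain: "\<And>q q'. \<lbrakk>q \<in> C; q' \<in> C\<rbrakk> \<Longrightarrow> (\<forall>x\<in>carr. q x \<le> q' x) \<or> (\<forall>x\<in>carr. q' x \<le> q x)"
  shows "sublinear (\<lambda>x. INF q\<in>C. q x)" "\<And>q x. \<lbrakk>q \<in> C; x \<in> carr\<rbrakk> \<Longrightarrow> (INF q\<in>C. q x) \<le> q x"
proof -
  show low: "(INF q\<in>C. q x) \<le> q x" if "q \<in> C" "x \<in> carr" for q x
  proof (rule cINF_lower[OF _ \<open>q \<in> C\<close>])
    show "bdd_below ((\<lambda>q. q x) ` C)"
      by (rule bdd_belowI2[of _ "- p ((- 1) \<odot> x)"])
        (use sublinear_minus[OF lin] le that scale_closed in \<open>smt (verit)\<close>)
  qed
  show "sublinear (\<lambda>x. INF q\<in>C. q x)"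
    unfolding sublinear_def
  proof (intro conjI ballI allI impI)
    fix x y assume xy: "x \<in> carr" "y \<in> carr"
    have "(INF q\<in>C. q (x \<oplus> y)) \<le> q x + q' y" if "q \<in> C" "q' \<in> C" for q q'
    proof -
      have "(INF q\<in>C. q (x \<oplus> y)) \<le> q x + q y" "(INF q\<in>C. q (x \<oplus> y)) \<le> q' x + q' y"
        using low[OF _ add_closed[OF xy]] sublinear_add[OF lin xy] that by (meson order_trans)+
      then show ?thesis using chain[OF that] xy by force
    qed
    then show "(INF q\<in>C. q (x \<oplus> y)) \<le> (INF q\<in>C. q x) + (INF q\<in>C. q y)"
      by (intro le_cINF_add C)
  next
    fix r :: real and x assume "0 \<le> r" "x \<in> carr"
    then show "(INF q\<in>C. q (r \<odot>\<^sub>r x)) \<le> r * (INF q\<in>C. q x)"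
      by (intro le_mult_cINF C order_trans[OF low sublinear_scale_le] lin scale_closed)
  qed
qed

text \<open>
  The core of the Hahn-Banach theorem.  Zorn's lemma is applied to the sublinear functionals
  below \<open>p\<close>, so no partially defined functionals have to be extended: a minimal one is linear.
\<close>

theorem linear_below_sublinear:
  assumes p: "sublinear p"
  obtains L where "\<And>x y. \<lbrakk>x \<in> carr; y \<in> carr\<rbrakk> \<Longrightarrow> L (x \<oplus> y) = L x + L y"
    and "\<And>r x. x \<in> carr \<Longrightarrow> L (r \<odot>\<^sub>r x) = r * L x"
    and "\<And>x. x \<in> carr \<Longrightarrow> L x \<le> p x"
proof -
  have ext: "sublinear (restrict q carr) \<longleftrightarrow> sublinear q" for q
    by (auto simp: sublinear_def add_closed scale_closed)
  define A where "A = {q \<in> extensional carr. sublinear q \<and> (\<forall>x\<in>carr. q x \<le> p x)}"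
  define P where "P = (\<lambda>q q' :: 'a \<Rightarrow> real. \<forall>x\<in>carr. q' x \<le> q x)"
  have "\<exists>m\<in>A. \<forall>a\<in>A. P m a \<longrightarrow> a = m"
  proof (rule predicate_Zorn)
    show "partial_order_on A (relation_of P A)"
      unfolding partial_order_on_def preorder_on_def refl_on_def trans_def antisym_def relation_of_def
      by (auto simp: P_def A_def intro: order_trans order_antisym intro!: extensionalityI[of _ carr])
  next
    fix C assume C: "C \<in> Chains (relation_of P A)"
    show "\<exists>u\<in>A. \<forall>a\<in>C. P a u"
    proof (cases "C = {}")
      case True
      have "restrict p carr \<in> A" using p by (simp add: A_def ext)
      then show ?thesis using True by blast
    next
      case False
      have CA: "C \<subseteq> A" using C by (auto simp: Chains_def relation_of_def)
      have "\<And>q q'. \<lbrakk>q \<in> C; q' \<in> C\<rbrakk> \<Longrightarrow> P q q' \<or> P q' q"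
        using C by (auto simp: Chains_def relation_of_def)
      then have chain: "(\<forall>x\<in>carr. q x \<le> q' x) \<or> (\<forall>x\<in>carr. q' x \<le> q x)"
        if "q \<in> C" "q' \<in> C" for q q' using that unfolding P_def by blast
      note inf = sublinear_cINF[OF False _ _ chain, where p=p]
      have lin: "sublinear (\<lambda>x. INF q\<in>C. q x)"
        using CA by (intro inf(1)) (auto simp: A_def)
      have low: "(INF q\<in>C. q x) \<le> q x" if "q \<in> C" "x \<in> carr" for q x
        using CA that by (intro inf(2)) (auto simp: A_def)
      from False obtain q where "q \<in> C" by blast
      then have "(INF q\<in>C. q x) \<le> p x" if "x \<in> carr" for x
        using low[of q x] CA that by (force simp: A_def)
      then have "restrict (\<lambda>x. INF q\<in>C. q x) carr \<in> A"
        using lin by (simp add: A_def ext)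
      moreover have "\<forall>a\<in>C. P a (restrict (\<lambda>x. INF q\<in>C. q x) carr)"
        using low by (simp add: P_def)
      ultimately show ?thesis by blast
    qed
  qed
  then obtain L where L: "L \<in> A" and min: "\<And>a. \<lbrakk>a \<in> A; P L a\<rbrakk> \<Longrightarrow> a = L" by blast
  have sub: "sublinear L" and Lp: "\<And>x. x \<in> carr \<Longrightarrow> L x \<le> p x" using L by (auto simp: A_def)
  have super: "L x + L y \<le> L (x \<oplus> y)" if "x \<in> carr" "y \<in> carr" for x y
  proof -
    have le: "lower_at L y z \<le> L z" if "z \<in> carr" for z
      using lower_at_le_self[OF sub that \<open>y \<in> carr\<close>] .
    \<comment> \<open>By minimality \<open>L\<close> is equal to its lowering at \<open>y\<close>; the value \<open>t = 1\<close> gives superadditivity.\<close>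
    have "restrict (lower_at L y) carr \<in> A"
      using sublinear_lower_at[OF sub \<open>y \<in> carr\<close>] le Lp by (force simp: A_def ext)
    moreover have "P L (restrict (lower_at L y) carr)" using le by (simp add: P_def)
    ultimately have "restrict (lower_at L y) carr = L" by (rule min)
    then have "lower_at L y x = L x" using \<open>x \<in> carr\<close> by (metis restrict_apply')
    then show ?thesis
      using lower_at_le[OF sub that, of 1] that by (simp add: scale_one)
  qed
  have add: "L (x \<oplus> y) = L x + L y" if "x \<in> carr" "y \<in> carr" for x y
    using super[OF that] sublinear_add[OF sub that] by simp
  have neg: "L ((- 1) \<odot> x) = - L x" if "x \<in> carr" for x
    using add[of x "(- 1) \<odot> x"] minus_self[OF that] sublinear_zero[OF sub that] that
    by (simp add: scale_closed)
  have hom: "L (r \<odot>\<^sub>r x) = r * L x" if x: "x \<in> carr" for r x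
  proof (cases "0 \<le> r")
    case True
    then show ?thesis using sublinear_scale[OF sub x] by simp
  next
    case False
    then have "L ((- r) \<odot>\<^sub>r x) = - r * L x" using sublinear_scale[OF sub x, of "- r"] by simp
    moreover have "r \<odot>\<^sub>r x = (- 1) \<odot> (- r) \<odot>\<^sub>r x" using x by (simp add: scale_scale)
    ultimately show ?thesis using neg[of "(- r) \<odot>\<^sub>r x"] x by (simp add: scale_closed)
  qed
  show thesis using add hom Lp by (rule that)
qed

text \<open>
  The distance \<open>d\<close> to \<open>M\<close> is sublinear, vanishes on \<open>M\<close> and is positive at \<open>y\<close>.  A real-linear \<open>L\<close>
  below \<open>lower_at d y\<close> vanishes on \<open>M\<close> and has \<open>L (- y) \<le> - d y\<close>, so it is positive at \<open>y\<close>; it is the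
  real part of the functional sought.
\<close>

theorem separate_point_from_closed_subspace:
  assumes M: "ns_subspace V M" and closed: "closedin (norm_topology V) M"
    and y: "y \<in> carr" "y \<notin> M"
  obtains \<Lambda> where "\<Lambda> \<in> dual_carr" "\<And>m. m \<in> M \<Longrightarrow> \<Lambda> m = 0" "\<Lambda> y \<noteq> 0"
proof -
  have MV: "M \<subseteq> carr" and ne: "M \<noteq> {}"
    and Madd: "\<And>a b. a \<in> M \<Longrightarrow> b \<in> M \<Longrightarrow> a \<oplus> b \<in> M" and Mscale: "\<And>c a. a \<in> M \<Longrightarrow> c \<odot> a \<in> M"
    using M by (auto simp: ns_subspace_def)
  have Min: "m \<in> carr" if "m \<in> M" for m using that MV by blast
  define d where "d = (\<lambda>x. INF m\<in>M. ns_norm V (subv x m))"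
  have dle: "d x \<le> ns_norm V (subv x m)" if "x \<in> carr" "m \<in> M" for x m
    unfolding d_def using that Min
    by (intro cINF_lower bdd_belowI2[of _ 0] norm_nonneg minus_closed) auto
  have d: "sublinear d"
    unfolding sublinear_def
  proof (intro conjI ballI allI impI)
    fix x1 x2 assume x: "x1 \<in> carr" "x2 \<in> carr"
    have "d (x1 \<oplus> x2) \<le> ns_norm V (subv x1 a) + ns_norm V (subv x2 b)" if "a \<in> M" "b \<in> M" for a b
    proof -
      have ab: "a \<in> carr" "b \<in> carr" using that Min by auto
      have "subv (x1 \<oplus> x2) (a \<oplus> b) = subv x1 a \<oplus> subv x2 b"
        using x ab by (simp add: scale_add add_add_swap scale_closed)
      then show ?thesis
        using dle[OF add_closed[OF x] Madd[OF that]] norm_triangle[of "subv x1 a" "subv x2 b"] x ab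
        by (simp add: minus_closed)
    qed
    then show "d (x1 \<oplus> x2) \<le> d x1 + d x2"
      unfolding d_def[of] by (intro le_cINF_add ne)
  next
    fix r :: real and x assume r: "0 \<le> r" and x: "x \<in> carr"
    have "d (r \<odot>\<^sub>r x) \<le> r * ns_norm V (subv x m)" if "m \<in> M" for m
    proof -
      have "subv (r \<odot>\<^sub>r x) (r \<odot>\<^sub>r m) = r \<odot>\<^sub>r subv x m"
        using x Min[OF that] by (simp add: scale_add scale_closed scale_scale)
      then show ?thesis
        using dle[OF scale_closed[OF x] Mscale[OF that], of r r] norm_scale[of "subv x m" r]
          minus_closed[OF x Min[OF that]] r by simp
    qed
    then show "d (r \<odot>\<^sub>r x) \<le> r * d x"
      unfolding d_def by (intro le_mult_cINF ne r)
  qed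
  have dnorm: "d x \<le> ns_norm V x" if x: "x \<in> carr" for x
  proof -
    obtain m where m: "m \<in> M" using ne by blast
    have "subv x (0 \<odot> m) = x" using x Min[OF m] by (simp add: scale_scale add_zero)
    then show ?thesis using dle[OF x Mscale[OF m, of 0]] by simp
  qed
  have dM: "d m \<le> 0" if "m \<in> M" for m
    using dle[OF Min[OF that] that] Min[OF that] by (simp add: minus_self norm_scale)
  \<comment> \<open>This is where closedness of \<open>M\<close> enters.\<close>
  have dy: "d y > 0"
  proof -
    obtain e where e: "e > 0" "\<And>m. m \<in> M \<Longrightarrow> \<not> ns_norm V (subv y m) < e"
      using closed y unfolding closedin_norm_topology by blast
    then have "e \<le> d y" unfolding d_def using ne by (intro cINF_greatest) (auto simp: not_less)
    with e show ?thesis by simp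
  qed
  obtain L where add: "\<And>x y. \<lbrakk>x \<in> carr; y \<in> carr\<rbrakk> \<Longrightarrow> L (x \<oplus> y) = L x + L y"
    and scale: "\<And>r x. x \<in> carr \<Longrightarrow> L (r \<odot>\<^sub>r x) = r * L x"
    and Lle: "\<And>x. x \<in> carr \<Longrightarrow> L x \<le> lower_at d y x"
    using linear_below_sublinear[OF sublinear_lower_at[OF d y(1)]] by blast
  have Ld: "L x \<le> d x" if "x \<in> carr" for x
    using Lle[OF that] lower_at_le_self[OF d that y(1)] by simp
  have neg: "L ((- 1) \<odot> x) = - L x" if "x \<in> carr" for x
    using scale[OF that, of "- 1"] by simp
  have LM: "L m = 0" if "m \<in> M" for m
    using Ld[OF Min[OF that]] dM[OF that] Ld[OF Min[OF Mscale[OF that, of "- 1"]]]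
      dM[OF Mscale[OF that, of "- 1"]] neg[OF Min[OF that]] by linarith
  have Labs: "\<bar>L x\<bar> \<le> ns_norm V x" if x: "x \<in> carr" for x
    using Ld[OF x] dnorm[OF x] Ld[of "(- 1) \<odot> x"] dnorm[of "(- 1) \<odot> x"] neg[OF x]
      norm_scale[OF x, of "- 1"] x by (simp add: scale_closed)
  have Ly: "L y > 0"
  proof -
    have "L ((- 1) \<odot> y) \<le> d ((- 1) \<odot> y \<oplus> 1 \<odot>\<^sub>r y) - 1 * d y"
      using Lle[of "(- 1) \<odot> y"] lower_at_le[OF d _ y(1), of "(- 1) \<odot> y" 1] y by (simp add: scale_closed)
    also have "(- 1) \<odot> y \<oplus> 1 \<odot>\<^sub>r y = 0 \<odot> y"
      using add_scale[OF y(1), of "- 1" 1] by simp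
    finally show ?thesis using sublinear_zero[OF d y(1)] neg[OF y(1)] dy by simp
  qed
  \<comment> \<open>The complex-linear functional with real part \<open>L\<close>.\<close>
  define \<Lambda> where "\<Lambda> = (\<lambda>x\<in>carr. Complex (L x) (- L (\<i> \<odot> x)))"
  have lin: "L (c \<odot> x) = Re c * L x + Im c * L (\<i> \<odot> x)" if x: "x \<in> carr" for c x
  proof -
    have "c \<odot> x = Re c \<odot>\<^sub>r x \<oplus> Im c \<odot>\<^sub>r \<i> \<odot> x"
      using x add_scale[OF x, of "Re c" "Im c * \<i>"] complex_eq[of c]
      by (simp add: scale_scale mult.commute)
    then show ?thesis using x by (simp add: add scale scale_closed)
  qed
  have "\<Lambda> \<in> dual_carr"
    unfolding \<Lambda>_def
  proof (rule dualI[where B=2])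
    fix a b assume ab: "a \<in> carr" "b \<in> carr"
    then show "Complex (L (a \<oplus> b)) (- L (\<i> \<odot> (a \<oplus> b)))
       = Complex (L a) (- L (\<i> \<odot> a)) + Complex (L b) (- L (\<i> \<odot> b))"
      by (simp add: scale_add add scale_closed complex_eq_iff)
  next
    fix c x assume x: "x \<in> carr"
    have "L (\<i> \<odot> c \<odot> x) = Re c * L (\<i> \<odot> x) - Im c * L x"
      using lin[OF x, of "\<i> * c"] x by (simp add: scale_scale)
    then show "Complex (L (c \<odot> x)) (- L (\<i> \<odot> c \<odot> x)) = c * Complex (L x) (- L (\<i> \<odot> x))"
      using lin[OF x, of c] by (simp add: complex_eq_iff algebra_simps)
  next
    fix x assume x: "x \<in> carr"
    have "cmod (Complex (L x) (- L (\<i> \<odot> x))) \<le> \<bar>L x\<bar> + \<bar>- L (\<i> \<odot> x)\<bar>"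
      using cmod_le[of "Complex (L x) (- L (\<i> \<odot> x))"] by simp
    also have "\<dots> \<le> 2 * ns_norm V x"
      using Labs[OF x] Labs[OF scale_closed[OF x, of \<i>]] norm_scale[OF x, of \<i>] by simp
    finally show "cmod (Complex (L x) (- L (\<i> \<odot> x))) \<le> 2 * ns_norm V x" .
  qed
  moreover have "\<Lambda> m = 0" if "m \<in> M" for m
    using LM[OF that] LM[OF Mscale[OF that]] Min[OF that] by (simp add: \<Lambda>_def complex_eq_iff)
  moreover have "\<Lambda> y \<noteq> 0" using Ly y by (simp add: \<Lambda>_def complex_eq_iff)
  ultimately show thesis by (rule that)
qed

end

section \<open>Preduals and weak topologies\<close>

lemma dual_restrict_carrier:
  "ns_carrier (ns_dual (ns_restrict V W)) = {\<phi> \<in> extensional W.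
       (\<forall>x\<in>W. \<forall>y\<in>W. \<phi> (ns_add V x y) = \<phi> x + \<phi> y) \<and>
       (\<forall>c. \<forall>x\<in>W. \<phi> (ns_scale V c x) = c * \<phi> x) \<and>
       (\<exists>B. \<forall>x\<in>W. cmod (\<phi> x) \<le> B * ns_norm V x)}"
  unfolding set_eq_iff dual_carrier_iff restrict_simps mem_Collect_eq by blast

context homogeneous_nspace
begin

text \<open>
  A functional on \<open>\<B>\<close> that vanishes on \<open>\<A>\<close> is evaluation at some \<open>y\<close>.  All of \<open>\<A>\<close> annihilates \<open>y\<close>, so
  \<open>y\<close> is zero and so is the functional.  Hence no point of \<open>\<B>\<close> can be separated from \<open>\<A>\<close>.
\<close>

theorem predual_not_included:
  assumes A: "is_predual V \<A>" and B: "is_predual V \<B>" and sub: "\<A> \<subseteq> \<B>"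
  shows "\<A> = \<B>"
proof (rule ccontr)
  assume "\<A> \<noteq> \<B>"
  with sub obtain \<psi> where \<psi>: "\<psi> \<in> \<B>" "\<psi> \<notin> \<A>" by blast
  interpret D: complex_nspace "ns_dual V" by (rule complex_nspace_dual)
  have subA: "ns_subspace (ns_dual V) \<A>" and clA: "closedin (norm_topology (ns_dual V)) \<A>"
    and inj: "inj_on (\<lambda>y. \<lambda>\<phi>\<in>\<A>. \<phi> y) (carr)"
    using A by (auto simp: is_predual_def Let_def bij_betw_def)
  have subB: "ns_subspace (ns_dual V) \<B>"
    and surj: "(\<lambda>y. \<lambda>\<phi>\<in>\<B>. \<phi> y) ` carr = ns_carrier (ns_dual (ns_restrict (ns_dual V) \<B>))"
    using B by (auto simp: is_predual_def Let_def bij_betw_def)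
  have BD: "\<B> \<subseteq> dual_carr" using subB by (simp add: ns_subspace_def)
  interpret R: complex_nspace "ns_restrict (ns_dual V) \<B>"
    by (rule complex_nspace_restrict[OF complex_nspace_dual subB])
  have "ns_subspace (ns_restrict (ns_dual V) \<B>) \<A>"
    using subA sub by (simp add: ns_subspace_def)
  moreover have "closedin (norm_topology (ns_restrict (ns_dual V) \<B>)) \<A>"
    using clA sub BD unfolding R.closedin_norm_topology D.closedin_norm_topology by auto
  ultimately obtain \<Lambda> where \<Lambda>: "\<Lambda> \<in> ns_carrier (ns_dual (ns_restrict (ns_dual V) \<B>))"
    "\<And>m. m \<in> \<A> \<Longrightarrow> \<Lambda> m = 0" "\<Lambda> \<psi> \<noteq> 0"
    using R.separate_point_from_closed_subspace[of \<A> \<psi>] \<psi> by auto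
  then obtain y where y: "y \<in> carr" "\<Lambda> = (\<lambda>\<phi>\<in>\<B>. \<phi> y)" using surj by blast
  have "\<phi> y = \<phi> zerov" if "\<phi> \<in> \<A>" for \<phi>
  proof -
    have "\<phi> \<in> \<B>" using sub that by blast
    then have "\<phi> zerov = 0" using BD dual_zerov by blast
    moreover have "\<phi> y = 0" using \<Lambda>(2)[OF that] y(2) \<open>\<phi> \<in> \<B>\<close> by simp
    ultimately show ?thesis by simp
  qed
  then have "(\<lambda>\<phi>\<in>\<A>. \<phi> y) = (\<lambda>\<phi>\<in>\<A>. \<phi> zerov)"
    by (intro restrict_ext) simp
  then have "y = zerov" using inj y(1) zerov(1) by (auto dest: inj_onD)
  moreover have "\<psi> zerov = 0" using \<psi>(1) BD dual_zerov by blast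
  ultimately show False using \<Lambda>(3) y(2) \<psi>(1) by simp
qed

lemma topspace_weak_topology: "\<X> \<noteq> {} \<Longrightarrow> topspace (weak_topology V \<X>) = carr"
  unfolding weak_topology_def topology_generated_by_topspace by auto

lemma openin_weak_vimage:
  "\<lbrakk>\<phi> \<in> \<X>; open U\<rbrakk> \<Longrightarrow> openin (weak_topology V \<X>) {x \<in> carr. \<phi> x \<in> U}"
  unfolding weak_topology_def
  by (rule topology_generated_by_Basis) (auto intro!: exI[of _ \<phi>] exI[of _ U])

text \<open>
  Finite intersections of subbasic sets suffice, by induction over the generation of the topology.
\<close>

lemma weak_neighbourhood_of_zero:
  assumes \<X>: "\<X> \<subseteq> dual_carr" and U: "openin (weak_topology V \<X>) U" and "zerov \<in> U"
  obtains \<Phi> e where "finite \<Phi>" "\<Phi> \<subseteq> \<X>" "e > 0"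
    "\<And>x. \<lbrakk>x \<in> carr; \<And>\<phi>. \<phi> \<in> \<Phi> \<Longrightarrow> cmod (\<phi> x) < e\<rbrakk> \<Longrightarrow> x \<in> U"
proof -
  have "generate_topology_on {\<phi> -` U \<inter> carr | \<phi> U. \<phi> \<in> \<X> \<and> open U} U"
    using U unfolding weak_topology_def openin_topology_generated_by_iff .
  then have "zerov \<in> U \<longrightarrow> (\<exists>\<Phi> e. finite \<Phi> \<and> \<Phi> \<subseteq> \<X> \<and> e > 0 \<and>
    {x \<in> carr. \<forall>\<phi>\<in>\<Phi>. cmod (\<phi> x) < e} \<subseteq> U)"
  proof (induction rule: generate_topology_on.induct)
    case (Int a b)
    show ?case
    proof
      assume "zerov \<in> a \<inter> b"
      then have "zerov \<in> a" "zerov \<in> b" by auto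
      obtain \<Phi> e where \<Phi>: "finite \<Phi>" "\<Phi> \<subseteq> \<X>" "e > 0"
        "{x \<in> carr. \<forall>\<phi>\<in>\<Phi>. cmod (\<phi> x) < e} \<subseteq> a"
        using Int.IH(1) \<open>zerov \<in> a\<close> by blast
      obtain \<Psi> d where \<Psi>: "finite \<Psi>" "\<Psi> \<subseteq> \<X>" "d > 0"
        "{x \<in> carr. \<forall>\<phi>\<in>\<Psi>. cmod (\<phi> x) < d} \<subseteq> b"
        using Int.IH(2) \<open>zerov \<in> b\<close> by blast
      have "{x \<in> carr. \<forall>\<phi>\<in>\<Phi> \<union> \<Psi>. cmod (\<phi> x) < min e d} \<subseteq> a \<inter> b"
        using \<Phi>(4) \<Psi>(4) by (simp add: subset_iff)
      moreover have "finite (\<Phi> \<union> \<Psi>)" "\<Phi> \<union> \<Psi> \<subseteq> \<X>" "min e d > 0" using \<Phi> \<Psi> by simp_all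
      ultimately show "\<exists>\<Phi> e. finite \<Phi> \<and> \<Phi> \<subseteq> \<X> \<and> e > 0 \<and>
        {x \<in> carr. \<forall>\<phi>\<in>\<Phi>. cmod (\<phi> x) < e} \<subseteq> a \<inter> b" by blast
    qed
  next
    case (UN K)
    show ?case
    proof
      assume "zerov \<in> \<Union>K"
      then obtain k where k: "k \<in> K" "zerov \<in> k" by blast
      obtain \<Phi> e where "finite \<Phi>" "\<Phi> \<subseteq> \<X>" "e > 0"
        "{x \<in> carr. \<forall>\<phi>\<in>\<Phi>. cmod (\<phi> x) < e} \<subseteq> k"
        using UN.IH[OF k(1)] k(2) by blast
      then show "\<exists>\<Phi> e. finite \<Phi> \<and> \<Phi> \<subseteq> \<X> \<and> e > 0 \<and>
        {x \<in> carr. \<forall>\<phi>\<in>\<Phi>. cmod (\<phi> x) < e} \<subseteq> \<Union>K" using k(1) by blast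
    qed
  next
    case (Basis s)
    then obtain \<phi> W where s: "s = \<phi> -` W \<inter> carr" "\<phi> \<in> \<X>" "open W" by blast
    show ?case
    proof
      assume "zerov \<in> s"
      moreover have "\<phi> zerov = 0" using s(2) \<X> dual_zerov by blast
      ultimately have "0 \<in> W" using s(1) by simp
      then obtain e where e: "e > 0" "ball 0 e \<subseteq> W" using s(3) open_contains_ball by blast
      then have "{x \<in> carr. \<forall>\<phi>\<in>{\<phi>}. cmod (\<phi> x) < e} \<subseteq> s"
        by (auto simp: s(1))
      moreover have "finite {\<phi>}" "{\<phi>} \<subseteq> \<X>" using s(2) by auto
      ultimately show "\<exists>\<Phi> e. finite \<Phi> \<and> \<Phi> \<subseteq> \<X> \<and> e > 0 \<and>
        {x \<in> carr. \<forall>\<phi>\<in>\<Phi>. cmod (\<phi> x) < e} \<subseteq> s" using e(1) by blast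
    qed
  qed simp
  with \<open>zerov \<in> U\<close> obtain \<Phi> e where "finite \<Phi>" "\<Phi> \<subseteq> \<X>" "e > 0"
    "{x \<in> carr. \<forall>\<phi>\<in>\<Phi>. cmod (\<phi> x) < e} \<subseteq> U" by blast
  then show thesis by (intro that) auto
qed

text \<open>
  If the common kernel of finitely many functionals lies in the kernel of \<open>f\<close>, then \<open>f\<close> is a linear
  combination of them.  Induction on their number: where \<open>\<phi>\<close> does not vanish on the common kernel of the
  others, subtracting \<open>f y * \<phi>\<close> with \<open>\<phi> y = 1\<close> leaves a functional that no longer needs \<open>\<phi>\<close>.
\<close>

lemma functional_in_span_of_kernels:
  assumes \<X>: "ns_subspace (ns_dual V) \<X>" and "finite \<Phi>" "\<Phi> \<subseteq> \<X>"
    and "\<And>x y. \<lbrakk>x \<in> carr; y \<in> carr\<rbrakk> \<Longrightarrow> f (ns_add V x y) = f x + f y"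
    and "\<And>c x. x \<in> carr \<Longrightarrow> f (ns_scale V c x) = c * f x"
    and "\<And>x. \<lbrakk>x \<in> carr; \<And>\<phi>. \<phi> \<in> \<Phi> \<Longrightarrow> \<phi> x = 0\<rbrakk> \<Longrightarrow> f x = 0"
  shows "(\<lambda>x\<in>carr. f x) \<in> \<X>"
  using assms(2-)
proof (induction \<Phi> arbitrary: f rule: finite_induct)
  case empty
  obtain \<phi> where \<phi>: "\<phi> \<in> \<X>" using \<X> by (auto simp: ns_subspace_def)
  then have "ns_scale (ns_dual V) 0 \<phi> \<in> \<X>" using \<X> by (simp add: ns_subspace_def)
  moreover have "ns_scale (ns_dual V) 0 \<phi> = (\<lambda>x\<in>carr. f x)"
    using empty.prems(4) by (auto simp: dual_scale intro!: restrict_ext)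
  ultimately show ?case by metis
next
  case (insert \<phi> \<Phi>)
  have \<phi>X: "\<phi> \<in> \<X>" and \<phi>: "\<phi> \<in> dual_carr"
    and \<Phi>: "\<And>\<psi>. \<psi> \<in> \<Phi> \<Longrightarrow> \<psi> \<in> dual_carr"
    using insert.prems(1) \<X> by (auto simp: ns_subspace_def)
  show ?case
  proof (cases "\<forall>x\<in>carr. (\<forall>\<psi>\<in>\<Phi>. \<psi> x = 0) \<longrightarrow> \<phi> x = 0")
    case True
    show ?thesis
    proof (rule insert.IH)
      fix x assume x: "x \<in> carr" "\<And>\<psi>. \<psi> \<in> \<Phi> \<Longrightarrow> \<psi> x = 0"
      then show "f x = 0" using True by (intro insert.prems(4)) blast+
    qed (use insert.prems in auto)
  next
    case False
    then obtain z where z: "z \<in> carr" "\<forall>\<psi>\<in>\<Phi>. \<psi> z = 0" "\<phi> z \<noteq> 0" by blast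
    define y where "y = ns_scale V (1 / \<phi> z) z"
    have y: "y \<in> carr" "\<phi> y = 1"
      using z by (auto simp: y_def scale_closed dual_scale_apply[OF \<phi>])
    have y\<Phi>: "\<psi> y = 0" if "\<psi> \<in> \<Phi>" for \<psi>
      using dual_scale_apply[OF \<Phi>[OF that] z(1)] z(2) that by (simp add: y_def)
    define g where "g = (\<lambda>x. f x - f y * \<phi> x)"
    have "(\<lambda>x\<in>carr. g x) \<in> \<X>"
    proof (rule insert.IH)
      show "\<Phi> \<subseteq> \<X>" using insert.prems by simp
      show "g (ns_add V a b) = g a + g b" if "a \<in> carr" "b \<in> carr" for a b
        using that insert.prems(2) by (simp add: g_def dual_add_apply[OF \<phi>] algebra_simps)
      show "g (ns_scale V c a) = c * g a" if "a \<in> carr" for c a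
        using that insert.prems(3) by (simp add: g_def dual_scale_apply[OF \<phi>] algebra_simps)
      show "g x = 0" if x: "x \<in> carr" "\<And>\<psi>. \<psi> \<in> \<Phi> \<Longrightarrow> \<psi> x = 0" for x
      proof -
        let ?w = "ns_add V x (ns_scale V (- \<phi> x) y)"
        have "f ?w = 0"
        proof (rule insert.prems(4))
          show "?w \<in> carr" using x y by (simp add: add_closed scale_closed)
          fix \<psi> assume "\<psi> \<in> insert \<phi> \<Phi>"
          then consider "\<psi> = \<phi>" | "\<psi> \<in> \<Phi>" by blast
          then show "\<psi> ?w = 0"
          proof cases
            case 1
            then show ?thesis
              using x(1) y by (simp add: dual_add_apply[OF \<phi>] dual_scale_apply[OF \<phi>] scale_closed)
          next
            case 2
            then show ?thesis
              using x(1) x(2)[OF 2] y(1) y\<Phi>[OF 2] by (simp add: dual_add_apply[OF \<Phi>[OF 2]] dual_scale_apply[OF \<Phi>[OF 2]] scale_closed)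
          qed
        qed
        then show ?thesis
          using insert.prems(2)[OF x(1) scale_closed[OF y(1), of "- \<phi> x"]]
            insert.prems(3)[OF y(1), of "- \<phi> x"] by (simp add: g_def)
      qed
    qed
    then have "ns_add (ns_dual V) (\<lambda>x\<in>carr. g x) (ns_scale (ns_dual V) (f y) \<phi>) \<in> \<X>"
      using \<X> \<phi>X by (simp add: ns_subspace_def)
    moreover have "ns_add (ns_dual V) (\<lambda>x\<in>carr. g x) (ns_scale (ns_dual V) (f y) \<phi>)
      = (\<lambda>x\<in>carr. f x)"
      by (auto simp: dual_add dual_scale g_def intro!: restrict_ext)
    ultimately show ?thesis by metis
  qed
qed

text \<open>
  By continuity \<open>\<bar>f\<bar> < 1\<close> on a set where finitely many \<open>\<phi> \<in> \<X>\<close> are small.  The common kernel of these \<open>\<phi>\<close> is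
  contained in that set and closed under scaling, so \<open>f\<close> vanishes on it.
\<close>

theorem weakly_continuous_functional:
  assumes \<X>: "ns_subspace (ns_dual V) \<X>"
    and add: "\<And>x y. \<lbrakk>x \<in> carr; y \<in> carr\<rbrakk> \<Longrightarrow> f (ns_add V x y) = f x + f y"
    and scale: "\<And>c x. x \<in> carr \<Longrightarrow> f (ns_scale V c x) = c * f x"
    and cont: "continuous_map (weak_topology V \<X>) euclidean f"
  shows "(\<lambda>x\<in>carr. f x) \<in> \<X>"
proof -
  have XD: "\<X> \<subseteq> dual_carr" and ne: "\<X> \<noteq> {}" using \<X> by (auto simp: ns_subspace_def)
  let ?U = "{x \<in> topspace (weak_topology V \<X>). f x \<in> ball 0 1}"
  have "f zerov = 0" using scale[of "SOME x. x \<in> carr" 0] carrier_nonempty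
    by (simp add: zerov_def some_in_eq)
  then have "zerov \<in> ?U" by (simp add: topspace_weak_topology[OF ne] zerov)
  moreover have "openin (weak_topology V \<X>) ?U"
    using cont by (rule openin_continuous_map_preimage) simp
  ultimately obtain \<Phi> e where \<Phi>: "finite \<Phi>" "\<Phi> \<subseteq> \<X>" "e > 0"
    "\<And>x. \<lbrakk>x \<in> carr; \<And>\<phi>. \<phi> \<in> \<Phi> \<Longrightarrow> cmod (\<phi> x) < e\<rbrakk> \<Longrightarrow> x \<in> ?U"
    using weak_neighbourhood_of_zero[OF XD, of ?U] by blast
  show ?thesis
  proof (rule functional_in_span_of_kernels[OF \<X> \<Phi>(1,2)])
    fix x assume x: "x \<in> carr" "\<And>\<phi>. \<phi> \<in> \<Phi> \<Longrightarrow> \<phi> x = 0"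
    show "f x = 0"
    proof (rule ccontr)
      assume nz: "f x \<noteq> 0"
      have "ns_scale V (1 / f x) x \<in> ?U"
      proof (rule \<Phi>(4))
        fix \<phi> assume \<phi>: "\<phi> \<in> \<Phi>"
        then have "\<phi> \<in> dual_carr" using \<Phi>(2) XD by blast
        then show "cmod (\<phi> (ns_scale V (1 / f x) x)) < e"
          using x(2)[OF \<phi>] \<Phi>(3) by (simp add: dual_scale_apply x(1))
      qed (simp add: scale_closed x(1))
      then show False using scale[OF x(1)] nz by simp
    qed
  qed (fact add scale)+
qed

lemma dual_sum:
  assumes \<X>: "ns_subspace (ns_dual V) \<X>" and \<Lambda>: "\<Lambda> \<in> ns_carrier (ns_dual (ns_restrict (ns_dual V) \<X>))"
    and "finite S" "\<And>s. s \<in> S \<Longrightarrow> \<phi> s \<in> \<X>"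
  shows "(\<lambda>x\<in>carr. \<Sum>s\<in>S. c s * \<phi> s x) \<in> \<X> \<and>
    \<Lambda> (\<lambda>x\<in>carr. \<Sum>s\<in>S. c s * \<phi> s x) = (\<Sum>s\<in>S. c s * \<Lambda> (\<phi> s))"
proof -
  define comb where "comb S = (\<lambda>x\<in>carr. \<Sum>s\<in>S. c s * \<phi> s x)" for S
  have "comb S \<in> \<X> \<and> \<Lambda> (comb S) = (\<Sum>s\<in>S. c s * \<Lambda> (\<phi> s))"
    using assms(3,4)
  proof (induction S rule: finite_induct)
    case empty
    obtain \<psi> where \<psi>: "\<psi> \<in> \<X>" using \<X> by (auto simp: ns_subspace_def)
    have "ns_scale (ns_dual V) 0 \<psi> \<in> \<X>" using \<X> \<psi> by (simp add: ns_subspace_def)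
    moreover have "\<Lambda> (ns_scale (ns_dual V) 0 \<psi>) = 0"
      using \<Lambda> \<psi> by (simp add: dual_restrict_carrier)
    moreover have "ns_scale (ns_dual V) 0 \<psi> = comb {}"
      by (simp add: dual_scale comb_def)
    ultimately show ?case by simp
  next
    case (insert a S)
    have IH: "comb S \<in> \<X>" "\<Lambda> (comb S) = (\<Sum>s\<in>S. c s * \<Lambda> (\<phi> s))" using insert by auto
    have a: "\<phi> a \<in> \<X>" "ns_scale (ns_dual V) (c a) (\<phi> a) \<in> \<X>"
      using insert.prems \<X> by (auto simp: ns_subspace_def)
    have eq: "ns_add (ns_dual V) (ns_scale (ns_dual V) (c a) (\<phi> a)) (comb S) = comb (insert a S)"
      using insert.hyps by (auto simp: dual_add dual_scale comb_def intro!: restrict_ext)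
    have "comb (insert a S) \<in> \<X>"
      unfolding eq[symmetric] using a IH \<X> by (simp add: ns_subspace_def)
    moreover have "\<Lambda> (comb (insert a S)) = c a * \<Lambda> (\<phi> a) + \<Lambda> (comb S)"
      unfolding eq[symmetric] using \<Lambda> a IH(1) by (simp add: dual_restrict_carrier)
    ultimately show ?case using IH(2) insert.hyps by simp
  qed
  then show ?thesis unfolding comb_def .
qed

lemma subspace_sum:
  assumes \<X>: "ns_subspace (ns_dual V) \<X>" and "finite S" "\<And>s. s \<in> S \<Longrightarrow> \<phi> s \<in> \<X>"
  shows "(\<lambda>x\<in>carr. \<Sum>s\<in>S. c s * \<phi> s x) \<in> \<X>"
proof -
  interpret R: complex_nspace "ns_restrict (ns_dual V) \<X>"
    by (rule complex_nspace_restrict[OF complex_nspace_dual \<X>])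
  have "(\<lambda>\<phi>\<in>\<X>. 0) \<in> ns_carrier (ns_dual (ns_restrict (ns_dual V) \<X>))"
    using R.zero_in_dual by simp
  from dual_sum[OF \<X> this assms(2), of \<phi> c] assms(3) show ?thesis by blast
qed

end

section \<open>Contractions and pullbacks of functionals\<close>

text \<open>
  Contractive linear maps; the adjoint of such a map between the duals is the pullback defined below.
\<close>

definition contraction :: "'a nspace \<Rightarrow> 'b nspace \<Rightarrow> ('a \<Rightarrow> 'b) \<Rightarrow> bool" where
  "contraction V W T \<longleftrightarrow>
     (\<forall>x\<in>ns_carrier V. T x \<in> ns_carrier W \<and> ns_norm W (T x) \<le> ns_norm V x) \<and>
     (\<forall>x\<in>ns_carrier V. \<forall>y\<in>ns_carrier V. T (ns_add V x y) = ns_add W (T x) (T y)) \<and>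
     (\<forall>c. \<forall>x\<in>ns_carrier V. T (ns_scale V c x) = ns_scale W c (T x))"

definition pullback :: "'a nspace \<Rightarrow> ('a \<Rightarrow> 'b) \<Rightarrow> ('b \<Rightarrow> complex) \<Rightarrow> 'a \<Rightarrow> complex" where
  "pullback V T \<phi> = (\<lambda>x\<in>ns_carrier V. \<phi> (T x))"

locale nspace_contraction = V: homogeneous_nspace V + W: homogeneous_nspace W
  for V :: "'a nspace" and W :: "'b nspace" +
  fixes T assumes contraction: "contraction V W T"
begin

lemma maps: "x \<in> ns_carrier V \<Longrightarrow> T x \<in> ns_carrier W"
  and norm_le: "x \<in> ns_carrier V \<Longrightarrow> ns_norm W (T x) \<le> ns_norm V x"
  using contraction by (auto simp: contraction_def)

lemma pullback_in_dual:
  assumes \<phi>: "\<phi> \<in> ns_carrier (ns_dual W)"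
  shows "pullback V T \<phi> \<in> ns_carrier (ns_dual V)"
  unfolding pullback_def
proof (rule V.dualI[where B="ns_norm (ns_dual W) \<phi>"])
  fix x assume x: "x \<in> ns_carrier V"
  show "cmod (\<phi> (T x)) \<le> ns_norm (ns_dual W) \<phi> * ns_norm V x"
    using W.dual_bound[OF \<phi> maps[OF x]] mult_left_mono[OF norm_le[OF x] W.dual_norm_nonneg[OF \<phi>]]
    by linarith
qed (use contraction in \<open>auto simp: contraction_def W.dual_add_apply[OF \<phi>] W.dual_scale_apply[OF \<phi>]\<close>)

lemma pullback_norm_le:
  assumes "\<phi> \<in> ns_carrier (ns_dual W)"
  shows "ns_norm (ns_dual V) (pullback V T \<phi>) \<le> ns_norm (ns_dual W) \<phi>"
  using assms maps norm_le
  by (intro V.dual_norm_le) (auto simp: pullback_def intro!: W.dual_norm_upper intro: order_trans)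

lemma pullback_add: "pullback V T (ns_add (ns_dual W) \<phi> \<psi>)
    = ns_add (ns_dual V) (pullback V T \<phi>) (pullback V T \<psi>)"
  and pullback_scale: "pullback V T (ns_scale (ns_dual W) c \<phi>) = ns_scale (ns_dual V) c (pullback V T \<phi>)"
  using maps by (auto simp: pullback_def dual_add dual_scale intro!: restrict_ext)

lemma contraction_pullback: "contraction (ns_dual W) (ns_dual V) (pullback V T)"
  by (simp add: contraction_def pullback_in_dual pullback_norm_le pullback_add pullback_scale)

lemma pullback_preimage_subspace:
  assumes "ns_subspace (ns_dual V) \<X>"
  shows "ns_subspace (ns_dual W) {\<phi> \<in> ns_carrier (ns_dual W). pullback V T \<phi> \<in> \<X>}"
proof -
  obtain \<psi> where \<psi>: "\<psi> \<in> \<X>" using assms by (auto simp: ns_subspace_def)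
  then have "ns_scale (ns_dual V) 0 \<psi> \<in> \<X>" using assms by (simp add: ns_subspace_def)
  then have "pullback V T (\<lambda>x\<in>ns_carrier W. 0) \<in> \<X>"
    using maps by (simp add: pullback_def dual_scale cong: restrict_cong)
  then have "(\<lambda>x\<in>ns_carrier W. 0) \<in> {\<phi> \<in> ns_carrier (ns_dual W). pullback V T \<phi> \<in> \<X>}"
    using W.zero_in_dual by simp
  then show ?thesis
    using assms unfolding ns_subspace_def
    by (auto simp: pullback_add pullback_scale W.dual_add_closed W.dual_scale_closed)
qed

lemma pullback_preimage_closed:
  assumes "closedin (norm_topology (ns_dual V)) \<X>"
  shows "closedin (norm_topology (ns_dual W)) {\<phi> \<in> ns_carrier (ns_dual W). pullback V T \<phi> \<in> \<X>}"
proof -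
  interpret DV: complex_nspace "ns_dual V" by (rule V.complex_nspace_dual)
  interpret DW: complex_nspace "ns_dual W" by (rule W.complex_nspace_dual)
  show ?thesis
    unfolding DW.closedin_norm_topology
  proof (intro conjI ballI impI)
    fix \<phi> assume \<phi>: "\<phi> \<in> ns_carrier (ns_dual W)"
      and lim: "\<forall>e>0. \<exists>\<psi>\<in>{\<phi> \<in> ns_carrier (ns_dual W). pullback V T \<phi> \<in> \<X>}.
        ns_norm (ns_dual W) (DW.subv \<phi> \<psi>) < e"
    have "\<exists>\<psi>\<in>\<X>. ns_norm (ns_dual V) (DV.subv (pullback V T \<phi>) \<psi>) < e" if e: "e > 0" for e
    proof -
      obtain \<psi> where \<psi>: "\<psi> \<in> ns_carrier (ns_dual W)" "pullback V T \<psi> \<in> \<X>"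
        "ns_norm (ns_dual W) (DW.subv \<phi> \<psi>) < e" using lim[rule_format, OF e] by auto
      have "DV.subv (pullback V T \<phi>) (pullback V T \<psi>) = pullback V T (DW.subv \<phi> \<psi>)"
        by (simp add: pullback_add pullback_scale)
      then show ?thesis
        using pullback_norm_le[OF DW.minus_closed[OF \<phi> \<psi>(1)]] \<psi>
        by (intro bexI[of _ "pullback V T \<psi>"]) auto
    qed
    then have "pullback V T \<phi> \<in> \<X>"
      using assms pullback_in_dual[OF \<phi>] unfolding DV.closedin_norm_topology by blast
    with \<phi> show "\<phi> \<in> {\<phi> \<in> ns_carrier (ns_dual W). pullback V T \<phi> \<in> \<X>}" by simp
  qed auto
qed

end

section \<open>Matrix norms through bilinear forms\<close>

definition vnorm :: "nat \<Rightarrow> (nat \<Rightarrow> complex) \<Rightarrow> real" where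
  "vnorm n u = L2_set (\<lambda>i. cmod (u i)) {..<n}"

text \<open>
  The matrix norm is the supremum of \<open>\<bar>bil n A w u\<bar>\<close> over the unit ball, and for fixed \<open>w\<close> and \<open>u\<close> this
  form is a linear combination of entries of \<open>A\<close>.  This links norms of values of NC functions with norms
  of combinations of entry functionals.  No conjugation is applied to \<open>w\<close>, so the form is linear in
  both vectors.
\<close>

definition bil :: "nat \<Rightarrow> complex mat \<Rightarrow> (nat \<Rightarrow> complex) \<Rightarrow> (nat \<Rightarrow> complex) \<Rightarrow> complex" where
  "bil n A w u = (\<Sum>a<n. \<Sum>b<n. w a * A $$ (a, b) * u b)"

lemma bil_add:
  "\<lbrakk>A \<in> carrier_mat n n; B \<in> carrier_mat n n\<rbrakk> \<Longrightarrow> bil n (A + B) w u = bil n A w u + bil n B w u"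
  by (simp add: bil_def sum.distrib[symmetric] algebra_simps)

lemma bil_smult: "A \<in> carrier_mat n n \<Longrightarrow> bil n (c \<cdot>\<^sub>m A) w u = c * bil n A w u"
  by (simp add: bil_def sum_distrib_left mult.assoc mult.left_commute)

lemma vnorm_zero: "vnorm n (\<lambda>_. 0) = 0"
  by (simp add: vnorm_def L2_set_0')

lemma vnorm_cong: "(\<And>i. i < n \<Longrightarrow> u i = v i) \<Longrightarrow> vnorm n u = vnorm n v"
  unfolding vnorm_def by (rule L2_set_cong) auto

lemma cmod_le_vnorm: "i < n \<Longrightarrow> cmod (u i) \<le> vnorm n u"
  unfolding vnorm_def using member_le_L2_set[of "{..<n}" i "\<lambda>i. cmod (u i)"] by simp

lemma vnorm_indicator: "a < n \<Longrightarrow> vnorm n (\<lambda>i. if i = a then 1 else 0) = 1"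
proof -
  assume "a < n"
  have "(\<Sum>i<n. (cmod (if i = a then 1 else 0))\<^sup>2) = (\<Sum>i<n. if i = a then 1 else 0)"
    by (rule sum.cong) auto
  then show ?thesis using \<open>a < n\<close> by (simp add: vnorm_def L2_set_def)
qed

lemma bil_indicator:
  assumes "a < n" "b < n"
  shows "bil n A (\<lambda>i. if i = a then 1 else 0) (\<lambda>i. if i = b then 1 else 0) = A $$ (a, b)"
proof -
  have "bil n A (\<lambda>i. if i = a then 1 else 0) (\<lambda>i. if i = b then 1 else 0)
    = (\<Sum>i<n. if i = a then (\<Sum>j<n. if j = b then A $$ (i, j) else 0) else 0)"
    unfolding bil_def by (intro sum.cong refl) (auto simp: if_distrib cong: if_cong)
  then show ?thesis using assms by simp
qed

lemma mat_norm_eq: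
  assumes A: "A \<in> carrier_mat n n"
  shows "mat_norm A = Sup {vnorm n (\<lambda>a. \<Sum>b<n. A $$ (a, b) * u b) | u. vnorm n u \<le> 1}"
proof -
  have app: "L2_set (\<lambda>i. cmod (vec_index (A *\<^sub>v v) i)) {..<dim_row A}
      = vnorm n (\<lambda>a. \<Sum>b<n. A $$ (a, b) * vec_index v b)" if "v \<in> carrier_vec n" for v
    unfolding vnorm_def using A that
    by (intro L2_set_cong) (auto simp: scalar_prod_def atLeast0LessThan)
  have nrm: "L2_set (\<lambda>i. cmod (vec_index v i)) {..<dim_col A} = vnorm n (vec_index v)" for v
    using A by (simp add: vnorm_def)
  have "{L2_set (\<lambda>i. cmod (vec_index (A *\<^sub>v v) i)) {..<dim_row A} | v.
     v \<in> carrier_vec (dim_col A) \<and> L2_set (\<lambda>i. cmod (vec_index v i)) {..<dim_col A} \<le> 1}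
    = {vnorm n (\<lambda>a. \<Sum>b<n. A $$ (a, b) * u b) | u. vnorm n u \<le> 1}" (is "?L = ?R")
  proof
    show "?L \<subseteq> ?R" using A app nrm by auto
    show "?R \<subseteq> ?L"
    proof
      fix x assume "x \<in> ?R"
      then obtain u where u: "x = vnorm n (\<lambda>a. \<Sum>b<n. A $$ (a, b) * u b)" "vnorm n u \<le> 1" by blast
      let ?v = "Matrix.vec n u"
      have "vnorm n (vec_index ?v) \<le> 1" using u(2) by (simp add: vnorm_cong[of n "vec_index ?v" u])
      moreover have "x = L2_set (\<lambda>i. cmod (vec_index (A *\<^sub>v ?v) i)) {..<dim_row A}"
        unfolding u(1) by (subst app) auto
      ultimately show "x \<in> ?L" using A nrm by auto
    qed
  qed
  then show ?thesis by (simp add: mat_norm_def)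
qed

lemma bil_eq: "bil n A w u = (\<Sum>a<n. w a * (\<Sum>b<n. A $$ (a, b) * u b))"
  by (simp add: bil_def sum_distrib_left mult.assoc)

lemma cmod_bil_le:
  assumes A: "A \<in> carrier_mat n n" and w: "vnorm n w \<le> 1" and u: "vnorm n u \<le> 1"
  shows "cmod (bil n A w u) \<le> mat_norm A"
proof -
  let ?Au = "\<lambda>u a. \<Sum>b<n. A $$ (a, b) * u b"
  have bound: "vnorm n (?Au v) \<le> (\<Sum>a<n. \<Sum>b<n. cmod (A $$ (a, b)))" if "vnorm n v \<le> 1" for v
  proof -
    have "cmod (?Au v a) \<le> (\<Sum>b<n. cmod (A $$ (a, b)))" for a
    proof (rule sum_norm_le)
      fix b assume "b \<in> {..<n}"
      then have "cmod (v b) \<le> 1" using cmod_le_vnorm[of b n v] that by simp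
      then show "cmod (A $$ (a, b) * v b) \<le> cmod (A $$ (a, b))"
        by (simp add: norm_mult mult_left_le)
    qed
    moreover have "vnorm n (?Au v) \<le> (\<Sum>a<n. cmod (?Au v a))"
      unfolding vnorm_def by (rule L2_set_le_sum) simp
    ultimately show ?thesis by (meson order_trans sum_mono)
  qed
  have "cmod (bil n A w u) \<le> (\<Sum>a<n. cmod (w a) * cmod (?Au u a))"
    unfolding bil_eq by (rule sum_norm_le) (simp add: norm_mult)
  also have "\<dots> \<le> vnorm n w * vnorm n (?Au u)"
    using L2_set_mult_ineq[of "\<lambda>a. cmod (w a)" "\<lambda>a. cmod (?Au u a)" "{..<n}"] by (simp add: vnorm_def)
  also have "\<dots> \<le> vnorm n (?Au u)"
    using w by (intro mult_left_le_one_le) (auto simp: vnorm_def)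
  also have "\<dots> \<le> mat_norm A"
    unfolding mat_norm_eq[OF A] using u bound by (intro cSup_upper bdd_aboveI) auto
  finally show ?thesis .
qed

text \<open>
  The vector \<open>w\<close> that attains the norm of \<open>A u\<close> is its normalized conjugate.
\<close>

lemma mat_norm_le:
  assumes A: "A \<in> carrier_mat n n"
    and C: "\<And>w u. \<lbrakk>vnorm n w \<le> 1; vnorm n u \<le> 1\<rbrakk> \<Longrightarrow> cmod (bil n A w u) \<le> C"
  shows "mat_norm A \<le> C"
  unfolding mat_norm_eq[OF A]
proof (rule cSup_least)
  show "{vnorm n (\<lambda>a. \<Sum>b<n. A $$ (a, b) * u b) | u. vnorm n u \<le> 1} \<noteq> {}"
    using vnorm_zero[of n] by (auto intro!: exI[of _ "\<lambda>_. 0"])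
  fix x assume "x \<in> {vnorm n (\<lambda>a. \<Sum>b<n. A $$ (a, b) * u b) | u. vnorm n u \<le> 1}"
  then obtain u where u: "vnorm n u \<le> 1" and x: "x = vnorm n (\<lambda>a. \<Sum>b<n. A $$ (a, b) * u b)" by blast
  define y where "y = (\<lambda>a. \<Sum>b<n. A $$ (a, b) * u b)"
  have x: "x = vnorm n y" by (simp add: x y_def)
  show "x \<le> C"
  proof (cases "x = 0")
    case True
    have "0 \<le> cmod (bil n A (\<lambda>_. 0) u)" by simp
    also have "\<dots> \<le> C" using u by (intro C) (auto simp: vnorm_zero)
    finally show ?thesis using True by simp
  next
    case False
    moreover have "0 \<le> x" by (simp add: x vnorm_def)
    ultimately have pos: "x > 0" by simp
    have x2: "x\<^sup>2 = (\<Sum>a<n. (cmod (y a))\<^sup>2)"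
      unfolding x vnorm_def L2_set_def by (simp add: sum_nonneg)
    \<comment> \<open>Normalized conjugate of \<open>y = A u\<close>, so that \<open>bil n A ?w u\<close> is the norm of \<open>y\<close>.\<close>
    let ?w = "\<lambda>a. cnj (y a) / complex_of_real x"
    have "vnorm n ?w = (1 / x) * vnorm n y"
      using pos L2_set_right_distrib[of "1/x" "\<lambda>i. cmod (y i)" "{..<n}"] by (simp add: vnorm_def norm_divide)
    then have "vnorm n ?w \<le> 1" using x pos by simp
    then have "cmod (bil n A ?w u) \<le> C" using u by (rule C)
    moreover have "bil n A ?w u = complex_of_real x"
    proof -
      have "bil n A ?w u = (\<Sum>a<n. ?w a * y a)" by (simp add: bil_eq y_def)
      then have "bil n A ?w u = (\<Sum>a<n. cnj (y a) * y a) / complex_of_real x"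
        by (simp add: sum_divide_distrib)
      also have "(\<Sum>a<n. cnj (y a) * y a) = complex_of_real (x\<^sup>2)"
        unfolding x2 of_real_sum by (intro sum.cong refl) (metis complex_norm_square mult.commute)
      finally show ?thesis using pos by (simp add: power2_eq_square)
    qed
    ultimately show ?thesis using pos by simp
  qed
qed

lemma mat_norm_nonneg: "A \<in> carrier_mat n n \<Longrightarrow> 0 \<le> mat_norm A"
  using cmod_bil_le[of A n "\<lambda>_. 0" "\<lambda>_. 0"] by (simp add: vnorm_zero order_trans[OF norm_ge_zero])

lemma cmod_entry_le_mat_norm:
  "\<lbrakk>A \<in> carrier_mat n n; a < n; b < n\<rbrakk> \<Longrightarrow> cmod (A $$ (a, b)) \<le> mat_norm A"
  using cmod_bil_le[of A n "\<lambda>i. if i = a then 1 else 0" "\<lambda>i. if i = b then 1 else 0"]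
  by (simp add: vnorm_indicator bil_indicator)

lemma mat_norm_le_sum_entries:
  assumes A: "A \<in> carrier_mat n n"
  shows "mat_norm A \<le> (\<Sum>a<n. \<Sum>b<n. cmod (A $$ (a, b)))"
proof (rule mat_norm_le[OF A])
  fix w u assume wu: "vnorm n w \<le> 1" "vnorm n u \<le> 1"
  have "cmod (w a * A $$ (a, b) * u b) \<le> cmod (A $$ (a, b))" if "a < n" "b < n" for a b
  proof -
    have "cmod (w a) \<le> 1" "cmod (u b) \<le> 1"
      using cmod_le_vnorm[OF that(1), of w] cmod_le_vnorm[OF that(2), of u] wu by auto
    then have "cmod (w a) * cmod (u b) \<le> 1" by (simp add: mult_le_one)
    then have "cmod (A $$ (a, b)) * (cmod (w a) * cmod (u b)) \<le> cmod (A $$ (a, b))"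
      by (rule mult_left_le) simp
    then show ?thesis by (simp add: norm_mult mult_ac)
  qed
  then show "cmod (bil n A w u) \<le> (\<Sum>a<n. \<Sum>b<n. cmod (A $$ (a, b)))"
    unfolding bil_def by (intro sum_norm_le) simp
qed

lemma mat_norm_add_le:
  assumes "A \<in> carrier_mat n n" "B \<in> carrier_mat n n"
  shows "mat_norm (A + B) \<le> mat_norm A + mat_norm B"
proof (rule mat_norm_le)
  show "A + B \<in> carrier_mat n n" using assms by simp
  fix w u assume "vnorm n w \<le> 1" "vnorm n u \<le> 1"
  then show "cmod (bil n (A + B) w u) \<le> mat_norm A + mat_norm B"
    using cmod_bil_le[OF assms(1), of w u] cmod_bil_le[OF assms(2), of w u]
      norm_triangle_ineq[of "bil n A w u" "bil n B w u"] by (simp add: bil_add assms)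
qed

lemma mat_norm_smult_le:
  assumes "A \<in> carrier_mat n n"
  shows "mat_norm (c \<cdot>\<^sub>m A) \<le> cmod c * mat_norm A"
  using assms
  by (intro mat_norm_le[of _ n]) (auto simp: bil_smult norm_mult intro!: mult_left_mono cmod_bil_le)

lemma mat_space_simps [simp]:
  "ns_carrier (mat_space n) = carrier_mat n n" "ns_add (mat_space n) = (+)"
  "ns_scale (mat_space n) = (\<cdot>\<^sub>m)" "ns_norm (mat_space n) = mat_norm"
  by (simp_all add: mat_space_def)

lemma homogeneous_mat_space: "homogeneous_nspace (mat_space n)"
  by (rule homogeneous_nspaceI)
    (auto intro: mat_norm_nonneg mat_norm_smult_le intro!: eq_matI exI[of _ "0\<^sub>m n n"])

section \<open>Block matrices\<close>

lemma sum_lessThan_add: "(\<Sum>p<m + (n::nat). f p) = (\<Sum>p<m. f p) + (\<Sum>a<n. f (m + a) :: 'a :: comm_monoid_add)"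
  by (induction n) (simp_all add: add.assoc)

lemma sum_blocks: "(\<Sum>p<k*n. f p) = (\<Sum>i<k. \<Sum>a<n. f (i * n + a :: nat) :: 'a :: comm_monoid_add)"
proof (induction k)
  case (Suc k)
  have "(\<Sum>p<Suc k * n. f p) = (\<Sum>p<k*n + n. f p)" by (simp add: add.commute)
  also have "\<dots> = (\<Sum>p<k*n. f p) + (\<Sum>a<n. f (k * n + a))" by (rule sum_lessThan_add)
  finally show ?case by (simp add: Suc)
qed simp

lemma block_index_less: "\<lbrakk>i < k; a < n\<rbrakk> \<Longrightarrow> i * n + a < k * (n::nat)"
proof -
  assume "i < k" "a < n"
  then have "i * n + a < Suc i * n" by simp
  also have "\<dots> \<le> k * n" using \<open>i < k\<close> by (intro mult_le_mono1) simp
  finally show ?thesis .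
qed

lemma flatten_carrier: "flatten_blocks k n A \<in> carrier_mat (k * n) (k * n)"
  by (simp add: flatten_blocks_def)

lemma flatten_dim [simp]:
  "dim_row (flatten_blocks k n A) = k * n" "dim_col (flatten_blocks k n A) = k * n"
  by (simp_all add: flatten_blocks_def)

lemma flatten_entry:
  "\<lbrakk>i < k; j < k; a < n; b < n\<rbrakk>
    \<Longrightarrow> flatten_blocks k n A $$ (i * n + a, j * n + b) = (A $$ (i, j)) $$ (a, b)"
  by (simp add: flatten_blocks_def block_index_less)

lemma bil_flatten:
  "bil (k * n) (flatten_blocks k n A) w u
    = (\<Sum>i<k. \<Sum>j<k. bil n (A $$ (i, j)) (\<lambda>a. w (i * n + a)) (\<lambda>b. u (j * n + b)))"
proof -
  have "bil (k * n) (flatten_blocks k n A) w u = (\<Sum>i<k. \<Sum>a<n. \<Sum>j<k. \<Sum>b<n.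
      w (i * n + a) * (A $$ (i, j)) $$ (a, b) * u (j * n + b))"
    unfolding bil_def sum_blocks by (intro sum.cong refl) (simp add: flatten_entry)
  also have "\<dots> = (\<Sum>i<k. \<Sum>j<k. \<Sum>a<n. \<Sum>b<n.
      w (i * n + a) * (A $$ (i, j)) $$ (a, b) * u (j * n + b))"
    by (intro sum.cong refl sum.swap)
  finally show ?thesis by (simp add: bil_def)
qed

lemma vnorm_block_le:
  assumes "i < k"
  shows "vnorm n (\<lambda>a. w (i * n + a)) \<le> vnorm (k * n) w"
proof -
  have "(\<Sum>a<n. (cmod (w (i * n + a)))\<^sup>2) \<le> (\<Sum>i<k. \<Sum>a<n. (cmod (w (i * n + a)))\<^sup>2)"
    using assms by (intro member_le_sum[where f="\<lambda>i. \<Sum>a<n. (cmod (w (i * n + a)))\<^sup>2"]) (auto simp: sum_nonneg)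
  then show ?thesis
    by (simp add: vnorm_def L2_set_def sum_blocks)
qed

lemma vnorm_embed_block:
  assumes "i < k"
  shows "vnorm (k * n) (\<lambda>p. if p div n = i then w (p mod n) else 0) = vnorm n w"
proof -
  have "(\<Sum>p<k*n. (cmod (if p div n = i then w (p mod n) else 0))\<^sup>2)
    = (\<Sum>i'<k. if i' = i then (\<Sum>a<n. (cmod (w a))\<^sup>2) else 0)"
    unfolding sum_blocks by (intro sum.cong refl) (auto intro!: sum.cong sum.neutral)
  then show ?thesis using assms by (simp add: vnorm_def L2_set_def)
qed

text \<open>
  Vectors supported in one block see only one entry of the block matrix.
\<close>

lemma mat_norm_block_le:
  assumes A: "A $$ (i, j) \<in> carrier_mat n n" and ij: "i < k" "j < k"
  shows "mat_norm (A $$ (i, j)) \<le> mat_norm (flatten_blocks k n A)"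
proof (rule mat_norm_le[OF A])
  fix w u assume wu: "vnorm n w \<le> 1" "vnorm n u \<le> 1"
  let ?w = "\<lambda>p. if p div n = i then w (p mod n) else 0"
  let ?u = "\<lambda>p. if p div n = j then u (p mod n) else 0"
  have "bil (k * n) (flatten_blocks k n A) ?w ?u
    = (\<Sum>i'<k. \<Sum>j'<k. if j' = j then if i' = i then bil n (A $$ (i, j)) w u else 0 else 0)"
    unfolding bil_flatten by (intro sum.cong refl) (auto simp: bil_def intro!: sum.cong sum.neutral)
  also have "\<dots> = bil n (A $$ (i, j)) w u" using ij by simp
  finally show "cmod (bil n (A $$ (i, j)) w u) \<le> mat_norm (flatten_blocks k n A)"
    using cmod_bil_le[OF flatten_carrier, of k n ?w ?u A] wu ij by (simp add: vnorm_embed_block)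
qed

text \<open>
  A bound that does not depend on the size \<open>n\<close> of the blocks; it makes the norm of \<open>mat_Hinf\<close> finite.
\<close>

lemma mat_norm_flatten_le:
  assumes A: "\<And>i j. \<lbrakk>i < k; j < k\<rbrakk> \<Longrightarrow> A $$ (i, j) \<in> carrier_mat n n"
  shows "mat_norm (flatten_blocks k n A) \<le> (\<Sum>i<k. \<Sum>j<k. mat_norm (A $$ (i, j)))"
proof (rule mat_norm_le[OF flatten_carrier])
  fix w u assume wu: "vnorm (k * n) w \<le> 1" "vnorm (k * n) u \<le> 1"
  have "cmod (bil n (A $$ (i, j)) (\<lambda>a. w (i * n + a)) (\<lambda>b. u (j * n + b))) \<le> mat_norm (A $$ (i, j))"
    if "i < k" "j < k" for i j
    using vnorm_block_le[OF that(1), of n w] vnorm_block_le[OF that(2), of n u] wu that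
    by (intro cmod_bil_le A) auto
  then show "cmod (bil (k * n) (flatten_blocks k n A) w u) \<le> (\<Sum>i<k. \<Sum>j<k. mat_norm (A $$ (i, j)))"
    unfolding bil_flatten by (intro sum_norm_le) simp
qed

lemma mat_amp_simps [simp]:
  "ns_carrier (mat_amp k V nrm) = {A \<in> carrier_mat k k. \<forall>i<k. \<forall>j<k. A $$ (i, j) \<in> ns_carrier V}"
  "ns_add (mat_amp k V nrm) = (\<lambda>A B. Matrix.mat k k (\<lambda>(i, j). ns_add V (A $$ (i, j)) (B $$ (i, j))))"
  "ns_scale (mat_amp k V nrm) = (\<lambda>c A. Matrix.mat k k (\<lambda>(i, j). ns_scale V c (A $$ (i, j))))"
  "ns_norm (mat_amp k V nrm) = nrm"
  by (simp_all add: mat_amp_def)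

lemma block_mat_space_simps [simp]:
  "ns_carrier (block_mat_space k n)
    = {A \<in> carrier_mat k k. \<forall>i<k. \<forall>j<k. A $$ (i, j) \<in> carrier_mat n n}"
  "ns_add (block_mat_space k n) = (\<lambda>A B. Matrix.mat k k (\<lambda>(i, j). A $$ (i, j) + B $$ (i, j)))"
  "ns_scale (block_mat_space k n) = (\<lambda>c A. Matrix.mat k k (\<lambda>(i, j). c \<cdot>\<^sub>m A $$ (i, j)))"
  "ns_norm (block_mat_space k n) = (\<lambda>A. mat_norm (flatten_blocks k n A))"
  by (simp_all add: block_mat_space_def)

lemma div_mod_less: "p < k * n \<Longrightarrow> p div n < k \<and> p mod n < (n::nat)"
  by (metis less_mult_imp_div_less mod_less_divisor mult_0_right not_gr_zero not_less_zero)

lemma flatten_add: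
  assumes "A \<in> ns_carrier (block_mat_space k n)" "B \<in> ns_carrier (block_mat_space k n)"
  shows "flatten_blocks k n (ns_add (block_mat_space k n) A B) = flatten_blocks k n A + flatten_blocks k n B"
proof (rule eq_matI)
  fix p q assume "p < dim_row (flatten_blocks k n A + flatten_blocks k n B)"
    "q < dim_col (flatten_blocks k n A + flatten_blocks k n B)"
  then have pq: "p < k * n" "q < k * n" by (auto simp: flatten_blocks_def)
  note dm = div_mod_less[OF pq(1)] div_mod_less[OF pq(2)]
  then have "B $$ (p div n, q div n) \<in> carrier_mat n n" using assms by auto
  then show "flatten_blocks k n (ns_add (block_mat_space k n) A B) $$ (p, q)
    = (flatten_blocks k n A + flatten_blocks k n B) $$ (p, q)"
    using pq dm by (simp add: flatten_blocks_def)
qed (auto simp: flatten_blocks_def)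

lemma flatten_scale:
  assumes "A \<in> ns_carrier (block_mat_space k n)"
  shows "flatten_blocks k n (ns_scale (block_mat_space k n) c A) = c \<cdot>\<^sub>m flatten_blocks k n A"
proof (rule eq_matI)
  fix p q assume "p < dim_row (c \<cdot>\<^sub>m flatten_blocks k n A)" "q < dim_col (c \<cdot>\<^sub>m flatten_blocks k n A)"
  then have pq: "p < k * n" "q < k * n" by (auto simp: flatten_blocks_def)
  note dm = div_mod_less[OF pq(1)] div_mod_less[OF pq(2)]
  then have "A $$ (p div n, q div n) \<in> carrier_mat n n" using assms by auto
  then show "flatten_blocks k n (ns_scale (block_mat_space k n) c A) $$ (p, q)
    = (c \<cdot>\<^sub>m flatten_blocks k n A) $$ (p, q)"
    using pq dm by (simp add: flatten_blocks_def)
qed (auto simp: flatten_blocks_def)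

text \<open>
  Flattening identifies block matrices with scalar matrices, from which they inherit the laws of a
  normed space.
\<close>

lemma flatten_inj:
  assumes "A \<in> ns_carrier (block_mat_space k n)" "B \<in> ns_carrier (block_mat_space k n)"
    and "flatten_blocks k n A = flatten_blocks k n B"
  shows "A = B"
proof (rule eq_matI)
  fix i j assume "i < dim_row B" "j < dim_col B"
  then have ij: "i < k" "j < k" using assms by auto
  then have car: "A $$ (i, j) \<in> carrier_mat n n" "B $$ (i, j) \<in> carrier_mat n n" using assms by auto
  have "(A $$ (i, j)) $$ (a, b) = (B $$ (i, j)) $$ (a, b)" if "a < n" "b < n" for a b
    using flatten_entry[OF ij that, of A] flatten_entry[OF ij that, of B] assms(3) by simp
  then show "A $$ (i, j) = B $$ (i, j)" using car by (intro eq_matI) auto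
qed (use assms in auto)

lemma complex_nspace_block_mat: "complex_nspace (block_mat_space k n)"
proof -
  let ?B = "block_mat_space k n"
  have addc: "ns_add ?B A B \<in> ns_carrier ?B" if "A \<in> ns_carrier ?B" "B \<in> ns_carrier ?B" for A B
    using that by simp
  have scalec: "ns_scale ?B c A \<in> ns_carrier ?B" if "A \<in> ns_carrier ?B" for c A
    using that by simp
  interpret homogeneous_nspace ?B
  proof (rule homogeneous_nspaceI)
    show "ns_carrier ?B \<noteq> {}"
      by (auto intro!: exI[of _ "Matrix.mat k k (\<lambda>_. 0\<^sub>m n n)"])
    show "0 \<le> ns_norm ?B A" if "A \<in> ns_carrier ?B" for A
      using mat_norm_nonneg[OF flatten_carrier] by simp
    show "ns_norm ?B (ns_scale ?B c A) \<le> cmod c * ns_norm ?B A" if "A \<in> ns_carrier ?B" for c A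
      using mat_norm_smult_le[OF flatten_carrier, of c k n A] flatten_scale[OF that, of c] by simp
    show "ns_scale ?B (inverse c) (ns_scale ?B c A) = A" if "A \<in> ns_carrier ?B" "c \<noteq> 0" for c A
    proof (rule flatten_inj[OF scalec[OF scalec[OF that(1)]] that(1)])
      show "flatten_blocks k n (ns_scale ?B (inverse c) (ns_scale ?B c A)) = flatten_blocks k n A"
        unfolding flatten_scale[OF scalec[OF that(1)]] flatten_scale[OF that(1)]
        by (rule eq_matI) (use that(2) in auto)
    qed
  qed (auto simp del: block_mat_space_simps intro: addc scalec)
  note F = flatten_add flatten_scale addc scalec
  show ?thesis
  proof
    fix x y z b c assume x: "x \<in> ns_carrier ?B" and y: "y \<in> ns_carrier ?B" and z: "z \<in> ns_carrier ?B"
    note [simp del] = block_mat_space_simps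
    have car: "flatten_blocks k n x \<in> carrier_mat (k*n) (k*n)" for x by (rule flatten_carrier)
    show "ns_add ?B (ns_add ?B x y) z = ns_add ?B x (ns_add ?B y z)"
      by (rule flatten_inj[of _ k n]) (use x y z in \<open>simp_all add: F assoc_add_mat[OF car car car]\<close>)
    show "ns_add ?B x y = ns_add ?B y x"
      by (rule flatten_inj[of _ k n]) (use x y in \<open>simp_all add: F comm_add_mat[OF car car]\<close>)
    show "ns_add ?B x (ns_scale ?B 0 y) = x"
      by (rule flatten_inj[of _ k n]) (use x y in \<open>auto simp: F intro!: eq_matI\<close>)
    show "ns_scale ?B c (ns_add ?B x y) = ns_add ?B (ns_scale ?B c x) (ns_scale ?B c y)"
      by (rule flatten_inj[of _ k n]) (use x y in \<open>simp_all add: F add_smult_distrib_left_mat[OF car car]\<close>)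
    show "ns_scale ?B (b + c) x = ns_add ?B (ns_scale ?B b x) (ns_scale ?B c x)"
      by (rule flatten_inj[of _ k n]) (use x y in \<open>simp_all add: F add_smult_distrib_right_mat[OF car]\<close>)
    show "ns_scale ?B b (ns_scale ?B c x) = ns_scale ?B (b * c) x"
      by (rule flatten_inj[of _ k n]) (use x in \<open>auto simp: F mult.assoc intro!: eq_matI\<close>)
    show "ns_scale ?B 1 x = x"
      by (rule flatten_inj[of _ k n]) (use x in \<open>auto simp: F intro!: eq_matI\<close>)
    show "ns_norm ?B (ns_add ?B x y) \<le> ns_norm ?B x + ns_norm ?B y"
      using mat_norm_add_le[OF car car, of x y] flatten_add[OF x y] by (simp add: block_mat_space_simps)
    show "x = ns_scale ?B 0 x" if "ns_norm ?B x = 0"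
    proof (rule flatten_inj[of _ k n])
      show "flatten_blocks k n x = flatten_blocks k n (ns_scale ?B 0 x)"
        unfolding flatten_scale[OF x]
        using that cmod_entry_le_mat_norm[OF car[of x]] car[of x]
        by (intro eq_matI) (auto simp: block_mat_space_simps)
    qed (use x scalec in auto)
  qed
qed

section \<open>Expansion in matrix units\<close>

text \<open>
  The matrix with \<open>x\<close> at position \<open>p\<close> and zeros elsewhere.  Writing the zeros as multiples of \<open>x\<close>
  makes the map linear in \<open>x\<close> without reference to a zero element of the carrier.
\<close>

definition matrix_unit :: "'a nspace \<Rightarrow> nat \<Rightarrow> nat \<times> nat \<Rightarrow> 'a \<Rightarrow> 'a mat" where
  "matrix_unit V k p x = Matrix.mat k k (\<lambda>q. if q = p then x else ns_scale V 0 x)"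

text \<open>
  Induction over the set of positions that have been filled in; the remaining positions hold zeros.
\<close>

lemma (in complex_nspace) additive_matrix_unit_expansion:
  fixes \<psi> :: "'a mat \<Rightarrow> complex"
  assumes Y: "Y = mat_amp k V nrm"
    and add: "\<And>A B. \<lbrakk>A \<in> ns_carrier Y; B \<in> ns_carrier Y\<rbrakk> \<Longrightarrow> \<psi> (ns_add Y A B) = \<psi> A + \<psi> B"
    and scale: "\<And>c A. A \<in> ns_carrier Y \<Longrightarrow> \<psi> (ns_scale Y c A) = c * \<psi> A"
    and F: "F \<in> ns_carrier Y"
  shows "\<psi> F = (\<Sum>p\<in>{..<k}\<times>{..<k}. \<psi> (matrix_unit V k p (F $$ p)))"
proof -
  define part where "part S = Matrix.mat k k (\<lambda>p. if p \<in> S then F $$ p else ns_scale V 0 (F $$ p))" for S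
  have FV: "F $$ p \<in> ns_carrier V" if "p \<in> {..<k}\<times>{..<k}" for p
    using F that by (auto simp: Y)
  have part: "part S \<in> ns_carrier Y" for S
    using FV by (auto simp: Y part_def scale_closed)
  have unit: "matrix_unit V k p x \<in> ns_carrier Y" if "x \<in> ns_carrier V" for p x
    using that by (auto simp: Y matrix_unit_def scale_closed)
  have "\<psi> (part S) = (\<Sum>p\<in>S. \<psi> (matrix_unit V k p (F $$ p)))"
    if "finite S" "S \<subseteq> {..<k}\<times>{..<k}" for S
    using that
  proof (induction S rule: finite_induct)
    case empty
    have "part {} = ns_scale Y 0 F" by (auto simp: part_def Y intro!: eq_matI)
    then show ?case using scale[OF F, of 0] by simp
  next
    case (insert p S)
    then have p: "F $$ p \<in> ns_carrier V" using FV by auto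
    have "part (insert p S) = ns_add Y (part S) (matrix_unit V k p (F $$ p))"
    proof (rule eq_matI)
      fix i j assume "i < dim_row (ns_add Y (part S) (matrix_unit V k p (F $$ p)))"
        "j < dim_col (ns_add Y (part S) (matrix_unit V k p (F $$ p)))"
      then have ij: "i < k" "j < k" by (auto simp: Y)
      then have "F $$ (i, j) \<in> ns_carrier V" using FV by auto
      then show "part (insert p S) $$ (i, j) = ns_add Y (part S) (matrix_unit V k p (F $$ p)) $$ (i, j)"
        using ij p insert.hyps by (auto simp: Y part_def matrix_unit_def add_zero zero_add scale_closed)
    qed (auto simp: Y part_def)
    then show ?case using insert add[OF part unit[OF p], of S] by (simp add: add.commute)
  qed
  from this[of "{..<k}\<times>{..<k}"] have "\<psi> (part ({..<k}\<times>{..<k})) = (\<Sum>p\<in>{..<k}\<times>{..<k}. \<psi> (matrix_unit V k p (F $$ p)))"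
    by simp
  moreover have "part ({..<k}\<times>{..<k}) = F"
    using F by (auto simp: part_def Y intro!: eq_matI)
  ultimately show ?thesis by simp
qed

text \<open>
  The scalars as a normed space, so that scalar matrices are matrices over a normed space too.
\<close>

definition complex_line :: "complex nspace" where
  "complex_line = \<lparr>ns_carrier = UNIV, ns_add = (+), ns_scale = (*), ns_norm = cmod\<rparr>"

lemma complex_nspace_complex_line: "complex_nspace complex_line"
  by unfold_locales (auto simp: complex_line_def algebra_simps norm_mult norm_triangle_ineq)

lemma mat_functional_expansion:
  assumes \<eta>: "\<eta> \<in> ns_carrier (ns_dual (mat_space n))" and A: "A \<in> carrier_mat n n"
  shows "\<eta> A = (\<Sum>p\<in>{..<n}\<times>{..<n}. \<eta> (matrix_unit complex_line n p 1) * A $$ p)"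
proof -
  interpret complex_nspace complex_line by (rule complex_nspace_complex_line)
  interpret M: homogeneous_nspace "mat_space n" by (rule homogeneous_mat_space)
  have cl: "ns_add complex_line = (+)" "ns_scale complex_line = (*)" "ns_carrier complex_line = UNIV"
    by (simp_all add: complex_line_def)
  have "\<eta> A = (\<Sum>p\<in>{..<n}\<times>{..<n}. \<eta> (matrix_unit complex_line n p (A $$ p)))"
  proof (rule additive_matrix_unit_expansion[OF refl, where nrm=mat_norm])
    fix B C assume "B \<in> ns_carrier (mat_amp n complex_line mat_norm)" "C \<in> ns_carrier (mat_amp n complex_line mat_norm)"
    then have BC: "B \<in> carrier_mat n n" "C \<in> carrier_mat n n" by (auto simp: cl)
    have "ns_add (mat_amp n complex_line mat_norm) B C = B + C"
      using BC by (intro eq_matI) (auto simp: cl)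
    then show "\<eta> (ns_add (mat_amp n complex_line mat_norm) B C) = \<eta> B + \<eta> C"
      using M.dual_add_apply[OF \<eta>, of B C] BC by simp
  next
    fix c B assume "B \<in> ns_carrier (mat_amp n complex_line mat_norm)"
    then have B: "B \<in> carrier_mat n n" by (auto simp: cl)
    have "ns_scale (mat_amp n complex_line mat_norm) c B = c \<cdot>\<^sub>m B"
      using B by (intro eq_matI) (auto simp: cl)
    then show "\<eta> (ns_scale (mat_amp n complex_line mat_norm) c B) = c * \<eta> B"
      using M.dual_scale_apply[OF \<eta>, of B] B by simp
  qed (use A in \<open>simp add: cl\<close>)
  moreover have "\<eta> (matrix_unit complex_line n p (A $$ p)) = \<eta> (matrix_unit complex_line n p 1) * A $$ p" for p
  proof -
    have "matrix_unit complex_line n p (A $$ p) = (A $$ p) \<cdot>\<^sub>m matrix_unit complex_line n p 1"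
      by (auto simp: matrix_unit_def cl intro!: eq_matI)
    moreover have "matrix_unit complex_line n p 1 \<in> carrier_mat n n" by (simp add: matrix_unit_def)
    ultimately show ?thesis
      using M.dual_scale_apply[OF \<eta>, of "matrix_unit complex_line n p 1" "A $$ p"] by simp
  qed
  ultimately show ?thesis by simp
qed

section \<open>The NC operator ball\<close>

lemma scaleC_zero_left: "(0::complex) *\<^sub>C x = 0"
  using scaleR_scaleC[of 0 x] by simp

text \<open>
  The class axioms tie the norm to real scalars directly, to complex ones through the inner product.
\<close>

lemma norm_scaleC: "norm (c *\<^sub>C x) = cmod c * norm x"
proof -
  have "cinner (c *\<^sub>C x) (c *\<^sub>C x) = c * cnj (c * cinner x x)"
    by (metis cinner_commute cinner_scaleC_left)
  also have "\<dots> = (c * cnj c) * complex_of_real ((norm x)\<^sup>2)"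
    by (simp add: cinner_self)
  also have "\<dots> = complex_of_real ((cmod c * norm x)\<^sup>2)"
    by (simp only: complex_norm_square[symmetric] of_real_mult[symmetric] power_mult_distrib)
  finally have "(norm (c *\<^sub>C x))\<^sup>2 = (cmod c * norm x)\<^sup>2"
    by (simp only: cinner_self of_real_eq_iff)
  then show ?thesis by (simp add: power2_eq_iff_nonneg)
qed

lemma mat_dsum_carrier:
  "\<lbrakk>A \<in> carrier_mat n n; B \<in> carrier_mat m m\<rbrakk> \<Longrightarrow> mat_dsum A B \<in> carrier_mat (n + m) (n + m)"
  by (simp add: mat_dsum_def)

lemma mat_dsum_entry:
  assumes "A \<in> carrier_mat n n" "B \<in> carrier_mat m m" "a < n + m" "b < n + m"
  shows "mat_dsum A B $$ (a, b) =
    (if a < n \<and> b < n then A $$ (a, b) else if n \<le> a \<and> n \<le> b then B $$ (a - n, b - n) else 0)"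
  using assms by (auto simp: mat_dsum_def)

locale nc_operator_ball =
  fixes Q :: "'d::finite \<Rightarrow> 'h::complex_hilbert_space \<Rightarrow> 'h"
  assumes Q_bounded_clinear: "bounded_clinear (Q j)"
begin

lemma Q_bounded_linear: "bounded_linear (Q j)"
  using Q_bounded_clinear by (simp add: bounded_clinear_def)

lemma pencil_apply_scaleR:
  "pencil_apply Q n X (\<lambda>b. r *\<^sub>R v b) a = r *\<^sub>R pencil_apply Q n X v a"
proof -
  have "c *\<^sub>C r *\<^sub>R x = r *\<^sub>R c *\<^sub>C x" for c and x :: 'h
    by (simp add: scaleR_scaleC scaleC_scaleC mult.commute)
  then show ?thesis
    by (simp add: pencil_apply_def scaleR_sum_right linear_simps(5)[OF Q_bounded_linear])
qed

text \<open>
  The supremum in \<open>pencil_norm\<close> is over a bounded set since the \<open>Q j\<close> are bounded operators.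
\<close>

lemma pencil_apply_norm_bounded:
  obtains C where "\<And>v. L2_set (\<lambda>b. norm (v b)) {..<n} \<le> 1 \<Longrightarrow>
    L2_set (\<lambda>a. norm (pencil_apply Q n X v a)) {..<n} \<le> C"
proof
  fix v :: "nat \<Rightarrow> 'h" assume v: "L2_set (\<lambda>b. norm (v b)) {..<n} \<le> 1"
  have "norm (pencil_apply Q n X v a) \<le> (\<Sum>j\<in>UNIV. \<Sum>b<n. cmod (X j $$ (a, b)) * onorm (Q j))" for a
    unfolding pencil_apply_def
  proof (intro sum_norm_le)
    fix j b assume "b \<in> {..<n}"
    then have "norm (v b) \<le> 1"
      using member_le_L2_set[of "{..<n}" b "\<lambda>b. norm (v b)"] v by simp
    then have "onorm (Q j) * norm (v b) \<le> onorm (Q j)"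
      by (simp add: mult_left_le onorm_pos_le[OF Q_bounded_linear])
    then have "norm (Q j (v b)) \<le> onorm (Q j)"
      using onorm[OF Q_bounded_linear, of j "v b"] by linarith
    then show "norm (X j $$ (a, b) *\<^sub>C Q j (v b)) \<le> cmod (X j $$ (a, b)) * onorm (Q j)"
      by (simp add: norm_scaleC mult_left_mono)
  qed
  then show "L2_set (\<lambda>a. norm (pencil_apply Q n X v a)) {..<n}
    \<le> (\<Sum>a<n. \<Sum>j\<in>UNIV. \<Sum>b<n. cmod (X j $$ (a, b)) * onorm (Q j))"
    by (intro order_trans[OF L2_set_le_sum] sum_mono) auto
qed

lemma pencil_norm_upper:
  assumes "L2_set (\<lambda>b. norm (v b)) {..<n} \<le> 1"
  shows "L2_set (\<lambda>a. norm (pencil_apply Q n X v a)) {..<n} \<le> pencil_norm Q n X"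
proof -
  obtain C where "\<And>v. L2_set (\<lambda>b. norm (v b)) {..<n} \<le> 1 \<Longrightarrow>
    L2_set (\<lambda>a. norm (pencil_apply Q n X v a)) {..<n} \<le> C"
    using pencil_apply_norm_bounded by blast
  then show ?thesis
    unfolding pencil_norm_def using assms by (intro cSup_upper bdd_aboveI[of _ C]) auto
qed

lemma pencil_norm_le:
  assumes "\<And>v. L2_set (\<lambda>b. norm (v b)) {..<n} \<le> 1 \<Longrightarrow>
    L2_set (\<lambda>a. norm (pencil_apply Q n X v a)) {..<n} \<le> C"
  shows "pencil_norm Q n X \<le> C"
  unfolding pencil_norm_def
proof (rule cSup_least)
  have "L2_set (\<lambda>b. norm (0::'h)) {..<n} \<le> 1" by (simp add: L2_set_0')
  then show "{L2_set (\<lambda>a. norm (pencil_apply Q n X v a)) {..<n} | v.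
     L2_set (\<lambda>b. norm (v b)) {..<n} \<le> 1} \<noteq> {}"
    by (intro ex_in_conv[THEN iffD1] exI[of _ "L2_set (\<lambda>a. norm (pencil_apply Q n X (\<lambda>_. 0) a)) {..<n}"]
      CollectI exI[of _ "\<lambda>_. 0"] conjI refl)
qed (use assms in blast)

lemma pencil_norm_nonneg: "0 \<le> pencil_norm Q n X"
  using pencil_norm_upper[of "\<lambda>_. 0" n X] by (simp add: L2_set_0' order_trans[OF L2_set_nonneg])

lemma pencil_norm_bound:
  "L2_set (\<lambda>a. norm (pencil_apply Q n X v a)) {..<n} \<le> pencil_norm Q n X * L2_set (\<lambda>b. norm (v b)) {..<n}"
proof (cases "L2_set (\<lambda>b. norm (v b)) {..<n} = 0")
  case True
  then have "v b = 0" if "b < n" for b using that by (simp add: L2_set_eq_0_iff)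
  moreover have "c *\<^sub>C Q j 0 = 0" for c j
    using norm_scaleC[of c "Q j 0"] linear_simps(3)[OF Q_bounded_linear, of j] by simp
  ultimately have "pencil_apply Q n X v a = 0" for a
    by (simp add: pencil_apply_def)
  then show ?thesis using True by (simp add: L2_set_0')
next
  case False
  let ?l = "L2_set (\<lambda>b. norm (v b)) {..<n}"
  from False have pos: "?l > 0" by (simp add: order_less_le)
  have scale: "L2_set (\<lambda>b. norm ((1 / ?l) *\<^sub>R w b)) {..<n} = (1 / ?l) * L2_set (\<lambda>b. norm (w b)) {..<n}" for w :: "nat \<Rightarrow> 'h"
    using pos by (subst L2_set_right_distrib) auto
  have "L2_set (\<lambda>a. norm (pencil_apply Q n X (\<lambda>b. (1 / ?l) *\<^sub>R v b) a)) {..<n} \<le> pencil_norm Q n X"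
    by (rule pencil_norm_upper) (use scale[of v] pos in simp)
  then have "(1 / ?l) * L2_set (\<lambda>a. norm (pencil_apply Q n X v a)) {..<n} \<le> pencil_norm Q n X"
    unfolding pencil_apply_scaleR scale .
  then show ?thesis using pos by (simp add: field_simps)
qed

lemma nc_ball_at_carrier: "X \<in> nc_ball_at Q n \<Longrightarrow> X j \<in> carrier_mat n n"
  by (simp add: nc_ball_at_def)

lemma nc_ball_at_subset: "X \<in> nc_ball_at Q n \<Longrightarrow> X \<in> nc_ball Q"
  by (auto simp: nc_ball_def)

lemma nc_ball_cases: "X \<in> nc_ball Q \<Longrightarrow> (\<And>n. X \<in> nc_ball_at Q n \<Longrightarrow> P) \<Longrightarrow> P"
  by (auto simp: nc_ball_def)

lemma zero_in_nc_ball: "(\<lambda>_. 0\<^sub>m 1 1) \<in> nc_ball_at Q 1"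
proof -
  have "pencil_apply Q 1 (\<lambda>_. 0\<^sub>m 1 1) v a = 0" if "a < 1" for v a
    using that by (simp add: pencil_apply_def scaleC_zero_left)
  then have "{L2_set (\<lambda>a. norm (pencil_apply Q 1 (\<lambda>_. 0\<^sub>m 1 1) v a)) {..<1} | v.
     L2_set (\<lambda>b. norm (v b)) {..<1} \<le> 1} = {0}"
    by (auto simp: L2_set_0' intro!: exI[of _ "\<lambda>_. 0"])
  then show ?thesis by (simp add: nc_ball_at_def pencil_norm_def)
qed

text \<open>
  The pencil at a direct sum acts separately on the two parts of the vector, so its norm is at most
  the larger of the two norms.  Sums and multiples of NC functions are again NC only because the ball
  is closed under direct sums: outside of it they have the value \<open>undefined\<close>.
\<close>

lemma dsum_in_nc_ball:
  assumes X: "X \<in> nc_ball_at Q n" and Y: "Y \<in> nc_ball_at Q m"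
  shows "(\<lambda>j. mat_dsum (X j) (Y j)) \<in> nc_ball_at Q (n + m)"
proof -
  let ?Z = "\<lambda>j. mat_dsum (X j) (Y j)"
  let ?r = "max (pencil_norm Q n X) (pencil_norm Q m Y)"
  note car = nc_ball_at_carrier[OF X] nc_ball_at_carrier[OF Y]
  have top: "pencil_apply Q (n + m) ?Z v a = pencil_apply Q n X v a" if "a < n" for v a
    unfolding pencil_apply_def sum_lessThan_add using that
    by (simp add: mat_dsum_entry[OF car] scaleC_zero_left)
  have bottom: "pencil_apply Q (n + m) ?Z v (n + a) = pencil_apply Q m Y (\<lambda>b. v (n + b)) a"
    if "a < m" for v a
    unfolding pencil_apply_def sum_lessThan_add using that
    by (simp add: mat_dsum_entry[OF car] scaleC_zero_left)
  have sq: "(L2_set f A)\<^sup>2 = (\<Sum>a\<in>A. (f a)\<^sup>2)" for f :: "nat \<Rightarrow> real" and A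
    by (simp add: L2_set_def sum_nonneg)
  have bound: "L2_set (\<lambda>a. norm (pencil_apply Q (n + m) ?Z v a)) {..<n + m} \<le> ?r"
    if v: "L2_set (\<lambda>b. norm (v b)) {..<n + m} \<le> 1" for v
  proof -
    have r0: "0 \<le> ?r" using pencil_norm_nonneg[of n X] by simp
    have part: "(L2_set (\<lambda>a. norm (pencil_apply Q l W u a)) {..<l})\<^sup>2
        \<le> ?r\<^sup>2 * (L2_set (\<lambda>b. norm (u b)) {..<l})\<^sup>2"
      if "pencil_norm Q l W \<le> ?r" for l W u
    proof -
      have "L2_set (\<lambda>a. norm (pencil_apply Q l W u a)) {..<l} \<le> ?r * L2_set (\<lambda>b. norm (u b)) {..<l}"
        using pencil_norm_bound[of l W u] mult_right_mono[OF that L2_set_nonneg, of "\<lambda>b. norm (u b)" "{..<l}"]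
        by linarith
      then have "(L2_set (\<lambda>a. norm (pencil_apply Q l W u a)) {..<l})\<^sup>2
          \<le> (?r * L2_set (\<lambda>b. norm (u b)) {..<l})\<^sup>2"
        by (rule power_mono) simp
      then show ?thesis by (simp only: power_mult_distrib)
    qed
    let ?v = "\<lambda>b. v (n + b)"
    have 1: "pencil_norm Q n X \<le> ?r" and 2: "pencil_norm Q m Y \<le> ?r" by simp_all
    have "(L2_set (\<lambda>a. norm (pencil_apply Q (n + m) ?Z v a)) {..<n + m})\<^sup>2
      = (L2_set (\<lambda>a. norm (pencil_apply Q n X v a)) {..<n})\<^sup>2
        + (L2_set (\<lambda>a. norm (pencil_apply Q m Y ?v a)) {..<m})\<^sup>2"
      by (simp add: sq sum_lessThan_add top bottom)
    also have "\<dots> \<le> ?r\<^sup>2 * ((L2_set (\<lambda>b. norm (v b)) {..<n})\<^sup>2 + (L2_set (\<lambda>b. norm (?v b)) {..<m})\<^sup>2)"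
      using part[OF 1, of v] part[OF 2, of ?v] by (simp only: distrib_left add_mono)
    also have "(L2_set (\<lambda>b. norm (v b)) {..<n})\<^sup>2 + (L2_set (\<lambda>b. norm (?v b)) {..<m})\<^sup>2
      = (L2_set (\<lambda>b. norm (v b)) {..<n + m})\<^sup>2"
      by (simp add: sq sum_lessThan_add)
    also have "?r\<^sup>2 * (L2_set (\<lambda>b. norm (v b)) {..<n + m})\<^sup>2 \<le> ?r\<^sup>2 * 1"
      using v by (intro mult_left_mono power_le_one) auto
    finally have "(L2_set (\<lambda>a. norm (pencil_apply Q (n + m) ?Z v a)) {..<n + m})\<^sup>2 \<le> ?r\<^sup>2"
      by (simp only: mult_1_right)
    then show ?thesis using r0 by (rule power2_le_imp_le)
  qed
  have "pencil_norm Q (n + m) ?Z \<le> ?r"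
    using bound by (rule pencil_norm_le)
  moreover have "?r < 1" using X Y by (simp add: nc_ball_at_def)
  ultimately have "pencil_norm Q (n + m) ?Z < 1" by (rule le_less_trans)
  then show ?thesis
    using X Y mat_dsum_carrier[OF car] by (simp add: nc_ball_at_def)
qed

section \<open>The space of bounded NC functions\<close>

lemma Hinf_carrier_iff:
  "F \<in> ns_carrier (Hinf Q) \<longleftrightarrow> nc_function Q F \<and> bdd_above ((\<lambda>X. mat_norm (F X)) ` nc_ball Q)"
  by (simp add: Hinf_def)

lemma Hinf_add_apply: "X \<in> nc_ball Q \<Longrightarrow> ns_add (Hinf Q) F G X = F X + G X"
  and Hinf_scale_apply: "X \<in> nc_ball Q \<Longrightarrow> ns_scale (Hinf Q) c F X = c \<cdot>\<^sub>m F X"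
  and Hinf_norm: "ns_norm (Hinf Q) F = (SUP X\<in>nc_ball Q. mat_norm (F X))"
  and Hinf_op_extensional: "ns_add (Hinf Q) F G \<in> extensional (nc_ball Q)"
    "ns_scale (Hinf Q) c F \<in> extensional (nc_ball Q)"
  by (simp_all add: Hinf_def)

lemma Hinf_mat: "\<lbrakk>F \<in> ns_carrier (Hinf Q); X \<in> nc_ball_at Q n\<rbrakk> \<Longrightarrow> F X \<in> carrier_mat n n"
  by (simp add: Hinf_carrier_iff nc_function_def)

lemma Hinf_dsum:
  "\<lbrakk>F \<in> ns_carrier (Hinf Q); X \<in> nc_ball Q; Y \<in> nc_ball Q\<rbrakk>
    \<Longrightarrow> F (\<lambda>j. mat_dsum (X j) (Y j)) = mat_dsum (F X) (F Y)"
  by (simp add: Hinf_carrier_iff nc_function_def)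

lemma Hinf_similar:
  "\<lbrakk>F \<in> ns_carrier (Hinf Q); X \<in> nc_ball_at Q n; S \<in> carrier_mat n n; T \<in> carrier_mat n n;
    S * T = 1\<^sub>m n; T * S = 1\<^sub>m n; (\<lambda>j. T * X j * S) \<in> nc_ball_at Q n\<rbrakk>
    \<Longrightarrow> F (\<lambda>j. T * X j * S) = T * F X * S"
  unfolding Hinf_carrier_iff nc_function_def by blast

lemma Hinf_norm_upper:
  "\<lbrakk>F \<in> ns_carrier (Hinf Q); X \<in> nc_ball_at Q n\<rbrakk> \<Longrightarrow> mat_norm (F X) \<le> ns_norm (Hinf Q) F"
  unfolding Hinf_norm by (rule cSUP_upper) (auto simp: Hinf_carrier_iff nc_ball_at_subset)

lemma Hinf_norm_le:
  assumes "\<And>n X. X \<in> nc_ball_at Q n \<Longrightarrow> mat_norm (F X) \<le> C"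
  shows "ns_norm (Hinf Q) F \<le> C"
  unfolding Hinf_norm
  by (rule cSUP_least) (use zero_in_nc_ball nc_ball_at_subset assms in \<open>auto elim!: nc_ball_cases\<close>)

lemma Hinf_carrierI:
  assumes "F \<in> extensional (nc_ball Q)"
    and "\<And>n X. X \<in> nc_ball_at Q n \<Longrightarrow> F X \<in> carrier_mat n n"
    and "\<And>n m X Y. \<lbrakk>X \<in> nc_ball_at Q n; Y \<in> nc_ball_at Q m\<rbrakk>
      \<Longrightarrow> F (\<lambda>j. mat_dsum (X j) (Y j)) = mat_dsum (F X) (F Y)"
    and "\<And>n X S T. \<lbrakk>X \<in> nc_ball_at Q n; S \<in> carrier_mat n n; T \<in> carrier_mat n n; S * T = 1\<^sub>m n;
      T * S = 1\<^sub>m n; (\<lambda>j. T * X j * S) \<in> nc_ball_at Q n\<rbrakk> \<Longrightarrow> F (\<lambda>j. T * X j * S) = T * F X * S"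
    and "\<And>n X. X \<in> nc_ball_at Q n \<Longrightarrow> mat_norm (F X) \<le> C"
  shows "F \<in> ns_carrier (Hinf Q)"
  unfolding Hinf_carrier_iff nc_function_def
proof (intro conjI allI ballI impI)
  show "F (\<lambda>j. mat_dsum (X j) (Y j)) = mat_dsum (F X) (F Y)" if "X \<in> nc_ball Q" "Y \<in> nc_ball Q" for X Y
    using that assms(3) by (auto elim!: nc_ball_cases)
  show "bdd_above ((\<lambda>X. mat_norm (F X)) ` nc_ball Q)"
    using assms(5) by (auto intro!: bdd_aboveI[of _ C] elim!: nc_ball_cases)
qed (use assms in auto)

lemma Hinf_eqI:
  assumes "F \<in> extensional (nc_ball Q)" "G \<in> extensional (nc_ball Q)"
    and "\<And>n X. X \<in> nc_ball_at Q n \<Longrightarrow> F X = G X"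
  shows "F = G"
  using assms by (auto intro!: extensionalityI[of _ "nc_ball Q"] elim!: nc_ball_cases)

lemma Hinf_extensional: "F \<in> ns_carrier (Hinf Q) \<Longrightarrow> F \<in> extensional (nc_ball Q)"
  by (simp add: Hinf_carrier_iff nc_function_def)

lemma Hinf_add_closed:
  assumes F: "F \<in> ns_carrier (Hinf Q)" and G: "G \<in> ns_carrier (Hinf Q)"
  shows "ns_add (Hinf Q) F G \<in> ns_carrier (Hinf Q)"
proof (rule Hinf_carrierI[where C="ns_norm (Hinf Q) F + ns_norm (Hinf Q) G"])
  show "ns_add (Hinf Q) F G \<in> extensional (nc_ball Q)" by (rule Hinf_op_extensional)
next
  fix n X assume X: "X \<in> nc_ball_at Q n"
  note FG = Hinf_mat[OF F X] Hinf_mat[OF G X]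
  show "ns_add (Hinf Q) F G X \<in> carrier_mat n n"
    using FG X by (simp add: Hinf_add_apply nc_ball_at_subset)
  show "mat_norm (ns_add (Hinf Q) F G X) \<le> ns_norm (Hinf Q) F + ns_norm (Hinf Q) G"
    using mat_norm_add_le[OF FG] Hinf_norm_upper[OF F X] Hinf_norm_upper[OF G X] X
    by (simp add: Hinf_add_apply nc_ball_at_subset)
next
  fix n m X Y assume X: "X \<in> nc_ball_at Q n" and Y: "Y \<in> nc_ball_at Q m"
  note XY = nc_ball_at_subset[OF X] nc_ball_at_subset[OF Y] nc_ball_at_subset[OF dsum_in_nc_ball[OF X Y]]
  have "mat_dsum (F X) (F Y) + mat_dsum (G X) (G Y) = mat_dsum (F X + G X) (F Y + G Y)"
    using Hinf_mat[OF F X] Hinf_mat[OF G X] Hinf_mat[OF F Y] Hinf_mat[OF G Y]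
    by (intro eq_matI) (auto simp: mat_dsum_def)
  then show "ns_add (Hinf Q) F G (\<lambda>j. mat_dsum (X j) (Y j))
    = mat_dsum (ns_add (Hinf Q) F G X) (ns_add (Hinf Q) F G Y)"
    using XY by (simp add: Hinf_add_apply Hinf_dsum[OF F] Hinf_dsum[OF G])
next
  fix n X S T assume X: "X \<in> nc_ball_at Q n" and ST: "S \<in> carrier_mat n n" "T \<in> carrier_mat n n"
    "S * T = 1\<^sub>m n" "T * S = 1\<^sub>m n" and TXS: "(\<lambda>j. T * X j * S) \<in> nc_ball_at Q n"
  note FG = Hinf_mat[OF F X] Hinf_mat[OF G X]
  have "T * (F X + G X) * S = T * F X * S + T * G X * S"
    using FG ST by (simp add: mult_add_distrib_mat[of _ n n _ n] add_mult_distrib_mat[of _ n n _ _ n])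
  then show "ns_add (Hinf Q) F G (\<lambda>j. T * X j * S) = T * ns_add (Hinf Q) F G X * S"
    using X TXS by (simp add: Hinf_add_apply nc_ball_at_subset Hinf_similar[OF F X ST TXS] Hinf_similar[OF G X ST TXS])
qed

lemma Hinf_scale_closed:
  assumes F: "F \<in> ns_carrier (Hinf Q)"
  shows "ns_scale (Hinf Q) c F \<in> ns_carrier (Hinf Q)"
proof (rule Hinf_carrierI[where C="cmod c * ns_norm (Hinf Q) F"])
  show "ns_scale (Hinf Q) c F \<in> extensional (nc_ball Q)" by (rule Hinf_op_extensional)
next
  fix n X assume X: "X \<in> nc_ball_at Q n"
  note FX = Hinf_mat[OF F X]
  show "ns_scale (Hinf Q) c F X \<in> carrier_mat n n"
    using FX X by (simp add: Hinf_scale_apply nc_ball_at_subset)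
  show "mat_norm (ns_scale (Hinf Q) c F X) \<le> cmod c * ns_norm (Hinf Q) F"
    using mat_norm_smult_le[OF FX, of c] mult_left_mono[OF Hinf_norm_upper[OF F X], of "cmod c"] X
    by (simp add: Hinf_scale_apply nc_ball_at_subset)
next
  fix n m X Y assume X: "X \<in> nc_ball_at Q n" and Y: "Y \<in> nc_ball_at Q m"
  note XY = nc_ball_at_subset[OF X] nc_ball_at_subset[OF Y] nc_ball_at_subset[OF dsum_in_nc_ball[OF X Y]]
  have "c \<cdot>\<^sub>m mat_dsum (F X) (F Y) = mat_dsum (c \<cdot>\<^sub>m F X) (c \<cdot>\<^sub>m F Y)"
    using Hinf_mat[OF F X] Hinf_mat[OF F Y] by (intro eq_matI) (auto simp: mat_dsum_def)
  then show "ns_scale (Hinf Q) c F (\<lambda>j. mat_dsum (X j) (Y j))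
    = mat_dsum (ns_scale (Hinf Q) c F X) (ns_scale (Hinf Q) c F Y)"
    using XY by (simp add: Hinf_scale_apply Hinf_dsum[OF F])
next
  fix n X S T assume X: "X \<in> nc_ball_at Q n" and ST: "S \<in> carrier_mat n n" "T \<in> carrier_mat n n"
    "S * T = 1\<^sub>m n" "T * S = 1\<^sub>m n" and TXS: "(\<lambda>j. T * X j * S) \<in> nc_ball_at Q n"
  have "T * (c \<cdot>\<^sub>m F X) * S = c \<cdot>\<^sub>m (T * F X * S)"
    using Hinf_mat[OF F X] ST
    by (simp add: mult_smult_distrib[of _ n n _ n] mult_smult_assoc_mat[of _ n n _ n])
  then show "ns_scale (Hinf Q) c F (\<lambda>j. T * X j * S) = T * ns_scale (Hinf Q) c F X * S"
    using X TXS by (simp add: Hinf_scale_apply nc_ball_at_subset Hinf_similar[OF F X ST TXS])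
qed

text \<open>
  The size of the value at \<open>X\<close> is read off an arbitrary component of \<open>X\<close>; there is one, as types are
  inhabited.
\<close>

lemma zero_function_in_Hinf: "(\<lambda>X\<in>nc_ball Q. 0\<^sub>m (dim_row (X undefined)) (dim_row (X undefined))) \<in> ns_carrier (Hinf Q)"
proof (rule Hinf_carrierI[where C=0])
  have dim: "dim_row (X undefined) = n" if "X \<in> nc_ball_at Q n" for n X
    using nc_ball_at_carrier[OF that, of undefined] by simp
  let ?Z = "\<lambda>X\<in>nc_ball Q. 0\<^sub>m (dim_row (X undefined)) (dim_row (X undefined)) :: complex mat"
  have Z: "?Z X = 0\<^sub>m n n" if "X \<in> nc_ball_at Q n" for n X
    using that by (simp add: nc_ball_at_subset dim)
  show "?Z X \<in> carrier_mat n n" if "X \<in> nc_ball_at Q n" for n X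
    unfolding Z[OF that] by simp
  show "mat_norm (?Z X) \<le> 0" if "X \<in> nc_ball_at Q n" for n X
    unfolding Z[OF that] by (rule order_trans[OF mat_norm_le_sum_entries]) auto
  show "?Z (\<lambda>j. mat_dsum (X j) (Y j)) = mat_dsum (?Z X) (?Z Y)"
    if "X \<in> nc_ball_at Q n" "Y \<in> nc_ball_at Q m" for n m X Y
    unfolding Z[OF that(1)] Z[OF that(2)] Z[OF dsum_in_nc_ball[OF that]]
    by (intro eq_matI) (auto simp: mat_dsum_def)
  show "?Z (\<lambda>j. T * X j * S) = T * ?Z X * S"
    if "X \<in> nc_ball_at Q n" "S \<in> carrier_mat n n" "T \<in> carrier_mat n n"
      "(\<lambda>j. T * X j * S) \<in> nc_ball_at Q n" for n X S T
    unfolding Z[OF that(1)] Z[OF that(4)] using that by simp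
qed simp

lemma complex_nspace_Hinf: "complex_nspace (Hinf Q)"
proof -
  let ?H = "Hinf Q"
  note app = Hinf_add_apply Hinf_scale_apply
  note closed = Hinf_add_closed Hinf_scale_closed
  have eqI: "F = G" if "F \<in> ns_carrier ?H" "G \<in> ns_carrier ?H"
    "\<And>n X. X \<in> nc_ball_at Q n \<Longrightarrow> X \<in> nc_ball Q \<Longrightarrow> F X = G X" for F G
    using that by (intro Hinf_eqI Hinf_extensional) (auto intro: nc_ball_at_subset)
  interpret homogeneous_nspace ?H
  proof (rule homogeneous_nspaceI)
    show "ns_carrier ?H \<noteq> {}" using zero_function_in_Hinf by blast
    show "0 \<le> ns_norm ?H F" if F: "F \<in> ns_carrier ?H" for F
      using mat_norm_nonneg[OF Hinf_mat[OF F zero_in_nc_ball]] Hinf_norm_upper[OF F zero_in_nc_ball] by simp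
    show "ns_norm ?H (ns_scale ?H c F) \<le> cmod c * ns_norm ?H F" if F: "F \<in> ns_carrier ?H" for c F
    proof (rule Hinf_norm_le)
      fix n X assume X: "X \<in> nc_ball_at Q n"
      show "mat_norm (ns_scale ?H c F X) \<le> cmod c * ns_norm ?H F"
        using mat_norm_smult_le[OF Hinf_mat[OF F X], of c] mult_left_mono[OF Hinf_norm_upper[OF F X], of "cmod c"] X
        by (simp add: app nc_ball_at_subset)
    qed
    show "ns_scale ?H (inverse c) (ns_scale ?H c F) = F" if F: "F \<in> ns_carrier ?H" and c: "c \<noteq> 0" for c F
    proof (rule eqI)
      fix n X assume X: "X \<in> nc_ball_at Q n" "X \<in> nc_ball Q"
      then show "ns_scale ?H (inverse c) (ns_scale ?H c F) X = F X"
        using Hinf_mat[OF F X(1)] c by (intro eq_matI) (auto simp: app)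
    qed (use F closed in auto)
  qed (auto intro: closed)
  show ?thesis
  proof
    fix x y z b c assume x: "x \<in> ns_carrier ?H" and y: "y \<in> ns_carrier ?H" and z: "z \<in> ns_carrier ?H"
    note car = Hinf_mat[OF x] Hinf_mat[OF y] Hinf_mat[OF z]
    show "ns_add ?H (ns_add ?H x y) z = ns_add ?H x (ns_add ?H y z)"
    proof (rule eqI)
      fix n X assume X: "X \<in> nc_ball_at Q n" "X \<in> nc_ball Q"
      show "ns_add ?H (ns_add ?H x y) z X = ns_add ?H x (ns_add ?H y z) X"
        using X(2) car(1-3)[OF X(1)] by (intro eq_matI) (auto simp: app algebra_simps)
    qed (use x y z closed in auto)
    show "ns_add ?H x y = ns_add ?H y x"
    proof (rule eqI)
      fix n X assume X: "X \<in> nc_ball_at Q n" "X \<in> nc_ball Q"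
      show "ns_add ?H x y X = ns_add ?H y x X"
        using X(2) car(1-3)[OF X(1)] by (intro eq_matI) (auto simp: app algebra_simps)
    qed (use x y z closed in auto)
    show "ns_add ?H x (ns_scale ?H 0 y) = x"
    proof (rule eqI)
      fix n X assume X: "X \<in> nc_ball_at Q n" "X \<in> nc_ball Q"
      show "ns_add ?H x (ns_scale ?H 0 y) X = x X"
        using X(2) car(1,2)[OF X(1)] by (intro eq_matI) (auto simp: app)
    qed (use x y closed in auto)
    show "ns_scale ?H c (ns_add ?H x y) = ns_add ?H (ns_scale ?H c x) (ns_scale ?H c y)"
    proof (rule eqI)
      fix n X assume X: "X \<in> nc_ball_at Q n" "X \<in> nc_ball Q"
      show "ns_scale ?H c (ns_add ?H x y) X = ns_add ?H (ns_scale ?H c x) (ns_scale ?H c y) X"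
        using X(2) car(1-3)[OF X(1)] by (intro eq_matI) (auto simp: app algebra_simps)
    qed (use x y z closed in auto)
    show "ns_scale ?H (b + c) x = ns_add ?H (ns_scale ?H b x) (ns_scale ?H c x)"
    proof (rule eqI)
      fix n X assume X: "X \<in> nc_ball_at Q n" "X \<in> nc_ball Q"
      show "ns_scale ?H (b + c) x X = ns_add ?H (ns_scale ?H b x) (ns_scale ?H c x) X"
        using X(2) car(1-3)[OF X(1)] by (intro eq_matI) (auto simp: app algebra_simps)
    qed (use x y z closed in auto)
    show "ns_scale ?H b (ns_scale ?H c x) = ns_scale ?H (b * c) x"
      by (rule eqI) (use x closed in \<open>auto simp: app mult.assoc intro!: eq_matI\<close>)
    show "ns_scale ?H 1 x = x"
      by (rule eqI) (use x closed in \<open>auto simp: app intro!: eq_matI\<close>)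
    show "ns_norm ?H (ns_add ?H x y) \<le> ns_norm ?H x + ns_norm ?H y"
    proof (rule Hinf_norm_le)
      fix n X assume X: "X \<in> nc_ball_at Q n"
      show "mat_norm (ns_add ?H x y X) \<le> ns_norm ?H x + ns_norm ?H y"
        using mat_norm_add_le[OF car(1)[OF X] car(2)[OF X]] Hinf_norm_upper[OF x X] Hinf_norm_upper[OF y X] X
        by (simp add: app nc_ball_at_subset)
    qed
    show "x = ns_scale ?H 0 x" if "ns_norm ?H x = 0"
    proof (rule eqI)
      fix n X assume X: "X \<in> nc_ball_at Q n" "X \<in> nc_ball Q"
      have "mat_norm (x X) \<le> 0" using Hinf_norm_upper[OF x X(1)] that by simp
      then have "(x X) $$ (a, b) = 0" if "a < n" "b < n" for a b
        using cmod_entry_le_mat_norm[OF car(1)[OF X(1)] that] by (metis norm_le_zero_iff order_trans)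
      then show "x X = ns_scale ?H 0 x X"
        using car(1)[OF X(1)] X(2) by (intro eq_matI) (auto simp: app)
    qed (use x closed in auto)
  qed
qed

end

section \<open>Criteria for preduals\<close>

context homogeneous_nspace
begin

lemma dual_restrict_bound:
  assumes \<X>: "ns_subspace (ns_dual V) \<X>" and \<Lambda>: "\<Lambda> \<in> ns_carrier (ns_dual (ns_restrict (ns_dual V) \<X>))"
    and "\<phi> \<in> \<X>"
  shows "cmod (\<Lambda> \<phi>) \<le> ns_norm (ns_dual (ns_restrict (ns_dual V) \<X>)) \<Lambda> * ns_norm (ns_dual V) \<phi>"
proof -
  interpret R: complex_nspace "ns_restrict (ns_dual V) \<X>"
    by (rule complex_nspace_restrict[OF complex_nspace_dual \<X>])
  show ?thesis using R.dual_bound[OF \<Lambda>, of \<phi>] assms(3) by simp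
qed

text \<open>
  A functional and an evaluation that agree on \<open>S\<close> agree on the closed span of \<open>S\<close>, both being
  continuous.
\<close>

lemma dual_representation_closure:
  assumes S: "S \<subseteq> dual_carr"
    and \<X>_def: "\<X> = norm_topology (ns_dual V) closure_of ns_span (ns_dual V) S"
    and \<Lambda>: "\<Lambda> \<in> ns_carrier (ns_dual (ns_restrict (ns_dual V) \<X>))"
    and y: "y \<in> carr" and eq: "\<And>\<phi>. \<phi> \<in> S \<Longrightarrow> \<Lambda> \<phi> = \<phi> y"
    and \<phi>: "\<phi> \<in> \<X>"
  shows "\<Lambda> \<phi> = \<phi> y"
proof -
  interpret D: complex_nspace "ns_dual V" by (rule complex_nspace_dual)
  have span: "ns_subspace (ns_dual V) (ns_span (ns_dual V) S)" by (rule D.span_subspace[OF S])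
  have \<X>: "ns_subspace (ns_dual V) \<X>" unfolding \<X>_def by (rule D.closure_subspace[OF span])
  have \<X>D: "\<X> \<subseteq> dual_carr" using \<X> by (simp add: ns_subspace_def)
  have closed: "closedin (norm_topology (ns_dual V)) \<X>" unfolding \<X>_def by (rule closedin_closure_of)
  have "S \<subseteq> ns_span (ns_dual V) S" by (rule D.span_subspace[OF S])
  moreover have "ns_span (ns_dual V) S \<subseteq> \<X>"
    unfolding \<X>_def by (rule closure_of_subset) (use span in \<open>auto simp: ns_subspace_def norm_topology_def\<close>)
  ultimately have S\<X>: "S \<subseteq> \<X>" by simp
  let ?W = "{\<phi> \<in> \<X>. \<Lambda> \<phi> = \<phi> y}"
  let ?C = "ns_norm (ns_dual (ns_restrict (ns_dual V) \<X>)) \<Lambda> + ns_norm V y"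
  have lin: "\<Lambda> (ns_add (ns_dual V) \<phi> \<psi>) = \<Lambda> \<phi> + \<Lambda> \<psi>" "\<Lambda> (ns_scale (ns_dual V) c \<phi>) = c * \<Lambda> \<phi>"
    if "\<phi> \<in> \<X>" "\<psi> \<in> \<X>" for \<phi> \<psi> c
    using \<Lambda> that by (auto simp: dual_restrict_carrier)
  have "ns_subspace (ns_dual V) ?W"
    unfolding ns_subspace_def
  proof (intro conjI ballI allI)
    show "?W \<subseteq> dual_carr" using \<X>D by blast
    obtain \<psi> where \<psi>: "\<psi> \<in> \<X>" using \<phi> by blast
    then have "ns_scale (ns_dual V) 0 \<psi> \<in> \<X>" using \<X> by (simp add: ns_subspace_def)
    then have "ns_scale (ns_dual V) 0 \<psi> \<in> ?W"
      using y lin(2)[OF \<psi> \<psi>, of 0] by (simp add: dual_scale)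
    then show "?W \<noteq> {}" by blast
    show "ns_add (ns_dual V) a b \<in> ?W" if "a \<in> ?W" "b \<in> ?W" for a b
      using that \<X> y lin(1)[of a b] by (simp add: ns_subspace_def dual_add)
    show "ns_scale (ns_dual V) c a \<in> ?W" if "a \<in> ?W" for a c
      using that \<X> y lin(2)[of a a c] by (simp add: ns_subspace_def dual_scale)
  qed
  moreover have "closedin (norm_topology (ns_dual V)) ?W"
    unfolding D.closedin_norm_topology
  proof (intro conjI ballI impI)
    show "?W \<subseteq> dual_carr" using \<X>D by blast
    fix \<phi> assume \<phi>: "\<phi> \<in> dual_carr"
      and lim: "\<forall>e>0. \<exists>\<psi>\<in>?W. ns_norm (ns_dual V) (D.subv \<phi> \<psi>) < e"
    then have \<phi>X: "\<phi> \<in> \<X>" using closed unfolding D.closedin_norm_topology by blast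
    have C0: "0 \<le> ?C"
    proof -
      interpret R: complex_nspace "ns_restrict (ns_dual V) \<X>"
        by (rule complex_nspace_restrict[OF complex_nspace_dual \<X>])
      show ?thesis using R.dual_norm_nonneg[OF \<Lambda>] norm_nonneg[OF y] by simp
    qed
    have small: "cmod (\<Lambda> \<phi> - \<phi> y) \<le> ?C * e" if e: "e > 0" for e
    proof -
      obtain \<psi> where \<psi>: "\<psi> \<in> \<X>" "\<Lambda> \<psi> = \<psi> y" "ns_norm (ns_dual V) (D.subv \<phi> \<psi>) < e"
        using lim[rule_format, OF e] by blast
      let ?d = "D.subv \<phi> \<psi>"
      have m\<psi>: "ns_scale (ns_dual V) (- 1) \<psi> \<in> \<X>" using \<psi>(1) \<X> by (simp add: ns_subspace_def)
      then have dX: "?d \<in> \<X>" using \<phi>X \<X> by (simp add: ns_subspace_def)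
      have "\<Lambda> ?d = \<Lambda> \<phi> - \<Lambda> \<psi>" using lin(1)[OF \<phi>X m\<psi>] lin(2)[OF \<psi>(1) \<psi>(1), of "- 1"] by simp
      moreover have "?d y = \<phi> y - \<psi> y" using y by (simp add: dual_add dual_scale)
      ultimately have "\<Lambda> \<phi> - \<phi> y = \<Lambda> ?d - ?d y" using \<psi>(2) by simp
      then have "cmod (\<Lambda> \<phi> - \<phi> y) \<le> cmod (\<Lambda> ?d) + cmod (?d y)" by (simp only: norm_triangle_ineq4)
      also have "\<dots> \<le> ?C * ns_norm (ns_dual V) ?d"
        using dual_restrict_bound[OF \<X> \<Lambda> dX] dual_bound[OF subsetD[OF \<X>D dX] y]
        by (simp add: algebra_simps)
      also have "\<dots> \<le> ?C * e" using \<psi>(3) C0 by (intro mult_left_mono) auto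
      finally show ?thesis .
    qed
    have "cmod (\<Lambda> \<phi> - \<phi> y) \<le> 0"
    proof (rule field_le_epsilon)
      fix e :: real assume "e > 0"
      moreover have "?C * (e / (?C + 1)) \<le> e" using C0 \<open>e > 0\<close> by (simp add: field_simps)
      ultimately show "cmod (\<Lambda> \<phi> - \<phi> y) \<le> 0 + e"
        using small[of "e / (?C + 1)"] C0 by simp
    qed
    then show "\<phi> \<in> ?W" using \<phi>X by simp
  qed
  moreover have "S \<subseteq> ?W" using S\<X> eq by blast
  ultimately have "\<X> \<subseteq> ?W" unfolding \<X>_def by (intro D.closure_span_subset) auto
  with \<phi> show ?thesis by blast
qed

text \<open>
  The embedding into the dual of \<open>\<X>\<close> is injective when \<open>\<X>\<close> separates points, isometric when the unit
  ball of \<open>\<X>\<close> is norming, and surjective when functionals on \<open>\<X>\<close> are evaluations.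
\<close>

theorem is_predualI:
  assumes \<X>: "ns_subspace (ns_dual V) \<X>" and closed: "closedin (norm_topology (ns_dual V)) \<X>"
    and separating: "\<And>x y. \<lbrakk>x \<in> carr; y \<in> carr; \<And>\<phi>. \<phi> \<in> \<X> \<Longrightarrow> \<phi> x = \<phi> y\<rbrakk> \<Longrightarrow> x = y"
    and norming: "\<And>y C. \<lbrakk>y \<in> carr;
      \<And>\<phi>. \<lbrakk>\<phi> \<in> \<X>; ns_norm (ns_dual V) \<phi> \<le> 1\<rbrakk> \<Longrightarrow> cmod (\<phi> y) \<le> C\<rbrakk> \<Longrightarrow> ns_norm V y \<le> C"
    and representing: "\<And>\<Lambda>. \<Lambda> \<in> ns_carrier (ns_dual (ns_restrict (ns_dual V) \<X>))
      \<Longrightarrow> \<exists>y\<in>carr. \<forall>\<phi>\<in>\<X>. \<Lambda> \<phi> = \<phi> y"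
  shows "is_predual V \<X>"
proof -
  let ?X' = "ns_dual (ns_restrict (ns_dual V) \<X>)"
  let ?\<iota> = "\<lambda>y. \<lambda>\<phi>\<in>\<X>. \<phi> y"
  interpret R: complex_nspace "ns_restrict (ns_dual V) \<X>"
    by (rule complex_nspace_restrict[OF complex_nspace_dual \<X>])
  have \<X>D: "\<phi> \<in> dual_carr" if "\<phi> \<in> \<X>" for \<phi>
    using \<X> that by (auto simp: ns_subspace_def)
  have \<iota>: "?\<iota> y \<in> ns_carrier ?X'" if y: "y \<in> carr" for y
  proof -
    have "(\<lambda>\<phi>\<in>ns_carrier (ns_restrict (ns_dual V) \<X>). \<phi> y) \<in> ns_carrier ?X'"
    proof (rule R.dualI[where B="ns_norm V y"])
      fix \<phi> assume "\<phi> \<in> ns_carrier (ns_restrict (ns_dual V) \<X>)"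
      then show "cmod (\<phi> y) \<le> ns_norm V y * ns_norm (ns_restrict (ns_dual V) \<X>) \<phi>"
        using dual_bound[OF \<X>D y] by (simp add: mult.commute)
    qed (use y in \<open>auto simp: dual_add dual_scale\<close>)
    then show ?thesis by simp
  qed
  have "inj_on ?\<iota> (carr)"
  proof (rule inj_onI)
    fix x y assume xy: "x \<in> carr" "y \<in> carr" "?\<iota> x = ?\<iota> y"
    show "x = y"
    proof (rule separating[OF xy(1,2)])
      fix \<phi> assume "\<phi> \<in> \<X>"
      then show "\<phi> x = \<phi> y" using fun_cong[OF xy(3), of \<phi>] by simp
    qed
  qed
  moreover have "?\<iota> ` carr = ns_carrier ?X'"
  proof
    show "?\<iota> ` carr \<subseteq> ns_carrier ?X'" using \<iota> by blast
    show "ns_carrier ?X' \<subseteq> ?\<iota> ` carr"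
    proof
      fix \<Lambda> assume \<Lambda>: "\<Lambda> \<in> ns_carrier ?X'"
      then obtain y where y: "y \<in> carr" "\<forall>\<phi>\<in>\<X>. \<Lambda> \<phi> = \<phi> y" using representing by blast
      have "\<Lambda> = ?\<iota> y"
        using \<Lambda> y(2) by (intro R.dual_eqI[OF \<Lambda> \<iota>[OF y(1)]]) simp
      with y(1) show "\<Lambda> \<in> ?\<iota> ` carr" by blast
    qed
  qed
  moreover have "ns_norm ?X' (?\<iota> y) = ns_norm V y" if y: "y \<in> carr" for y
  proof (rule antisym)
    show "ns_norm ?X' (?\<iota> y) \<le> ns_norm V y"
    proof (rule R.dual_norm_le)
      fix \<phi> assume \<phi>: "\<phi> \<in> ns_carrier (ns_restrict (ns_dual V) \<X>)" "ns_norm (ns_restrict (ns_dual V) \<X>) \<phi> \<le> 1"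
      then have "ns_norm (ns_dual V) \<phi> * ns_norm V y \<le> ns_norm V y"
        using norm_nonneg[OF y] dual_norm_nonneg[OF \<X>D] by (intro mult_left_le_one_le) auto
      then show "cmod (?\<iota> y \<phi>) \<le> ns_norm V y"
        using dual_bound[OF \<X>D y, of \<phi>] \<phi> by simp
    qed
    show "ns_norm V y \<le> ns_norm ?X' (?\<iota> y)"
    proof (rule norming[OF y])
      fix \<phi> assume "\<phi> \<in> \<X>" "ns_norm (ns_dual V) \<phi> \<le> 1"
      then show "cmod (\<phi> y) \<le> ns_norm ?X' (?\<iota> y)"
        using R.dual_norm_upper[OF \<iota>[OF y], of \<phi>] by simp
    qed
  qed
  ultimately show ?thesis
    unfolding is_predual_def Let_def bij_betw_def using \<X> closed by blast
qed

end

context nc_operator_ball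
begin

section \<open>Bounded NC functions as a dual space\<close>

sublocale H: complex_nspace "Hinf Q"
  by (rule complex_nspace_Hinf)

lemma contraction_evaluation:
  "X \<in> nc_ball_at Q n \<Longrightarrow> contraction (Hinf Q) (mat_space n) (\<lambda>F. F X)"
  unfolding contraction_def
  by (auto simp: Hinf_mat Hinf_norm_upper Hinf_add_apply Hinf_scale_apply nc_ball_at_subset)

lemma point_functionals_eq:
  "point_functionals Q = {pullback (Hinf Q) (\<lambda>F. F X) \<eta> | n X \<eta>.
    X \<in> nc_ball_at Q n \<and> \<eta> \<in> ns_carrier (ns_dual (mat_space n))}"
  unfolding point_functionals_def pullback_def ..

lemma point_functionals_in_dual: "point_functionals Q \<subseteq> H.dual_carr"
proof
  fix \<phi> assume "\<phi> \<in> point_functionals Q"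
  then obtain n X \<eta> where X: "X \<in> nc_ball_at Q n" and \<eta>: "\<eta> \<in> ns_carrier (ns_dual (mat_space n))"
    and \<phi>: "\<phi> = pullback (Hinf Q) (\<lambda>F. F X) \<eta>" unfolding point_functionals_eq by blast
  interpret nspace_contraction "Hinf Q" "mat_space n" "\<lambda>F. F X"
    unfolding nspace_contraction_def nspace_contraction_axioms_def
    using homogeneous_mat_space contraction_evaluation[OF X] H.homogeneous_nspace_axioms by blast
  show "\<phi> \<in> H.dual_carr" unfolding \<phi> by (rule pullback_in_dual[OF \<eta>])
qed

lemma predual_X_subspace: "ns_subspace (ns_dual (Hinf Q)) (predual_X Q)"
  and predual_X_closed: "closedin (norm_topology (ns_dual (Hinf Q))) (predual_X Q)"
  and point_functionals_subset: "point_functionals Q \<subseteq> predual_X Q"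
proof -
  interpret D: complex_nspace "ns_dual (Hinf Q)" by (rule H.complex_nspace_dual)
  note span = D.span_subspace[OF point_functionals_in_dual]
  show "ns_subspace (ns_dual (Hinf Q)) (predual_X Q)"
    unfolding predual_X_def by (rule D.closure_subspace[OF span(1)])
  show "closedin (norm_topology (ns_dual (Hinf Q))) (predual_X Q)"
    unfolding predual_X_def by (rule closedin_closure_of)
  have "ns_span (ns_dual (Hinf Q)) (point_functionals Q) \<subseteq> predual_X Q"
    unfolding predual_X_def
    by (rule closure_of_subset) (use span(1) in \<open>auto simp: ns_subspace_def norm_topology_def\<close>)
  with span(2) show "point_functionals Q \<subseteq> predual_X Q" by simp
qed

lemma predual_X_in_dual: "\<phi> \<in> predual_X Q \<Longrightarrow> \<phi> \<in> H.dual_carr"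
  using predual_X_subspace by (auto simp: ns_subspace_def)

definition entry_functional :: "('d \<Rightarrow> complex mat) \<Rightarrow> nat \<times> nat \<Rightarrow> (('d \<Rightarrow> complex mat) \<Rightarrow> complex mat) \<Rightarrow> complex" where
  "entry_functional X p = (\<lambda>F\<in>H.carr. F X $$ p)"

lemma entry_functional_in_predual_X:
  assumes X: "X \<in> nc_ball_at Q n" and p: "p \<in> {..<n} \<times> {..<n}"
  shows "entry_functional X p \<in> predual_X Q"
proof -
  interpret M: homogeneous_nspace "mat_space n" by (rule homogeneous_mat_space)
  let ?\<eta> = "\<lambda>A\<in>ns_carrier (mat_space n). A $$ p"
  have "?\<eta> \<in> ns_carrier (ns_dual (mat_space n))"
    by (rule M.dualI[where B=1]) (use p in \<open>auto intro: cmod_entry_le_mat_norm\<close>)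
  then have "pullback (Hinf Q) (\<lambda>F. F X) ?\<eta> \<in> point_functionals Q"
    unfolding point_functionals_eq using X by blast
  moreover have "pullback (Hinf Q) (\<lambda>F. F X) ?\<eta> = entry_functional X p"
    unfolding pullback_def entry_functional_def using Hinf_mat[OF _ X] by (intro restrict_ext) simp
  ultimately show ?thesis using point_functionals_subset by auto
qed

text \<open>
  The NC function whose entries are the values of \<open>\<Lambda>\<close> at the entry functionals, the only candidate
  for a function that represents \<open>\<Lambda>\<close>.
\<close>

definition function_of_functional ::
    "(((('d \<Rightarrow> complex mat) \<Rightarrow> complex mat) \<Rightarrow> complex) \<Rightarrow> complex) \<Rightarrow> ('d \<Rightarrow> complex mat) \<Rightarrow> complex mat" where
  "function_of_functional \<Lambda> = (\<lambda>X\<in>nc_ball Q.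
     Matrix.mat (dim_row (X undefined)) (dim_row (X undefined)) (\<lambda>p. \<Lambda> (entry_functional X p)))"

lemma function_of_functional_apply:
  "X \<in> nc_ball_at Q n \<Longrightarrow>
    function_of_functional \<Lambda> X = Matrix.mat n n (\<lambda>p. \<Lambda> (entry_functional X p))"
  using nc_ball_at_carrier[of X n undefined] nc_ball_at_subset[of X n]
  by (simp add: function_of_functional_def)

text \<open>
  The coefficients do not depend on \<open>A\<close>, so the identity lifts to the entry functionals.
\<close>

lemma similarity_entry:
  fixes A :: "complex mat"
  assumes "A \<in> carrier_mat n n" "S \<in> carrier_mat n n" "T \<in> carrier_mat n n" "a < n" "b < n"
  shows "(T * A * S) $$ (a, b) = (\<Sum>p\<in>{..<n}\<times>{..<n}. (T $$ (a, fst p) * S $$ (snd p, b)) * A $$ p)"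
proof -
  have "(T * A * S) $$ (a, b) = (\<Sum>d<n. (\<Sum>c<n. T $$ (a, c) * A $$ (c, d)) * S $$ (d, b))"
    using assms by (simp add: scalar_prod_def atLeast0LessThan del: assoc_mult_mat)
  also have "\<dots> = (\<Sum>d<n. \<Sum>c<n. (T $$ (a, c) * S $$ (d, b)) * A $$ (c, d))"
    by (simp add: sum_distrib_right sum_distrib_left mult_ac)
  also have "\<dots> = (\<Sum>c<n. \<Sum>d<n. (T $$ (a, c) * S $$ (d, b)) * A $$ (c, d))"
    by (rule sum.swap)
  finally show ?thesis by (simp add: sum.cartesian_product case_prod_unfold)
qed

text \<open>
  Each NC axiom for \<open>\<Lambda> (entry_functional X p)\<close> is the image under \<open>\<Lambda>\<close> of a linear relation between entry
  functionals that holds because all elements of \<open>Hinf Q\<close> are NC.  The bound comes from the combination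
  of entry functionals with the coefficients \<open>w\<^sub>a u\<^sub>b\<close>, whose norm is at most 1.
\<close>

lemma function_of_functional_in_Hinf:
  assumes \<Lambda>: "\<Lambda> \<in> ns_carrier (ns_dual (ns_restrict (ns_dual (Hinf Q)) (predual_X Q)))"
  shows "function_of_functional \<Lambda> \<in> H.carr"
proof -
  let ?F = "function_of_functional \<Lambda>"
  let ?N = "ns_norm (ns_dual (ns_restrict (ns_dual (Hinf Q)) (predual_X Q))) \<Lambda>"
  note comb = H.dual_sum[OF predual_X_subspace \<Lambda>]
  interpret R: complex_nspace "ns_restrict (ns_dual (Hinf Q)) (predual_X Q)"
    by (rule complex_nspace_restrict[OF H.complex_nspace_dual predual_X_subspace])
  show ?thesis
  proof (rule Hinf_carrierI[where C="?N"])
    show "?F \<in> extensional (nc_ball Q)" by (simp add: function_of_functional_def)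
    show "?F X \<in> carrier_mat n n" if "X \<in> nc_ball_at Q n" for n X
      by (simp add: function_of_functional_apply[OF that])
  next
    fix n m X Y assume X: "X \<in> nc_ball_at Q n" and Y: "Y \<in> nc_ball_at Q m"
    let ?Z = "\<lambda>j. mat_dsum (X j) (Y j)"
    have Z: "?Z \<in> nc_ball_at Q (n + m)" by (rule dsum_in_nc_ball[OF X Y])
    have zero: "\<Lambda> (\<lambda>F\<in>H.carr. 0) = 0"
      using comb[of "{}"] by simp
    have F: "?F X \<in> carrier_mat n n" "?F Y \<in> carrier_mat m m"
      by (simp_all add: function_of_functional_apply[OF X] function_of_functional_apply[OF Y])
    show "?F ?Z = mat_dsum (?F X) (?F Y)"
    proof (rule eq_matI)
      fix a b assume "a < dim_row (mat_dsum (?F X) (?F Y))" "b < dim_col (mat_dsum (?F X) (?F Y))"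
      then have ab: "a < n + m" "b < n + m" using mat_dsum_carrier[OF F] by auto
      have ent: "entry_functional ?Z (a, b) = (\<lambda>G\<in>H.carr.
        if a < n \<and> b < n then G X $$ (a, b) else if n \<le> a \<and> n \<le> b then G Y $$ (a - n, b - n) else 0)"
        unfolding entry_functional_def
        by (intro restrict_ext)
          (simp only: Hinf_dsum[OF _ nc_ball_at_subset[OF X] nc_ball_at_subset[OF Y]]
            mat_dsum_entry[OF Hinf_mat[OF _ X] Hinf_mat[OF _ Y] ab])
      have "?F ?Z $$ (a, b) = \<Lambda> (entry_functional ?Z (a, b))"
        using ab by (simp add: function_of_functional_apply[OF Z])
      also have "\<dots> = mat_dsum (?F X) (?F Y) $$ (a, b)"
        unfolding mat_dsum_entry[OF F ab] ent using ab zero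
        by (auto simp: function_of_functional_apply[OF X] function_of_functional_apply[OF Y]
            entry_functional_def)
      finally show "?F ?Z $$ (a, b) = mat_dsum (?F X) (?F Y) $$ (a, b)" .
    qed (use mat_dsum_carrier[OF F] in \<open>auto simp: function_of_functional_apply[OF Z]\<close>)
  next
    fix n X S T assume X: "X \<in> nc_ball_at Q n" and ST: "S \<in> carrier_mat n n" "T \<in> carrier_mat n n"
      "S * T = 1\<^sub>m n" "T * S = 1\<^sub>m n" and TXS: "(\<lambda>j. T * X j * S) \<in> nc_ball_at Q n"
    have F: "?F X \<in> carrier_mat n n" by (simp add: function_of_functional_apply[OF X])
    show "?F (\<lambda>j. T * X j * S) = T * ?F X * S"
    proof (rule eq_matI)
      fix a b assume "a < dim_row (T * ?F X * S)" "b < dim_col (T * ?F X * S)"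
      then have ab: "a < n" "b < n" using ST by auto
      let ?c = "\<lambda>p. T $$ (a, fst p) * S $$ (snd p, b)"
      have "entry_functional (\<lambda>j. T * X j * S) (a, b)
        = (\<lambda>G\<in>H.carr. \<Sum>p\<in>{..<n}\<times>{..<n}. ?c p * entry_functional X p G)"
        unfolding entry_functional_def
        by (intro restrict_ext)
          (simp add: Hinf_similar[OF _ X ST TXS] similarity_entry[OF Hinf_mat[OF _ X] ST(1,2) ab])
      then have "\<Lambda> (entry_functional (\<lambda>j. T * X j * S) (a, b))
        = (\<Sum>p\<in>{..<n}\<times>{..<n}. ?c p * \<Lambda> (entry_functional X p))"
        using comb[of "{..<n}\<times>{..<n}" "entry_functional X" ?c] entry_functional_in_predual_X[OF X] by simp
      also have "\<dots> = (T * ?F X * S) $$ (a, b)"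
        unfolding similarity_entry[OF F ST(1,2) ab]
        by (intro sum.cong refl) (auto simp: function_of_functional_apply[OF X])
      finally show "?F (\<lambda>j. T * X j * S) $$ (a, b) = (T * ?F X * S) $$ (a, b)"
        using ab by (simp add: function_of_functional_apply[OF TXS])
    qed (use ST in \<open>auto simp: function_of_functional_apply[OF TXS]\<close>)
  next
    fix n X assume X: "X \<in> nc_ball_at Q n"
    have F: "?F X \<in> carrier_mat n n" by (simp add: function_of_functional_apply[OF X])
    show "mat_norm (?F X) \<le> ?N"
    proof (rule mat_norm_le[OF F])
      fix w u assume wu: "vnorm n w \<le> 1" "vnorm n u \<le> 1"
      let ?c = "\<lambda>p. w (fst p) * u (snd p)"
      let ?\<phi> = "\<lambda>G\<in>H.carr. \<Sum>p\<in>{..<n}\<times>{..<n}. ?c p * entry_functional X p G"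
      have bil: "bil n A w u = (\<Sum>p\<in>{..<n}\<times>{..<n}. ?c p * A $$ p)" for A
        by (simp add: bil_def sum.cartesian_product case_prod_unfold mult_ac)
      have \<phi>: "?\<phi> \<in> predual_X Q" "\<Lambda> ?\<phi> = (\<Sum>p\<in>{..<n}\<times>{..<n}. ?c p * \<Lambda> (entry_functional X p))"
        using comb[of "{..<n}\<times>{..<n}" "entry_functional X" ?c] entry_functional_in_predual_X[OF X] by auto
      have "ns_norm (ns_dual (Hinf Q)) ?\<phi> \<le> 1"
      proof (rule H.dual_norm_le)
        fix G assume G: "G \<in> H.carr" "ns_norm (Hinf Q) G \<le> 1"
        have "?\<phi> G = bil n (G X) w u" using G(1) by (simp add: bil entry_functional_def)
        then show "cmod (?\<phi> G) \<le> 1"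
          using cmod_bil_le[OF Hinf_mat[OF G(1) X] wu] Hinf_norm_upper[OF G(1) X] G(2) by simp
      qed
      then have "cmod (\<Lambda> ?\<phi>) \<le> ?N"
        using R.dual_norm_upper[OF \<Lambda>, of ?\<phi>] \<phi>(1) by simp
      moreover have "\<Lambda> ?\<phi> = bil n (?F X) w u"
        unfolding \<phi>(2) bil by (intro sum.cong refl) (auto simp: function_of_functional_apply[OF X])
      ultimately show "cmod (bil n (?F X) w u) \<le> ?N" by simp
    qed
  qed
qed

text \<open>
  A functional on \<open>n \<times> n\<close> matrices is a combination of entries, so the claim holds on the point
  functionals; these span a dense subspace.
\<close>

theorem predual_X_representation:
  assumes \<Lambda>: "\<Lambda> \<in> ns_carrier (ns_dual (ns_restrict (ns_dual (Hinf Q)) (predual_X Q)))"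
    and \<phi>: "\<phi> \<in> predual_X Q"
  shows "\<Lambda> \<phi> = \<phi> (function_of_functional \<Lambda>)"
proof (rule H.dual_representation_closure[OF point_functionals_in_dual predual_X_def \<Lambda>
      function_of_functional_in_Hinf[OF \<Lambda>] _ \<phi>])
  fix \<psi> assume "\<psi> \<in> point_functionals Q"
  then obtain n X \<eta> where X: "X \<in> nc_ball_at Q n" and \<eta>: "\<eta> \<in> ns_carrier (ns_dual (mat_space n))"
    and \<psi>: "\<psi> = pullback (Hinf Q) (\<lambda>F. F X) \<eta>" unfolding point_functionals_eq by blast
  let ?c = "\<lambda>p. \<eta> (matrix_unit complex_line n p 1)"
  have "\<psi> = (\<lambda>G\<in>ns_carrier (Hinf Q). \<Sum>p\<in>{..<n}\<times>{..<n}. ?c p * entry_functional X p G)"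
    unfolding \<psi> pullback_def
    by (intro restrict_ext) (simp add: mat_functional_expansion[OF \<eta> Hinf_mat[OF _ X]] entry_functional_def)
  then have "\<Lambda> \<psi> = (\<Sum>p\<in>{..<n}\<times>{..<n}. ?c p * \<Lambda> (entry_functional X p))"
    using H.dual_sum[OF predual_X_subspace \<Lambda>, of "{..<n}\<times>{..<n}" "entry_functional X" ?c]
      entry_functional_in_predual_X[OF X] by simp
  also have "\<dots> = (\<Sum>p\<in>{..<n}\<times>{..<n}. ?c p * function_of_functional \<Lambda> X $$ p)"
    by (intro sum.cong refl) (auto simp: function_of_functional_apply[OF X])
  also have "\<dots> = \<eta> (function_of_functional \<Lambda> X)"
    by (rule mat_functional_expansion[OF \<eta>, symmetric]) (simp add: function_of_functional_apply[OF X])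
  finally show "\<Lambda> \<psi> = \<psi> (function_of_functional \<Lambda>)"
    using function_of_functional_in_Hinf[OF \<Lambda>] by (simp add: \<psi> pullback_def)
qed

end

context nc_operator_ball
begin

section \<open>Matrices of bounded NC functions\<close>

lemma mat_Hinf_simps:
  "ns_carrier (mat_Hinf k Q) = {F \<in> carrier_mat k k. \<forall>i<k. \<forall>j<k. F $$ (i, j) \<in> ns_carrier (Hinf Q)}"
  "ns_add (mat_Hinf k Q) = (\<lambda>A B. Matrix.mat k k (\<lambda>(i, j). ns_add (Hinf Q) (A $$ (i, j)) (B $$ (i, j))))"
  "ns_scale (mat_Hinf k Q) = (\<lambda>c A. Matrix.mat k k (\<lambda>(i, j). ns_scale (Hinf Q) c (A $$ (i, j))))"
  by (simp_all add: mat_Hinf_def)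

lemma mat_Hinf_norm: "ns_norm (mat_Hinf k Q) F
    = Sup {mat_norm (flatten_blocks k n (matrix_eval X F)) | n X. X \<in> nc_ball_at Q n}"
  by (simp add: mat_Hinf_def)

lemma matrix_eval_entry:
  "\<lbrakk>F \<in> carrier_mat k k; i < k; j < k\<rbrakk> \<Longrightarrow> matrix_eval X F $$ (i, j) = (F $$ (i, j)) X"
  by (simp add: matrix_eval_def)

lemma matrix_eval_carrier:
  "\<lbrakk>F \<in> ns_carrier (mat_Hinf k Q); X \<in> nc_ball_at Q n\<rbrakk>
    \<Longrightarrow> matrix_eval X F \<in> ns_carrier (block_mat_space k n)"
  by (auto simp: matrix_eval_def mat_Hinf_simps Hinf_mat)

lemma matrix_eval_linear:
  assumes F: "F \<in> ns_carrier (mat_Hinf k Q)" and G: "G \<in> ns_carrier (mat_Hinf k Q)" and X: "X \<in> nc_ball_at Q n"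
  shows "matrix_eval X (ns_add (mat_Hinf k Q) F G)
      = ns_add (block_mat_space k n) (matrix_eval X F) (matrix_eval X G)"
    and "matrix_eval X (ns_scale (mat_Hinf k Q) c F) = ns_scale (block_mat_space k n) c (matrix_eval X F)"
  using F G nc_ball_at_subset[OF X]
  by (auto simp: matrix_eval_def mat_Hinf_simps Hinf_add_apply Hinf_scale_apply intro!: eq_matI)

lemma mat_Hinf_norm_upper:
  assumes F: "F \<in> ns_carrier (mat_Hinf k Q)" and X: "X \<in> nc_ball_at Q n"
  shows "mat_norm (flatten_blocks k n (matrix_eval X F)) \<le> ns_norm (mat_Hinf k Q) F"
proof -
  have "mat_norm (flatten_blocks k n (matrix_eval X F))
      \<le> (\<Sum>i<k. \<Sum>j<k. ns_norm (Hinf Q) (F $$ (i, j)))" if X: "X \<in> nc_ball_at Q n" for n X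
  proof -
    have "mat_norm (flatten_blocks k n (matrix_eval X F)) \<le> (\<Sum>i<k. \<Sum>j<k. mat_norm (matrix_eval X F $$ (i, j)))"
      using matrix_eval_carrier[OF F X] by (intro mat_norm_flatten_le) auto
    also have "\<dots> \<le> (\<Sum>i<k. \<Sum>j<k. ns_norm (Hinf Q) (F $$ (i, j)))"
      using F X by (intro sum_mono) (auto simp: mat_Hinf_simps matrix_eval_entry intro!: Hinf_norm_upper)
    finally show ?thesis .
  qed
  then show ?thesis
    unfolding mat_Hinf_norm using X
    by (intro cSup_upper bdd_aboveI[of _ "\<Sum>i<k. \<Sum>j<k. ns_norm (Hinf Q) (F $$ (i, j))"]) auto
qed

lemma mat_Hinf_norm_le:
  assumes "\<And>n X. X \<in> nc_ball_at Q n \<Longrightarrow> mat_norm (flatten_blocks k n (matrix_eval X F)) \<le> C"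
  shows "ns_norm (mat_Hinf k Q) F \<le> C"
  unfolding mat_Hinf_norm by (rule cSup_least) (use zero_in_nc_ball assms in auto)

lemma homogeneous_mat_Hinf: "homogeneous_nspace (mat_Hinf k Q)"
proof (rule homogeneous_nspaceI)
  let ?Y = "mat_Hinf k Q"
  show "ns_carrier ?Y \<noteq> {}"
    using zero_function_in_Hinf
    by (auto simp: mat_Hinf_simps intro!: exI[of _ "Matrix.mat k k (\<lambda>_. \<lambda>X\<in>nc_ball Q. 0\<^sub>m (dim_row (X undefined)) (dim_row (X undefined)))"])
  show "ns_add ?Y F G \<in> ns_carrier ?Y" if "F \<in> ns_carrier ?Y" "G \<in> ns_carrier ?Y" for F G
    using that by (simp add: mat_Hinf_simps Hinf_add_closed)
  show "ns_scale ?Y c F \<in> ns_carrier ?Y" if "F \<in> ns_carrier ?Y" for c F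
    using that by (simp add: mat_Hinf_simps Hinf_scale_closed)
  show "0 \<le> ns_norm ?Y F" if F: "F \<in> ns_carrier ?Y" for F
    using mat_norm_nonneg[OF flatten_carrier] mat_Hinf_norm_upper[OF F zero_in_nc_ball] by (rule order_trans)
  show "ns_norm ?Y (ns_scale ?Y c F) \<le> cmod c * ns_norm ?Y F" if F: "F \<in> ns_carrier ?Y" for c F
  proof (rule mat_Hinf_norm_le)
    fix n X assume X: "X \<in> nc_ball_at Q n"
    have "mat_norm (flatten_blocks k n (matrix_eval X (ns_scale ?Y c F)))
        \<le> cmod c * mat_norm (flatten_blocks k n (matrix_eval X F))"
      unfolding matrix_eval_linear(2)[OF F F X] flatten_scale[OF matrix_eval_carrier[OF F X]]
      by (rule mat_norm_smult_le[OF flatten_carrier])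
    also have "\<dots> \<le> cmod c * ns_norm ?Y F"
      by (intro mult_left_mono mat_Hinf_norm_upper F X) simp
    finally show "mat_norm (flatten_blocks k n (matrix_eval X (ns_scale ?Y c F))) \<le> cmod c * ns_norm ?Y F" .
  qed
  show "ns_scale ?Y (inverse c) (ns_scale ?Y c F) = F" if "F \<in> ns_carrier ?Y" "c \<noteq> 0" for c F
    using that by (auto simp: mat_Hinf_simps H.scale_scale H.scale_one intro!: eq_matI)
qed

end

locale nc_matrix_functions = nc_operator_ball Q
  for Q :: "'d::finite \<Rightarrow> 'h::complex_hilbert_space \<Rightarrow> 'h" +
  fixes k :: nat
begin

abbreviation "Y \<equiv> mat_Hinf k Q"
abbreviation "indices \<equiv> {..<k} \<times> {..<k}"

abbreviation "unit_at \<equiv> matrix_unit (Hinf Q) k"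

sublocale Y: homogeneous_nspace "mat_Hinf k Q"
  by (rule homogeneous_mat_Hinf)

text \<open>
  Together with \<open>contraction_matrix_unit\<close> this makes each position of the matrix a contractively
  complemented copy of \<open>Hinf Q\<close>.  The dual of \<open>mat_Hinf k Q\<close> is compared with that of \<open>Hinf Q\<close> through the
  pullbacks along these two maps.
\<close>

lemma contraction_entry:
  assumes p: "p \<in> indices"
  shows "contraction Y (Hinf Q) (\<lambda>F. F $$ p)"
proof -
  obtain i j where ij: "p = (i, j)" "i < k" "j < k" using p by auto
  have "ns_norm (Hinf Q) (F $$ p) \<le> ns_norm Y F" if F: "F \<in> Y.carr" for F
  proof (rule Hinf_norm_le)
    fix n X assume X: "X \<in> nc_ball_at Q n"
    have "F \<in> carrier_mat k k" using F by (simp add: mat_Hinf_simps)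
    then have eval: "matrix_eval X F $$ (i, j) = (F $$ p) X" using ij by (simp add: matrix_eval_entry)
    have "matrix_eval X F $$ (i, j) \<in> carrier_mat n n"
      using matrix_eval_carrier[OF F X] ij by simp
    then have "mat_norm ((F $$ p) X) \<le> mat_norm (flatten_blocks k n (matrix_eval X F))"
      using mat_norm_block_le[of "matrix_eval X F" i j n k] ij eval by simp
    also have "\<dots> \<le> ns_norm Y F" by (rule mat_Hinf_norm_upper[OF F X])
    finally show "mat_norm ((F $$ p) X) \<le> ns_norm Y F" .
  qed
  then show ?thesis using ij by (auto simp: contraction_def mat_Hinf_simps)
qed

lemma matrix_unit_in_mat_Hinf:
  "f \<in> H.carr \<Longrightarrow> unit_at p f \<in> Y.carr"
  by (auto simp: matrix_unit_def mat_Hinf_simps Hinf_scale_closed)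

lemma contraction_matrix_unit:
  assumes p: "p \<in> indices"
  shows "contraction (Hinf Q) Y (unit_at p)"
proof -
  obtain i j where ij: "p = (i, j)" "i < k" "j < k" using p by auto
  have "ns_norm Y (unit_at p f) \<le> ns_norm (Hinf Q) f" if f: "f \<in> H.carr" for f
  proof (rule mat_Hinf_norm_le)
    fix n X assume X: "X \<in> nc_ball_at Q n"
    let ?A = "matrix_eval X (unit_at p f)"
    have fX: "f X \<in> carrier_mat n n" by (rule Hinf_mat[OF f X])
    have ent: "?A $$ (i', j') = (if i' = i \<and> j' = j then f X else 0 \<cdot>\<^sub>m f X)" if "i' < k" "j' < k" for i' j'
      using that ij nc_ball_at_subset[OF X] by (simp add: matrix_eval_def matrix_unit_def Hinf_scale_apply)
    have zero: "mat_norm (0 \<cdot>\<^sub>m f X) = 0"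
      using mat_norm_smult_le[OF fX, of 0] mat_norm_nonneg[of "0 \<cdot>\<^sub>m f X" n] fX by simp
    have "mat_norm (flatten_blocks k n ?A) \<le> (\<Sum>i'<k. \<Sum>j'<k. mat_norm (?A $$ (i', j')))"
      using matrix_eval_carrier[OF matrix_unit_in_mat_Hinf[OF f] X] by (intro mat_norm_flatten_le) auto
    also have "\<dots> = (\<Sum>i'<k. \<Sum>j'<k. if j' = j then if i' = i then mat_norm (f X) else 0 else 0)"
      by (intro sum.cong refl) (auto simp: ent zero)
    also have "\<dots> = mat_norm (f X)" using ij by simp
    also have "\<dots> \<le> ns_norm (Hinf Q) f" by (rule Hinf_norm_upper[OF f X])
    finally show "mat_norm (flatten_blocks k n ?A) \<le> ns_norm (Hinf Q) f" .
  qed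
  moreover have "unit_at p (ns_add (Hinf Q) f g)
      = ns_add Y (unit_at p f) (unit_at p g)"
    if "f \<in> H.carr" "g \<in> H.carr" for f g
    using that by (intro eq_matI) (auto simp: matrix_unit_def mat_Hinf_simps H.scale_add)
  moreover have "unit_at p (ns_scale (Hinf Q) c f) = ns_scale Y c (unit_at p f)"
    if "f \<in> H.carr" for c f
    using that by (intro eq_matI) (auto simp: matrix_unit_def mat_Hinf_simps H.scale_scale)
  ultimately show ?thesis unfolding contraction_def by (auto simp: matrix_unit_in_mat_Hinf)
qed

lemma nspace_contraction_entry: "p \<in> indices \<Longrightarrow> nspace_contraction Y (Hinf Q) (\<lambda>F. F $$ p)"
  and nspace_contraction_matrix_unit:
    "p \<in> indices \<Longrightarrow> nspace_contraction (Hinf Q) Y (unit_at p)"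
  unfolding nspace_contraction_def nspace_contraction_axioms_def
  using contraction_entry contraction_matrix_unit Y.homogeneous_nspace_axioms H.homogeneous_nspace_axioms
  by blast+

lemma dual_matrix_unit_expansion:
  assumes \<psi>: "\<psi> \<in> Y.dual_carr" and F: "F \<in> Y.carr"
  shows "\<psi> F = (\<Sum>p\<in>indices. \<psi> (unit_at p (F $$ p)))"
  by (rule H.additive_matrix_unit_expansion[OF mat_Hinf_def, where \<psi>=\<psi>])
    (use Y.dual_add_apply[OF \<psi>] Y.dual_scale_apply[OF \<psi>] F in auto)

lemma predual_Xk_eq_sums:
  "predual_Xk k Q = {\<lambda>F\<in>Y.carr. \<Sum>p\<in>indices. \<phi> p (F $$ p) | \<phi>. \<forall>p\<in>indices. \<phi> p \<in> predual_X Q}"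
  (is "?L = ?R")
proof
  show "?L \<subseteq> ?R"
  proof
    fix \<psi> assume "\<psi> \<in> ?L"
    then obtain \<phi> where \<phi>: "\<psi> = (\<lambda>F\<in>Y.carr. \<Sum>i<k. \<Sum>j<k. \<phi> i j (F $$ (i, j)))"
      "\<forall>i<k. \<forall>j<k. \<phi> i j \<in> predual_X Q" unfolding predual_Xk_def by blast
    have "\<psi> = (\<lambda>F\<in>Y.carr. \<Sum>p\<in>indices. case_prod \<phi> p (F $$ p))"
      unfolding \<phi>(1) by (simp add: sum.cartesian_product case_prod_unfold)
    moreover have "\<forall>p\<in>indices. case_prod \<phi> p \<in> predual_X Q" using \<phi>(2) by auto
    ultimately show "\<psi> \<in> ?R" by blast
  qed
  show "?R \<subseteq> ?L"
  proof
    fix \<psi> assume "\<psi> \<in> ?R"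
    then obtain \<phi> where \<phi>: "\<psi> = (\<lambda>F\<in>Y.carr. \<Sum>p\<in>indices. \<phi> p (F $$ p))"
      "\<forall>p\<in>indices. \<phi> p \<in> predual_X Q" by blast
    have "\<psi> = (\<lambda>F\<in>Y.carr. \<Sum>i<k. \<Sum>j<k. \<phi> (i, j) (F $$ (i, j)))"
      unfolding \<phi>(1) by (simp add: sum.cartesian_product case_prod_unfold)
    moreover have "\<forall>i<k. \<forall>j<k. \<phi> (i, j) \<in> predual_X Q" using \<phi>(2) by auto
    ultimately show "\<psi> \<in> ?L" unfolding predual_Xk_def mem_Collect_eq
      by (intro exI[of _ "\<lambda>i j. \<phi> (i, j)"]) simp
  qed
qed

lemma dual_matrix_unit_entry:
  "\<phi> \<in> H.dual_carr \<Longrightarrow> f \<in> H.carr \<Longrightarrow> p \<in> indices \<Longrightarrow> q \<in> indices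
    \<Longrightarrow> \<phi> (unit_at p f $$ q) = (if q = p then \<phi> f else 0)"
  using H.dual_scale_apply[of \<phi> f 0] by (cases q) (auto simp: matrix_unit_def split: if_splits)

text \<open>
  Membership can be tested in each position separately.  Since pullbacks are continuous, this shows
  that \<open>predual_Xk\<close> is norm closed.
\<close>

lemma predual_Xk_iff:
  "\<psi> \<in> predual_Xk k Q \<longleftrightarrow> \<psi> \<in> Y.dual_carr \<and>
    (\<forall>p\<in>indices. pullback (Hinf Q) (unit_at p) \<psi> \<in> predual_X Q)"
proof (intro iffI conjI ballI; (elim conjE)?)
  assume "\<psi> \<in> predual_Xk k Q"
  then obtain \<phi> where \<psi>: "\<psi> = (\<lambda>F\<in>Y.carr. \<Sum>p\<in>indices. \<phi> p (F $$ p))"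
    and \<phi>: "\<And>p. p \<in> indices \<Longrightarrow> \<phi> p \<in> predual_X Q" unfolding predual_Xk_eq_sums by blast
  have \<phi>D: "\<phi> p \<in> H.dual_carr" if "p \<in> indices" for p
    by (rule predual_X_in_dual[OF \<phi>[OF that]])
  have ent: "F $$ p \<in> H.carr" "ns_norm (Hinf Q) (F $$ p) \<le> ns_norm Y F"
    "(ns_add Y F G) $$ p = ns_add (Hinf Q) (F $$ p) (G $$ p)" "(ns_scale Y c F) $$ p = ns_scale (Hinf Q) c (F $$ p)"
    if "p \<in> indices" "F \<in> Y.carr" "G \<in> Y.carr" for p F G c
    using contraction_entry[OF that(1)] that(2,3) unfolding contraction_def by auto
  show "\<psi> \<in> Y.dual_carr"
    unfolding \<psi>
  proof (rule Y.dualI[where B="\<Sum>p\<in>indices. ns_norm (ns_dual (Hinf Q)) (\<phi> p)"])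
    fix F G assume FG: "F \<in> Y.carr" "G \<in> Y.carr"
    show "(\<Sum>p\<in>indices. \<phi> p (ns_add Y F G $$ p)) = (\<Sum>p\<in>indices. \<phi> p (F $$ p)) + (\<Sum>p\<in>indices. \<phi> p (G $$ p))"
      unfolding sum.distrib[symmetric]
      using H.dual_add_apply[OF \<phi>D ent(1)[OF _ FG] ent(1)[OF _ FG(2,1)]] ent(3)[OF _ FG]
      by (intro sum.cong refl) metis
  next
    fix c F assume F: "F \<in> Y.carr"
    show "(\<Sum>p\<in>indices. \<phi> p (ns_scale Y c F $$ p)) = c * (\<Sum>p\<in>indices. \<phi> p (F $$ p))"
      unfolding sum_distrib_left
      using H.dual_scale_apply[OF \<phi>D ent(1)[OF _ F F]] ent(4)[OF _ F F]
      by (intro sum.cong refl) metis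
  next
    fix F assume F: "F \<in> Y.carr"
    have "cmod (\<phi> p (F $$ p)) \<le> ns_norm (ns_dual (Hinf Q)) (\<phi> p) * ns_norm Y F" if p: "p \<in> indices" for p
      using H.dual_bound[OF \<phi>D[OF p] ent(1)[OF p F F]]
        mult_left_mono[OF ent(2)[OF p F F] H.dual_norm_nonneg[OF \<phi>D[OF p]]] by linarith
    then show "cmod (\<Sum>p\<in>indices. \<phi> p (F $$ p)) \<le> (\<Sum>p\<in>indices. ns_norm (ns_dual (Hinf Q)) (\<phi> p)) * ns_norm Y F"
      unfolding sum_distrib_right by (rule sum_norm_le)
  qed
  fix p assume p: "p \<in> indices"
  have "pullback (Hinf Q) (unit_at p) \<psi> f = \<phi> p f" if f: "f \<in> H.carr" for f
  proof -
    have "pullback (Hinf Q) (unit_at p) \<psi> f = (\<Sum>q\<in>indices. if q = p then \<phi> p f else 0)"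
      using f matrix_unit_in_mat_Hinf[OF f, of p]
      by (auto simp: pullback_def \<psi> dual_matrix_unit_entry[OF \<phi>D f p] intro!: sum.cong simp del: mem_Sigma_iff)
    also have "\<dots> = \<phi> p f" using p by (subst sum.delta) auto
    finally show ?thesis .
  qed
  then have "pullback (Hinf Q) (unit_at p) \<psi> = \<phi> p"
    using \<phi>D[OF p] by (intro extensionalityI[of _ "H.carr"]) (auto simp: pullback_def dual_carrier_iff)
  then show "pullback (Hinf Q) (unit_at p) \<psi> \<in> predual_X Q" using \<phi>[OF p] by simp
next
  assume \<psi>: "\<psi> \<in> Y.dual_carr"
    and comp: "\<forall>p\<in>indices. pullback (Hinf Q) (unit_at p) \<psi> \<in> predual_X Q"
  let ?\<phi> = "\<lambda>p. pullback (Hinf Q) (unit_at p) \<psi>"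
  have "\<psi> = (\<lambda>F\<in>Y.carr. \<Sum>p\<in>indices. ?\<phi> p (F $$ p))"
  proof (rule extensionalityI[of _ "Y.carr"])
    show "\<psi> \<in> extensional (Y.carr)" using \<psi> by (simp add: dual_carrier_iff)
    fix F assume F: "F \<in> Y.carr"
    then have "F $$ p \<in> H.carr" if "p \<in> indices" for p
      using that by (auto simp: mat_Hinf_simps)
    then have "(\<Sum>p\<in>indices. \<psi> (unit_at p (F $$ p))) = (\<Sum>p\<in>indices. ?\<phi> p (F $$ p))"
      by (intro sum.cong refl) (simp add: pullback_def)
    then show "\<psi> F = (\<lambda>F\<in>Y.carr. \<Sum>p\<in>indices. ?\<phi> p (F $$ p)) F"
      using dual_matrix_unit_expansion[OF \<psi> F] F by simp
  qed simp
  then show "\<psi> \<in> predual_Xk k Q" unfolding predual_Xk_eq_sums mem_Collect_eq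
    using comp by (intro exI[of _ ?\<phi>] conjI)
qed

lemma pullback_entry_in_predual_Xk:
  assumes \<phi>: "\<phi> \<in> predual_X Q" and p: "p \<in> indices"
  shows "pullback Y (\<lambda>F. F $$ p) \<phi> \<in> predual_Xk k Q"
proof -
  let ?\<phi> = "\<lambda>q. if q = p then \<phi> else (\<lambda>f\<in>H.carr. 0)"
  have "ns_scale (ns_dual (Hinf Q)) 0 \<phi> \<in> predual_X Q"
    using predual_X_subspace \<phi> by (simp add: ns_subspace_def)
  then have zero: "(\<lambda>f\<in>H.carr. 0) \<in> predual_X Q" by (simp add: dual_scale)
  have "pullback Y (\<lambda>F. F $$ p) \<phi> = (\<lambda>F\<in>Y.carr. \<Sum>q\<in>indices. ?\<phi> q (F $$ q))"
    unfolding pullback_def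
  proof (rule restrict_ext)
    fix F assume F: "F \<in> Y.carr"
    have "(\<Sum>q\<in>indices. ?\<phi> q (F $$ q)) = (\<Sum>q\<in>indices. if q = p then \<phi> (F $$ p) else 0)"
      using F by (intro sum.cong refl) (auto simp: mat_Hinf_simps)
    also have "\<dots> = \<phi> (F $$ p)" using p by (subst sum.delta) auto
    finally show "\<phi> (F $$ p) = (\<Sum>q\<in>indices. ?\<phi> q (F $$ q))" by simp
  qed
  moreover have "\<forall>q\<in>indices. ?\<phi> q \<in> predual_X Q" using \<phi> zero by simp
  ultimately show ?thesis unfolding predual_Xk_eq_sums mem_Collect_eq
    by (intro exI[of _ ?\<phi>] conjI)
qed

lemma predual_Xk_eq_Inter:
  "predual_Xk k Q = \<Inter>(insert (Y.dual_carr) ((\<lambda>p. {\<psi> \<in> Y.dual_carr.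
    pullback (Hinf Q) (unit_at p) \<psi> \<in> predual_X Q}) ` indices))"
  by (auto simp: predual_Xk_iff)

lemma predual_Xk_subspace: "ns_subspace (ns_dual Y) (predual_Xk k Q)"
proof -
  interpret D: complex_nspace "ns_dual Y" by (rule Y.complex_nspace_dual)
  show ?thesis
    unfolding predual_Xk_eq_Inter
  proof (rule D.subspace_Inter; (elim insertE imageE)?)
    fix W p assume p: "p \<in> indices" and W: "W = {\<psi> \<in> Y.dual_carr.
      pullback (Hinf Q) (unit_at p) \<psi> \<in> predual_X Q}"
    show "ns_subspace (ns_dual Y) W"
      unfolding W by (rule nspace_contraction.pullback_preimage_subspace[OF
        nspace_contraction_matrix_unit[OF p] predual_X_subspace])
  qed (use D.subspace_carrier in simp_all)
qed

lemma predual_Xk_closed: "closedin (norm_topology (ns_dual Y)) (predual_Xk k Q)"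
proof -
  interpret D: complex_nspace "ns_dual Y" by (rule Y.complex_nspace_dual)
  show ?thesis
    unfolding predual_Xk_eq_Inter
  proof (rule closedin_Inter; (elim insertE imageE)?)
    fix W p assume p: "p \<in> indices" and W: "W = {\<psi> \<in> Y.dual_carr.
      pullback (Hinf Q) (unit_at p) \<psi> \<in> predual_X Q}"
    show "closedin (norm_topology (ns_dual Y)) W"
      unfolding W by (rule nspace_contraction.pullback_preimage_closed[OF
        nspace_contraction_matrix_unit[OF p] predual_X_closed])
  qed (simp_all add: D.closedin_norm_topology)
qed

lemma entry_evaluation_in_predual_Xk:
  assumes X: "X \<in> nc_ball_at Q n" and p: "p \<in> indices" and q: "q \<in> {..<n} \<times> {..<n}"
  shows "(\<lambda>F\<in>Y.carr. (F $$ p) X $$ q) \<in> predual_Xk k Q"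
proof -
  have "pullback Y (\<lambda>F. F $$ p) (entry_functional X q) \<in> predual_Xk k Q"
    by (rule pullback_entry_in_predual_Xk[OF entry_functional_in_predual_X[OF X q] p])
  moreover have "pullback Y (\<lambda>F. F $$ p) (entry_functional X q) = (\<lambda>F\<in>Y.carr. (F $$ p) X $$ q)"
    using p unfolding pullback_def entry_functional_def by (intro restrict_ext) (auto simp: mat_Hinf_simps)
  ultimately show ?thesis by simp
qed

lemma flat_entry_in_predual_Xk:
  assumes X: "X \<in> nc_ball_at Q n" and r: "r < k * n" "s < k * n"
  shows "(\<lambda>F\<in>Y.carr. flatten_blocks k n (matrix_eval X F) $$ (r, s)) \<in> predual_Xk k Q"
proof -
  note dm = div_mod_less[OF r(1)] div_mod_less[OF r(2)]
  have "(\<lambda>F\<in>Y.carr. flatten_blocks k n (matrix_eval X F) $$ (r, s))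
      = (\<lambda>F\<in>Y.carr. (F $$ (r div n, s div n)) X $$ (r mod n, s mod n))"
    using r dm by (intro restrict_ext) (simp add: flatten_blocks_def matrix_eval_entry[of _ k] mat_Hinf_simps)
  then show ?thesis using entry_evaluation_in_predual_Xk[OF X, of "(r div n, s div n)" "(r mod n, s mod n)"] dm by simp
qed

text \<open>
  Separation: the entries of the values determine a matrix of NC functions.  Norming: the functionals
  \<open>bil\<close> of the flattened values.  Representation: a functional on \<open>predual_Xk\<close> restricts to a functional
  on \<open>predual_X\<close> in each position, and the representing functions form the matrix sought.
\<close>

theorem predual_Xk_is_predual: "is_predual Y (predual_Xk k Q)"
proof (rule Y.is_predualI[OF predual_Xk_subspace predual_Xk_closed])
  fix F G assume F: "F \<in> Y.carr" and G: "G \<in> Y.carr"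
    and eq: "\<And>\<phi>. \<phi> \<in> predual_Xk k Q \<Longrightarrow> \<phi> F = \<phi> G"
  show "F = G"
  proof (rule eq_matI)
    fix i j assume "i < dim_row G" "j < dim_col G"
    then have p: "(i, j) \<in> indices" using G by (auto simp: mat_Hinf_simps)
    then have FG: "F $$ (i, j) \<in> H.carr" "G $$ (i, j) \<in> H.carr"
      using F G by (auto simp: mat_Hinf_simps)
    show "F $$ (i, j) = G $$ (i, j)"
    proof (rule Hinf_eqI[OF Hinf_extensional[OF FG(1)] Hinf_extensional[OF FG(2)]])
      fix n X assume X: "X \<in> nc_ball_at Q n"
      have "(F $$ (i, j)) X $$ (a, b) = (G $$ (i, j)) X $$ (a, b)" if "a < n" "b < n" for a b
        using eq[OF entry_evaluation_in_predual_Xk[OF X p, of "(a, b)"]] F G that by simp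
      then show "(F $$ (i, j)) X = (G $$ (i, j)) X"
        using Hinf_mat[OF FG(1) X] Hinf_mat[OF FG(2) X] by (intro eq_matI) auto
    qed
  qed (use F G in \<open>auto simp: mat_Hinf_simps\<close>)
next
  fix F and C :: real
  assume F: "F \<in> Y.carr"
    and C: "\<And>\<phi>. \<lbrakk>\<phi> \<in> predual_Xk k Q; ns_norm (ns_dual Y) \<phi> \<le> 1\<rbrakk> \<Longrightarrow> cmod (\<phi> F) \<le> C"
  show "ns_norm Y F \<le> C"
  proof (intro mat_Hinf_norm_le mat_norm_le[OF flatten_carrier])
    fix n X w u assume X: "X \<in> nc_ball_at Q n" and wu: "vnorm (k * n) w \<le> 1" "vnorm (k * n) u \<le> 1"
    let ?c = "\<lambda>p. w (fst p) * u (snd p)"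
    let ?e = "\<lambda>p. \<lambda>F\<in>Y.carr. flatten_blocks k n (matrix_eval X F) $$ p"
    let ?\<phi> = "\<lambda>F\<in>Y.carr. \<Sum>p\<in>{..<k*n}\<times>{..<k*n}. ?c p * ?e p F"
    have val: "?\<phi> G = bil (k * n) (flatten_blocks k n (matrix_eval X G)) w u" if "G \<in> Y.carr" for G
      using that by (simp add: bil_def sum.cartesian_product case_prod_unfold mult_ac)
    have e: "?e p \<in> predual_Xk k Q" if "p \<in> {..<k*n}\<times>{..<k*n}" for p
      using flat_entry_in_predual_Xk[OF X, of "fst p" "snd p"] that by auto
    have "?\<phi> \<in> predual_Xk k Q"
      by (rule Y.subspace_sum[OF predual_Xk_subspace _ e]) simp_all
    moreover have "ns_norm (ns_dual Y) ?\<phi> \<le> 1"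
    proof (rule Y.dual_norm_le)
      fix G assume G: "G \<in> Y.carr" "ns_norm Y G \<le> 1"
      show "cmod (?\<phi> G) \<le> 1"
        unfolding val[OF G(1)]
        using cmod_bil_le[OF flatten_carrier wu, of "matrix_eval X G"] mat_Hinf_norm_upper[OF G(1) X] G(2)
        by linarith
    qed
    ultimately have "cmod (?\<phi> F) \<le> C" by (rule C)
    then show "cmod (bil (k * n) (flatten_blocks k n (matrix_eval X F)) w u) \<le> C"
      unfolding val[OF F] .
  qed
next
  fix \<Lambda> assume \<Lambda>: "\<Lambda> \<in> ns_carrier (ns_dual (ns_restrict (ns_dual Y) (predual_Xk k Q)))"
  let ?XH = "ns_restrict (ns_dual (Hinf Q)) (predual_X Q)"
  let ?XY = "ns_restrict (ns_dual Y) (predual_Xk k Q)"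
  let ?pb = "\<lambda>p. pullback Y (\<lambda>F. F $$ p)"
  let ?\<Lambda> = "\<lambda>p. pullback ?XH (?pb p) \<Lambda>"
  have \<Lambda>p: "?\<Lambda> p \<in> ns_carrier (ns_dual ?XH)" if p: "p \<in> indices" for p
  proof -
    interpret entry: nspace_contraction Y "Hinf Q" "\<lambda>F. F $$ p" by (rule nspace_contraction_entry[OF p])
    have "contraction ?XH ?XY (?pb p)"
      using entry.contraction_pullback pullback_entry_in_predual_Xk[OF _ p] predual_X_in_dual
      unfolding contraction_def by simp
    then interpret nspace_contraction ?XH ?XY "?pb p"
      unfolding nspace_contraction_def nspace_contraction_axioms_def
      using complex_nspace.axioms(1)[OF complex_nspace_restrict[OF Y.complex_nspace_dual predual_Xk_subspace]]
        complex_nspace.axioms(1)[OF complex_nspace_restrict[OF H.complex_nspace_dual predual_X_subspace]]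
      by blast
    show ?thesis by (rule pullback_in_dual[OF \<Lambda>])
  qed
  define F where "F = Matrix.mat k k (\<lambda>p. function_of_functional (?\<Lambda> p))"
  have F: "F \<in> Y.carr"
    using function_of_functional_in_Hinf[OF \<Lambda>p] by (auto simp: F_def mat_Hinf_simps)
  have "\<Lambda> \<psi> = \<psi> F" if \<psi>: "\<psi> \<in> predual_Xk k Q" for \<psi>
  proof -
    obtain \<phi> where \<psi>_eq: "\<psi> = (\<lambda>F\<in>Y.carr. \<Sum>p\<in>indices. \<phi> p (F $$ p))"
      and \<phi>: "\<And>p. p \<in> indices \<Longrightarrow> \<phi> p \<in> predual_X Q" using \<psi> unfolding predual_Xk_eq_sums by blast
    have "\<psi> = (\<lambda>F\<in>Y.carr. \<Sum>p\<in>indices. 1 * ?pb p (\<phi> p) F)"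
      unfolding \<psi>_eq by (intro restrict_ext) (simp add: pullback_def)
    then have "\<Lambda> \<psi> = (\<Sum>p\<in>indices. 1 * \<Lambda> (?pb p (\<phi> p)))"
      using Y.dual_sum[OF predual_Xk_subspace \<Lambda>, of indices "\<lambda>p. ?pb p (\<phi> p)" "\<lambda>_. 1"]
        pullback_entry_in_predual_Xk[OF \<phi>] by simp
    also have "\<dots> = (\<Sum>p\<in>indices. \<phi> p (F $$ p))"
    proof (rule sum.cong[OF refl])
      fix p assume p: "p \<in> indices"
      have "\<Lambda> (?pb p (\<phi> p)) = ?\<Lambda> p (\<phi> p)" using \<phi>[OF p] by (simp add: pullback_def[of ?XH])
      also have "\<dots> = \<phi> p (function_of_functional (?\<Lambda> p))"
        by (rule predual_X_representation[OF \<Lambda>p[OF p] \<phi>[OF p]])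
      also have "function_of_functional (?\<Lambda> p) = F $$ p" using p by (auto simp: F_def)
      finally show "1 * \<Lambda> (?pb p (\<phi> p)) = \<phi> p (F $$ p)" by simp
    qed
    finally show ?thesis using F by (simp add: \<psi>_eq)
  qed
  with F show "\<exists>F\<in>Y.carr. \<forall>\<psi>\<in>predual_Xk k Q. \<Lambda> \<psi> = \<psi> F" by blast
qed

section \<open>Continuity of the point evaluations and uniqueness\<close>

text \<open>
  On a weak neighbourhood all of the finitely many entries of the flattened value are within \<open>d\<close> of
  those at the centre, and the matrix norm is at most the sum of the entries.
\<close>

theorem matrix_eval_weakly_continuous:
  assumes X: "X \<in> nc_ball_at Q n"
  shows "continuous_map (weak_topology Y (predual_Xk k Q)) (norm_topology (block_mat_space k n)) (matrix_eval X)"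
proof -
  interpret B: complex_nspace "block_mat_space k n" by (rule complex_nspace_block_mat)
  let ?T = "weak_topology Y (predual_Xk k Q)"
  let ?N = "k * n"
  have top: "topspace ?T = Y.carr"
    using predual_Xk_subspace by (intro Y.topspace_weak_topology) (auto simp: ns_subspace_def)
  show ?thesis
    unfolding norm_topology_def B.continuous_map_to_metric top
  proof (intro ballI allI impI)
    fix F and e :: real assume F: "F \<in> Y.carr" and e: "e > 0"
    define M where "M = real (?N * ?N)"
    have M: "M \<ge> 0" by (simp add: M_def)
    \<comment> \<open>There are \<open>M\<close> entries; the summand 1 covers \<open>M = 0\<close> and makes the final inequality strict.\<close>
    define d where "d = e / (M + 1)"
    have d: "d > 0" "(M + 1) * d = e" using e M by (auto simp: d_def)
    let ?e = "\<lambda>p F. flatten_blocks k n (matrix_eval X F) $$ p"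
    let ?S = "{..<?N} \<times> {..<?N}"
    let ?U = "(\<Inter>p\<in>?S. {G \<in> Y.carr. ?e p G \<in> ball (?e p F) d}) \<inter> topspace ?T"
    have "openin ?T {G \<in> Y.carr. ?e p G \<in> ball (?e p F) d}" if p: "p \<in> ?S" for p
    proof -
      have "(\<lambda>F\<in>Y.carr. ?e p F) \<in> predual_Xk k Q"
        using flat_entry_in_predual_Xk[OF X, of "fst p" "snd p"] p by auto
      from Y.openin_weak_vimage[OF this open_ball, of "?e p F" d] show ?thesis
        by (simp cong: conj_cong)
    qed
    then have "openin ?T ?U"
      by (intro openin_INT) auto
    moreover have "F \<in> ?U" using F d top by simp
    moreover have "matrix_eval X G \<in> B.mball (matrix_eval X F) e" if G: "G \<in> ?U" for G
    proof -
      have GY: "G \<in> Y.carr" using G top by simp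
      note car = matrix_eval_carrier[OF F X] matrix_eval_carrier[OF GY X]
      let ?D = "B.subv (matrix_eval X F) (matrix_eval X G)"
      have D: "flatten_blocks k n ?D = flatten_blocks k n (matrix_eval X F) + (- 1) \<cdot>\<^sub>m flatten_blocks k n (matrix_eval X G)"
        using car B.scale_closed by (simp only: flatten_add flatten_scale)
      have "mat_norm (flatten_blocks k n ?D) \<le> (\<Sum>r<?N. \<Sum>s<?N. cmod (flatten_blocks k n ?D $$ (r, s)))"
        by (rule mat_norm_le_sum_entries[OF flatten_carrier])
      also have "\<dots> \<le> (\<Sum>r<?N. \<Sum>s<?N. d)"
      proof (intro sum_mono)
        fix r s assume "r \<in> {..<?N}" "s \<in> {..<?N}"
        then show "cmod (flatten_blocks k n ?D $$ (r, s)) \<le> d"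
          unfolding D using G by (auto simp: dist_norm dest!: bspec[where x="(r, s)"] intro: less_imp_le)
      qed
      also have "\<dots> = M * d" by (simp add: M_def)
      also have "\<dots> < e" using d by (simp add: algebra_simps)
      finally show ?thesis using car by (simp only: B.in_mball ns_dist_def) (simp add: block_mat_space_simps)
    qed
    ultimately show "\<exists>U. openin ?T U \<and> F \<in> U \<and> (\<forall>G\<in>U. matrix_eval X G \<in> B.mball (matrix_eval X F) e)"
      by blast
  qed
qed

text \<open>
  Lipschitz with the norm of \<open>\<eta>\<close> as constant, since a block has at most the norm of the flattened matrix.
\<close>

lemma block_functional_continuous:
  assumes \<eta>: "\<eta> \<in> ns_carrier (ns_dual (mat_space n))" and ij: "i < k" "j < k"
  shows "continuous_map (norm_topology (block_mat_space k n)) euclidean (\<lambda>A. \<eta> (A $$ (i, j)))"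
proof -
  interpret B: complex_nspace "block_mat_space k n" by (rule complex_nspace_block_mat)
  interpret M: homogeneous_nspace "mat_space n" by (rule homogeneous_mat_space)
  let ?C = "ns_norm (ns_dual (mat_space n)) \<eta>"
  have C0: "0 \<le> ?C" by (rule M.dual_norm_nonneg[OF \<eta>])
  have lip: "dist (\<eta> (A $$ (i, j))) (\<eta> (A' $$ (i, j))) \<le> ?C * ns_dist (block_mat_space k n) A A'"
    if A: "A \<in> ns_carrier (block_mat_space k n)" and A': "A' \<in> ns_carrier (block_mat_space k n)" for A A'
  proof -
    let ?D = "B.subv A A'"
    have ent: "?D $$ (i, j) = A $$ (i, j) + (- 1) \<cdot>\<^sub>m A' $$ (i, j)" using ij by simp
    have car: "A $$ (i, j) \<in> carrier_mat n n" "A' $$ (i, j) \<in> carrier_mat n n" using A A' ij by auto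
    then have D: "?D $$ (i, j) \<in> carrier_mat n n" unfolding ent by simp
    from car have "\<eta> (?D $$ (i, j)) = \<eta> (A $$ (i, j)) - \<eta> (A' $$ (i, j))"
      unfolding ent using M.dual_add_apply[OF \<eta>, of "A $$ (i, j)" "(- 1) \<cdot>\<^sub>m A' $$ (i, j)"]
        M.dual_scale_apply[OF \<eta>, of "A' $$ (i, j)" "- 1"] by simp
    then have "dist (\<eta> (A $$ (i, j))) (\<eta> (A' $$ (i, j))) = cmod (\<eta> (?D $$ (i, j)))" by (simp add: dist_norm)
    also have "\<dots> \<le> ?C * mat_norm (?D $$ (i, j))"
      using M.dual_bound[OF \<eta>, of "?D $$ (i, j)"] D by (simp only: mat_space_simps)
    also have "\<dots> \<le> ?C * mat_norm (flatten_blocks k n ?D)"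
      by (intro mult_left_mono mat_norm_block_le C0 ij D)
    also have "\<dots> = ?C * ns_dist (block_mat_space k n) A A'"
      using A A' by (simp only: ns_dist_def) (simp add: block_mat_space_simps)
    finally show ?thesis .
  qed
  have "continuous_map B.mtopology Met_TC.mtopology (\<lambda>A. \<eta> (A $$ (i, j)))"
    unfolding B.metric_continuous_map[OF Met_TC.Metric_space_axioms]
  proof (intro conjI ballI allI impI)
    fix A and e :: real assume A: "A \<in> ns_carrier (block_mat_space k n)" and e: "e > 0"
    have "dist (\<eta> (A $$ (i, j))) (\<eta> (A' $$ (i, j))) < e"
      if A': "A' \<in> ns_carrier (block_mat_space k n)" and lt: "ns_dist (block_mat_space k n) A A' < e / (?C + 1)" for A'
    proof -
      have "dist (\<eta> (A $$ (i, j))) (\<eta> (A' $$ (i, j))) \<le> ?C * ns_dist (block_mat_space k n) A A'"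
        by (rule lip[OF A A'])
      also have "\<dots> \<le> (?C + 1) * ns_dist (block_mat_space k n) A A'"
        by (intro mult_right_mono) auto
      also have "\<dots> < e" using lt C0 by (simp add: pos_less_divide_eq mult.commute)
      finally show ?thesis .
    qed
    moreover have "e / (?C + 1) > 0" using e C0 by simp
    ultimately show "\<exists>d>0. \<forall>A'. A' \<in> ns_carrier (block_mat_space k n) \<and> ns_dist (block_mat_space k n) A A' < d
        \<longrightarrow> dist (\<eta> (A $$ (i, j))) (\<eta> (A' $$ (i, j))) < e" by blast
  qed simp
  then show ?thesis unfolding norm_topology_def by simp
qed

text \<open>
  A point functional in position \<open>(i, j)\<close> is a continuous functional of the value at a point, hence weakly
  continuous, hence in \<open>\<X>\<close>.  The functionals on \<open>Hinf Q\<close> whose pullback lies in \<open>\<X>\<close> form a closed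
  subspace, which therefore contains \<open>predual_X\<close>.
\<close>

theorem predual_Xk_minimal:
  assumes \<X>: "ns_subspace (ns_dual Y) \<X>" and closed: "closedin (norm_topology (ns_dual Y)) \<X>"
    and cont: "\<And>n X. X \<in> nc_ball_at Q n \<Longrightarrow>
      continuous_map (weak_topology Y \<X>) (norm_topology (block_mat_space k n)) (matrix_eval X)"
  shows "predual_Xk k Q \<subseteq> \<X>"
proof -
  have entry: "pullback Y (\<lambda>F. F $$ p) \<phi> \<in> \<X>" if p: "p \<in> indices" and \<phi>: "\<phi> \<in> predual_X Q" for p \<phi>
  proof -
    interpret entry: nspace_contraction Y "Hinf Q" "\<lambda>F. F $$ p" by (rule nspace_contraction_entry[OF p])
    interpret D: complex_nspace "ns_dual (Hinf Q)" by (rule H.complex_nspace_dual)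
    let ?W = "{\<phi> \<in> H.dual_carr. pullback Y (\<lambda>F. F $$ p) \<phi> \<in> \<X>}"
    have "predual_X Q \<subseteq> ?W"
      unfolding predual_X_def
    proof (rule D.closure_span_subset[OF _ entry.pullback_preimage_subspace[OF \<X>] entry.pullback_preimage_closed[OF closed]])
      show "point_functionals Q \<subseteq> ?W"
      proof
        fix \<phi> assume \<phi>: "\<phi> \<in> point_functionals Q"
        then obtain n X \<eta> where X: "X \<in> nc_ball_at Q n" and \<eta>: "\<eta> \<in> ns_carrier (ns_dual (mat_space n))"
          and eq: "\<phi> = pullback (Hinf Q) (\<lambda>F. F X) \<eta>" unfolding point_functionals_eq by blast
        obtain i j where ij: "p = (i, j)" "i < k" "j < k" using p by auto
        have \<phi>D: "\<phi> \<in> H.dual_carr" using point_functionals_in_dual \<phi> by blast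
        have pb: "pullback Y (\<lambda>F. F $$ p) \<phi> \<in> Y.dual_carr" by (rule entry.pullback_in_dual[OF \<phi>D])
        let ?f = "\<lambda>F. \<eta> (matrix_eval X F $$ (i, j))"
        have f: "pullback Y (\<lambda>F. F $$ p) \<phi> F = ?f F" if "F \<in> Y.carr" for F
          using that entry.maps[OF that] ij
          by (simp add: eq pullback_def matrix_eval_entry[of _ k] mat_Hinf_simps)
        have "continuous_map (weak_topology Y \<X>) euclidean ?f"
          using continuous_map_compose[OF cont[OF X] block_functional_continuous[OF \<eta> ij(2,3)]]
          by (simp add: o_def)
        then have "(\<lambda>F\<in>Y.carr. ?f F) \<in> \<X>"
        proof (rule Y.weakly_continuous_functional[OF \<X>, rotated 2])
          fix F G assume FG: "F \<in> Y.carr" "G \<in> Y.carr"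
          show "?f (ns_add Y F G) = ?f F + ?f G"
            using Y.dual_add_apply[OF pb FG] unfolding f[OF FG(1)] f[OF FG(2)] f[OF Y.add_closed[OF FG]] .
        next
          fix c F assume F: "F \<in> Y.carr"
          show "?f (ns_scale Y c F) = c * ?f F"
            using Y.dual_scale_apply[OF pb F] unfolding f[OF F] f[OF Y.scale_closed[OF F]] .
        qed
        moreover have "(\<lambda>F\<in>Y.carr. ?f F) = pullback Y (\<lambda>F. F $$ p) \<phi>"
          using f by (intro extensionalityI[of _ "Y.carr"]) (auto simp: pullback_def)
        ultimately show "\<phi> \<in> ?W" using \<phi>D by simp
      qed
    qed
    with \<phi> show ?thesis by blast
  qed
  show ?thesis
  proof
    fix \<psi> assume "\<psi> \<in> predual_Xk k Q"
    then obtain \<phi> where \<psi>: "\<psi> = (\<lambda>F\<in>Y.carr. \<Sum>p\<in>indices. \<phi> p (F $$ p))"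
      and \<phi>: "\<And>p. p \<in> indices \<Longrightarrow> \<phi> p \<in> predual_X Q" unfolding predual_Xk_eq_sums by blast
    have "\<psi> = (\<lambda>F\<in>Y.carr. \<Sum>p\<in>indices. 1 * pullback Y (\<lambda>F. F $$ p) (\<phi> p) F)"
      unfolding \<psi> by (intro restrict_ext) (simp add: pullback_def)
    then show "\<psi> \<in> \<X>"
      using Y.subspace_sum[OF \<X>, of indices "\<lambda>p. pullback Y (\<lambda>F. F $$ p) (\<phi> p)" "\<lambda>_. 1"] entry \<phi> by simp
  qed
qed

end

theorem proposition4p2:
  fixes Q :: "'d::finite \<Rightarrow> 'h::complex_hilbert_space \<Rightarrow> 'h"
    and E :: "('h \<Rightarrow> 'h) set"
    and k :: nat
  assumes "operator_space_basis E Q"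
    and "1 \<le> k"
  shows "\<forall>\<X>. (is_predual (mat_Hinf k Q) \<X> \<and>
                (\<forall>n. \<forall>X\<in>nc_ball_at Q n.
                   continuous_map (weak_topology (mat_Hinf k Q) \<X>)
                     (norm_topology (block_mat_space k n)) (matrix_eval X)))
             \<longleftrightarrow> \<X> = predual_Xk k Q"
proof -
  interpret nc_matrix_functions Q k
    using assms(1) by unfold_locales (simp add: operator_space_basis_def)
  show ?thesis
  proof (intro allI iffI)
    fix \<X> assume \<X>: "is_predual (mat_Hinf k Q) \<X> \<and> (\<forall>n. \<forall>X\<in>nc_ball_at Q n.
      continuous_map (weak_topology (mat_Hinf k Q) \<X>) (norm_topology (block_mat_space k n)) (matrix_eval X))"
    then have "predual_Xk k Q \<subseteq> \<X>"
      by (intro predual_Xk_minimal) (auto simp: is_predual_def)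
    then show "\<X> = predual_Xk k Q"
      using Y.predual_not_included[OF predual_Xk_is_predual] \<X> by blast
  qed (simp add: predual_Xk_is_predual matrix_eval_weakly_continuous)
qed

end
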